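(* Let $k$ be a Noetherian commutative ring, $A$ a filtered $k$-algebra with $A/F^1A=k$ (that is, the composition $k\to A\to A/F^1A$ is an isomorphism), $\mathbf h\colon\mathbb Z\to\mathbb Z$ a finite function, and $C\in\mathbb{AF}_A^{\mathbf h}$. Assume the graded $G_\bullet A$-module $G_\bullet C$ is level. Then so is $C$.
   Context: A filtered $k$-algebra $A$ has a descending chain of ideals $F^mA$, $m\in\mathbb Z$, with $F^mA=A$ for $m\le0$ and $F^mA\cdot F^nA\subset F^{m+n}A$. A filtered $A$-module $C$ has a descending chain of $A$-submodules $F^nC$ with $F^mA\cdot F^nC\subset F^{m+n}C$; $G_nC:=F^nC/F^{n+1}C$ and $G_\bullet C:=\bigoplus_nG_nC$, a graded module over $G_\bullet A$ (filtered by $F^n=\bigoplus_{p\ge n}$ of its graded pieces). A finite function has finitely many nonzero values; put $s:=\sup\{n:\mathbf h(n)\ne0\}$ (with $\mathbf h\neq0$). $\mathbb{AF}_A^{\mathbf h}$ is the collection of filtered $A$-modules $C$ with $F^nC=C$ for $n\ll0$, $F^nC=0$ for $n\gg0$, and each $G_nC$ locally free over $k$ of rank $\mathbf h(n)$. $C^*:=\mathrm{Hom}_k(C,k)$ with $(af)(\psi)=f(a\psi)$ and $F^p(C^* ):=(C/F^{1-p}C)^*$; then $G_n(C^* )=(G_{-n}C)^*$, so $F^{-s}(C^* )=C^*$. $k$ is an $A$-module via $A\to A/F^1A=k$ (and a $G_\bullet A$-module via $G_\bullet A\to G_0A=k$). $C$ is level if $C^*\otimes_Ak=G_{-s}(C^*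 )$, i.e. if the canonical surjection $C^*\otimes_Ak\to G_{-s}(C^* )=C^*/F^{1-s}(C^* )$ is an isomorphism; for $G_\bullet C$ the same definition is used over $G_\bullet A$ (equivalently $((G_\bullet C)^* )_{-s}$ generates $(G_\bullet C)^*$ over $G_\bullet A$). *)

theory Defs
  imports "HOL-Algebra.Free_Abelian_Groups" "HOL-Algebra.QuotRing" "HOL-Algebra.Ring_Divisibility" "HOL-Algebra.Module"
begin

text \<open>
  Modules are records of type \<open>('r, 'm) module\<close> from HOL-Algebra. Their inherited
  fields \<open>mult\<close> and \<open>one\<close> carry no information for a module which is not an algebra, and
  are left \<open>undefined\<close>.
\<close>

section \<open>Constructions on modules\<close>

definition self_module :: "('r, 'x) ring_scheme \<Rightarrow> ('r, 'r) module" where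
  "self_module R = \<lparr>carrier = carrier R, monoid.mult = monoid.mult R, one = one R, ring.zero = ring.zero R,
     add = add R, smult = monoid.mult R\<rparr>"

definition submodule_of :: "('r, 'm) module \<Rightarrow> 'm set \<Rightarrow> ('r, 'm) module" where
  "submodule_of M N = M\<lparr>carrier := N\<rparr>"

definition quot_module :: "('r, 'm) module \<Rightarrow> 'm set \<Rightarrow> ('r, 'm set) module" where
  "quot_module M N = \<lparr>carrier = a_rcosets\<^bsub>M\<^esub> N, monoid.mult = undefined, one = undefined, ring.zero = N,
     add = set_add M, smult = (\<lambda>r U. \<Union>x\<in>U. N +>\<^bsub>M\<^esub> (r \<odot>\<^bsub>M\<^esub> x))\<rparr>"

definition restrict_scalars ::
    "('k, 'x) ring_scheme \<Rightarrow> ('k, 'a) module \<Rightarrow> ('a, 'm) module \<Rightarrow> ('k, 'm) module" where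
  "restrict_scalars k A M = \<lparr>carrier = carrier M, monoid.mult = monoid.mult M, one = one M, ring.zero = ring.zero M,
     add = add M, smult = (\<lambda>c x. (c \<odot>\<^bsub>A\<^esub> \<one>\<^bsub>A\<^esub>) \<odot>\<^bsub>M\<^esub> x)\<rparr>"

definition lin_maps ::
    "('r, 'x) ring_scheme \<Rightarrow> ('r, 'm) module \<Rightarrow> ('r, 'n) module \<Rightarrow> ('m \<Rightarrow> 'n) set" where
  "lin_maps R M N = {f \<in> carrier M \<rightarrow>\<^sub>E carrier N.
     (\<forall>x\<in>carrier M. \<forall>y\<in>carrier M. f (x \<oplus>\<^bsub>M\<^esub> y) = f x \<oplus>\<^bsub>N\<^esub> f y) \<and>
     (\<forall>r\<in>carrier R. \<forall>x\<in>carrier M. f (r \<odot>\<^bsub>M\<^esub> x) = r \<odot>\<^bsub>N\<^esub> f x)}"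

text \<open>The direct sum of a family indexed by the integers: families of finite support.\<close>

definition direct_sum :: "(int \<Rightarrow> ('r, 'm) module) \<Rightarrow> ('r, int \<Rightarrow> 'm) module" where
  "direct_sum M = \<lparr>carrier = {x. (\<forall>n. x n \<in> carrier (M n)) \<and> finite {n. x n \<noteq> \<zero>\<^bsub>M n\<^esub>}},
     monoid.mult = undefined, one = undefined, ring.zero = (\<lambda>n. \<zero>\<^bsub>M n\<^esub>),
     add = (\<lambda>x y n. x n \<oplus>\<^bsub>M n\<^esub> y n), smult = (\<lambda>r x n. r \<odot>\<^bsub>M n\<^esub> x n)\<rparr>"


section \<open>Tensor products\<close>

text \<open>
  The tensor product over a commutative ring is the free abelian group on pairs modulo
  the subgroup generated by the usual relations; the scalars act through the left factor.
\<close>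

definition tensor_rels ::
    "('r, 'x) ring_scheme \<Rightarrow> ('r, 'm) module \<Rightarrow> ('r, 'n) module \<Rightarrow> (('m \<times> 'n) \<Rightarrow>\<^sub>0 int) set" where
  "tensor_rels R M N =
     {frag_of (x \<oplus>\<^bsub>M\<^esub> x', y) - frag_of (x, y) - frag_of (x', y) | x x' y.
        x \<in> carrier M \<and> x' \<in> carrier M \<and> y \<in> carrier N} \<union>
     {frag_of (x, y \<oplus>\<^bsub>N\<^esub> y') - frag_of (x, y) - frag_of (x, y') | x y y'.
        x \<in> carrier M \<and> y \<in> carrier N \<and> y' \<in> carrier N} \<union>
     {frag_of (r \<odot>\<^bsub>M\<^esub> x, y) - frag_of (x, r \<odot>\<^bsub>N\<^esub> y) | r x y.
        r \<in> carrier R \<and> x \<in> carrier M \<and> y \<in> carrier N}"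

definition tensor_kernel ::
    "('r, 'x) ring_scheme \<Rightarrow> ('r, 'm) module \<Rightarrow> ('r, 'n) module \<Rightarrow> (('m \<times> 'n) \<Rightarrow>\<^sub>0 int) set" where
  "tensor_kernel R M N =
     generate (free_Abelian_group (carrier M \<times> carrier N)) (tensor_rels R M N)"

definition tensor_class ::
    "('r, 'x) ring_scheme \<Rightarrow> ('r, 'm) module \<Rightarrow> ('r, 'n) module \<Rightarrow>
     (('m \<times> 'n) \<Rightarrow>\<^sub>0 int) \<Rightarrow> (('m \<times> 'n) \<Rightarrow>\<^sub>0 int) set" where
  "tensor_class R M N z =
     tensor_kernel R M N #>\<^bsub>free_Abelian_group (carrier M \<times> carrier N)\<^esub> z"

definition tensor_product ::
    "('r, 'x) ring_scheme \<Rightarrow> ('r, 'm) module \<Rightarrow> ('r, 'n) module \<Rightarrow>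
     ('r, (('m \<times> 'n) \<Rightarrow>\<^sub>0 int) set) module" where
  "tensor_product R M N =
     (let Q = free_Abelian_group (carrier M \<times> carrier N) Mod tensor_kernel R M N in
      \<lparr>carrier = carrier Q, monoid.mult = undefined, one = undefined, ring.zero = one Q, add = monoid.mult Q,
       smult = (\<lambda>r U. \<Union>z\<in>U.
         tensor_class R M N (frag_extend (\<lambda>(x, y). frag_of (r \<odot>\<^bsub>M\<^esub> x, y)) z))\<rparr>)"

definition pure_tensor ::
    "('r, 'x) ring_scheme \<Rightarrow> ('r, 'm) module \<Rightarrow> ('r, 'n) module \<Rightarrow>
     'm \<Rightarrow> 'n \<Rightarrow> (('m \<times> 'n) \<Rightarrow>\<^sub>0 int) set" where
  "pure_tensor R M N x y = tensor_class R M N (frag_of (x, y))"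


section \<open>Localization and locally free modules\<close>

definition powers_of :: "('r, 'x) ring_scheme \<Rightarrow> 'r \<Rightarrow> 'r set" where
  "powers_of R f = {f [^]\<^bsub>R\<^esub> n | n :: nat. True}"

text \<open>The fraction \<open>m / s\<close>, as an equivalence class of pairs.\<close>

definition fraction ::
    "('r, 'm) module \<Rightarrow> 'r set \<Rightarrow> 'm \<Rightarrow> 'r \<Rightarrow> ('m \<times> 'r) set" where
  "fraction M S m s = {(m', s') \<in> carrier M \<times> S.
     \<exists>u\<in>S. u \<odot>\<^bsub>M\<^esub> (s' \<odot>\<^bsub>M\<^esub> m) = u \<odot>\<^bsub>M\<^esub> (s \<odot>\<^bsub>M\<^esub> m')}"

definition loc_module ::
    "('r, 'x) ring_scheme \<Rightarrow> 'r set \<Rightarrow> ('r, 'm) module \<Rightarrow> (('r \<times> 'r) set, ('m \<times> 'r) set) module" where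
  "loc_module R S M = \<lparr>carrier = {fraction M S m s | m s. m \<in> carrier M \<and> s \<in> S},
     monoid.mult = undefined, one = undefined, ring.zero = fraction M S \<zero>\<^bsub>M\<^esub> \<one>\<^bsub>R\<^esub>,
     add = (\<lambda>U V. \<Union>(m, s)\<in>U. \<Union>(n, t)\<in>V.
       fraction M S ((t \<odot>\<^bsub>M\<^esub> m) \<oplus>\<^bsub>M\<^esub> (s \<odot>\<^bsub>M\<^esub> n)) (s \<otimes>\<^bsub>R\<^esub> t)),
     smult = (\<lambda>U V. \<Union>(r, s)\<in>U. \<Union>(m, t)\<in>V. fraction M S (r \<odot>\<^bsub>M\<^esub> m) (s \<otimes>\<^bsub>R\<^esub> t))\<rparr>"

definition loc_ring :: "('r, 'x) ring_scheme \<Rightarrow> 'r set \<Rightarrow> ('r \<times> 'r) set ring" where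
  "loc_ring R S =
     (let L = loc_module R S (self_module R) in
      \<lparr>carrier = carrier L, monoid.mult = smult L, one = fraction (self_module R) S \<one>\<^bsub>R\<^esub> \<one>\<^bsub>R\<^esub>,
       ring.zero = ring.zero L, add = add L\<rparr>)"

definition free_of_rank :: "('r, 'x) ring_scheme \<Rightarrow> ('r, 'm) module \<Rightarrow> nat \<Rightarrow> bool" where
  "free_of_rank R M r \<longleftrightarrow> (\<exists>b \<in> {..<r} \<rightarrow> carrier M. \<forall>x\<in>carrier M.
     \<exists>!c. c \<in> {..<r} \<rightarrow>\<^sub>E carrier R \<and> x = (\<Oplus>\<^bsub>M\<^esub>i\<in>{..<r}. c i \<odot>\<^bsub>M\<^esub> b i))"

text \<open>
  Local freeness on the spectrum: every prime has a basic open neighbourhood on which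
  the module becomes free of the given rank. The rank is an integer, since Hilbert functions
  are integer-valued.
\<close>

definition locally_free_of_rank :: "('r, 'x) ring_scheme \<Rightarrow> ('r, 'm) module \<Rightarrow> int \<Rightarrow> bool" where
  "locally_free_of_rank R M r \<longleftrightarrow> (\<forall>P. primeideal P R \<longrightarrow>
     (\<exists>f \<in> carrier R - P. \<exists>n. int n = r \<and>
        free_of_rank (loc_ring R (powers_of R f)) (loc_module R (powers_of R f) M) n))"


section \<open>Filtered algebras and modules\<close>

locale filtered_algebra = algebra k A
  for k :: "('k, 'x) ring_scheme" and A :: "('k, 'a) module" and F :: "int \<Rightarrow> 'a set" +
  assumes filt_ideal: "ideal (F m) A"
    and filt_decreasing: "m \<le> n \<Longrightarrow> F n \<subseteq> F m"
    and filt_nonpos: "m \<le> 0 \<Longrightarrow> F m = carrier A"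
    and filt_mult: "\<lbrakk>a \<in> F m; b \<in> F n\<rbrakk> \<Longrightarrow> a \<otimes>\<^bsub>A\<^esub> b \<in> F (m + n)"

locale filtered_module = module A C
  for A :: "('k, 'a) module" and FA :: "int \<Rightarrow> 'a set"
    and C :: "('a, 'c) module" and F :: "int \<Rightarrow> 'c set" +
  assumes filt_submodule: "submodule (F n) A C"
    and filt_decreasing: "m \<le> n \<Longrightarrow> F n \<subseteq> F m"
    and filt_smult: "\<lbrakk>a \<in> FA m; x \<in> F n\<rbrakk> \<Longrightarrow> a \<odot>\<^bsub>C\<^esub> x \<in> F (m + n)"

definition gr_piece :: "('r, 'm) module \<Rightarrow> (int \<Rightarrow> 'm set) \<Rightarrow> int \<Rightarrow> ('r, 'm set) module" where
  "gr_piece M F n = quot_module (submodule_of M (F n)) (F (n + 1))"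

text \<open>
  The product of a class of degree \<open>i\<close> and a class of degree \<open>j\<close>, as a class of degree
  \<open>i + j\<close> in the graded object associated to \<open>(M, F)\<close>.
\<close>

definition gr_act ::
    "('r, 'm) module \<Rightarrow> (int \<Rightarrow> 'm set) \<Rightarrow> ('a \<Rightarrow> 'm \<Rightarrow> 'm) \<Rightarrow>
     int \<Rightarrow> int \<Rightarrow> 'a set \<Rightarrow> 'm set \<Rightarrow> 'm set" where
  "gr_act M F act i j U V = (\<Union>x\<in>U. \<Union>y\<in>V. F (i + j + 1) +>\<^bsub>M\<^esub> act x y)"

definition gr_algebra ::
    "('k, 'a) module \<Rightarrow> (int \<Rightarrow> 'a set) \<Rightarrow> ('k, int \<Rightarrow> 'a set) module" where
  "gr_algebra A F = (direct_sum (gr_piece A F))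
     \<lparr>monoid.mult := (\<lambda>a b n. \<Oplus>\<^bsub>gr_piece A F n\<^esub>i\<in>{i. a i \<noteq> \<zero>\<^bsub>gr_piece A F i\<^esub>}.
                 gr_act A F (monoid.mult A) i (n - i) (a i) (b (n - i))),
      one := (\<lambda>n. if n = 0 then F 1 +>\<^bsub>A\<^esub> \<one>\<^bsub>A\<^esub> else \<zero>\<^bsub>gr_piece A F n\<^esub>)\<rparr>"

definition gr_module ::
    "('k, 'a) module \<Rightarrow> (int \<Rightarrow> 'a set) \<Rightarrow> ('a, 'c) module \<Rightarrow> (int \<Rightarrow> 'c set) \<Rightarrow>
     (int \<Rightarrow> 'a set, int \<Rightarrow> 'c set) module" where
  "gr_module A FA C FC =
     (let D = direct_sum (gr_piece C FC) in
      \<lparr>carrier = carrier D, monoid.mult = undefined, one = undefined, ring.zero = ring.zero D, add = add D,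
       smult = (\<lambda>a x n. \<Oplus>\<^bsub>gr_piece C FC n\<^esub>i\<in>{i. a i \<noteq> \<zero>\<^bsub>gr_piece A FA i\<^esub>}.
                 gr_act C FC (smult C) i (n - i) (a i) (x (n - i)))\<rparr>)"

definition gr_filt :: "('r, 'c) module \<Rightarrow> (int \<Rightarrow> 'c set) \<Rightarrow> int \<Rightarrow> (int \<Rightarrow> 'c set) set" where
  "gr_filt C FC n = {x \<in> carrier (direct_sum (gr_piece C FC)). \<forall>p<n. x p = \<zero>\<^bsub>gr_piece C FC p\<^esub>}"

definition AF ::
    "('k, 'x) ring_scheme \<Rightarrow> ('k, 'a) module \<Rightarrow> (int \<Rightarrow> 'a set) \<Rightarrow> (int \<Rightarrow> int) \<Rightarrow>
     ('a, 'c) module \<Rightarrow> (int \<Rightarrow> 'c set) \<Rightarrow> bool" where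
  "AF k A FA h C FC \<longleftrightarrow> filtered_module A FA C FC \<and>
     (\<exists>m. \<forall>n\<le>m. FC n = carrier C) \<and> (\<exists>m. \<forall>n\<ge>m. FC n = {\<zero>\<^bsub>C\<^esub>}) \<and>
     (\<forall>n. locally_free_of_rank k (restrict_scalars k A (gr_piece C FC n)) (h n))"


section \<open>Duals and level modules\<close>

definition dual ::
    "('k, 'x) ring_scheme \<Rightarrow> ('k, 'a) module \<Rightarrow> ('a, 'c) module \<Rightarrow> ('a, 'c \<Rightarrow> 'k) module" where
  "dual k A C = \<lparr>carrier = lin_maps k (restrict_scalars k A C) (self_module k),
     monoid.mult = undefined, one = undefined, ring.zero = (\<lambda>x\<in>carrier C. \<zero>\<^bsub>k\<^esub>),
     add = (\<lambda>f g. \<lambda>x\<in>carrier C. f x \<oplus>\<^bsub>k\<^esub> g x),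
     smult = (\<lambda>a f. \<lambda>x\<in>carrier C. f (a \<odot>\<^bsub>C\<^esub> x))\<rparr>"

text \<open>The dual of \<open>C / F\<^sup>1\<^sup>-\<^sup>p C\<close> is embedded in the dual of \<open>C\<close> by composition with the projection.\<close>

definition dual_filt ::
    "('k, 'x) ring_scheme \<Rightarrow> ('k, 'a) module \<Rightarrow> ('a, 'c) module \<Rightarrow> (int \<Rightarrow> 'c set) \<Rightarrow>
     int \<Rightarrow> ('c \<Rightarrow> 'k) set" where
  "dual_filt k A C F p = {(\<lambda>x\<in>carrier C. g (F (1 - p) +>\<^bsub>C\<^esub> x)) | g.
     g \<in> carrier (dual k A (quot_module C (F (1 - p))))}"

definition residue_map ::
    "('k, 'a) module \<Rightarrow> (int \<Rightarrow> 'a set) \<Rightarrow> 'k \<Rightarrow> 'a set" where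
  "residue_map A F c = F 1 +>\<^bsub>A\<^esub> (c \<odot>\<^bsub>A\<^esub> \<one>\<^bsub>A\<^esub>)"

text \<open>
  The maps from \<open>A\<close> to \<open>k\<close> and from \<open>G A\<close> to \<open>k\<close> obtained by inverting the
  isomorphism of \<open>k\<close> with \<open>A / F\<^sup>1 A\<close>, which is also the degree \<open>0\<close> piece of \<open>G A\<close>.
\<close>

definition augmentation ::
    "('k, 'x) ring_scheme \<Rightarrow> ('k, 'a) module \<Rightarrow> (int \<Rightarrow> 'a set) \<Rightarrow> 'a \<Rightarrow> 'k" where
  "augmentation k A F a = the_inv_into (carrier k) (residue_map A F) (F 1 +>\<^bsub>A\<^esub> a)"

definition gr_augmentation ::
    "('k, 'x) ring_scheme \<Rightarrow> ('k, 'a) module \<Rightarrow> (int \<Rightarrow> 'a set) \<Rightarrow> (int \<Rightarrow> 'a set) \<Rightarrow> 'k" where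
  "gr_augmentation k A F a = the_inv_into (carrier k) (residue_map A F) (a 0)"

definition residue_module :: "('k, 'x) ring_scheme \<Rightarrow> ('a \<Rightarrow> 'k) \<Rightarrow> ('a, 'k) module" where
  "residue_module k \<epsilon> = \<lparr>carrier = carrier k, monoid.mult = monoid.mult k, one = one k, ring.zero = ring.zero k,
     add = add k, smult = (\<lambda>a c. \<epsilon> a \<otimes>\<^bsub>k\<^esub> c)\<rparr>"

text \<open>
  The canonical map sends \<open>f \<otimes> c\<close> to the class of \<open>c f\<close>. Pure tensors generate the tensor
  product, so at most one linear map does so, and the condition below says that the canonical
  map is an isomorphism. The target \<open>G\<^sub>-\<^sub>s\<close> of the dual is the last quotient of the dual as
  soon as \<open>F\<^sup>s\<^sup>+\<^sup>1 C = 0\<close>.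
\<close>

definition level ::
    "('k, 'x) ring_scheme \<Rightarrow> ('k, 'a) module \<Rightarrow> ('a \<Rightarrow> 'k) \<Rightarrow>
     ('a, 'c) module \<Rightarrow> (int \<Rightarrow> 'c set) \<Rightarrow> int \<Rightarrow> bool" where
  "level k A \<epsilon> C F s \<longleftrightarrow>
     (let D = dual k A C; K = residue_module k \<epsilon>;
          T = tensor_product A D K; G = gr_piece D (dual_filt k A C F) (- s) in
      \<exists>\<phi> \<in> lin_maps A T G. bij_betw \<phi> (carrier T) (carrier G) \<and>
        (\<forall>f\<in>carrier D. \<forall>c\<in>carrier k.
           \<phi> (pure_tensor A D K f c) =
             dual_filt k A C F (1 - s) +>\<^bsub>D\<^esub> (c \<odot>\<^bsub>restrict_scalars k A D\<^esub> f)))"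

definition top_degree :: "(int \<Rightarrow> int) \<Rightarrow> int" where
  "top_degree h = Sup {n. h n \<noteq> 0}"

end

theory Submission
  imports Defs
begin

text \<open>
  Write \<open>D\<close> for the dual of \<open>C\<close>, so that \<open>F\<^sup>1\<^sup>-\<^sup>s D\<close> consists of the functionals vanishing on \<open>F\<^sup>s C\<close>.
  Since the tensor product of \<open>D\<close> with the residue ring is \<open>D / (F\<^sup>1 A \<cdot> D)\<close>, the module \<open>C\<close> is level if and
  only if every functional vanishing on \<open>F\<^sup>s C\<close> lies in \<open>F\<^sup>1 A \<cdot> D\<close>. Suppose \<open>f\<close> vanishes on \<open>F\<^sup>n\<^sup>+\<^sup>1 C\<close>
  with \<open>n < s\<close>. It induces a functional on \<open>G\<^sub>n C\<close> and, extended by zero, one on the graded module;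
  levelness of the latter writes it as \<open>x \<mapsto> \<Sum> \<psi>\<^sub>j (a\<^sub>j x)\<close> with \<open>a\<^sub>j\<close> of degree \<open>j > 0\<close> and \<open>\<psi>\<^sub>j\<close> a functional
  on \<open>G\<^sub>n\<^sub>+\<^sub>j C\<close>. Because the graded pieces are locally free, the \<open>\<psi>\<^sub>j\<close> lift to functionals on \<open>C\<close>, so \<open>f\<close> agrees
  on \<open>F\<^sup>n C\<close> with an element of \<open>F\<^sup>1 A \<cdot> D\<close>, and the difference vanishes on \<open>F\<^sup>n C\<close>. Induction on \<open>n\<close>,
  starting where \<open>F\<^sup>n C = C\<close>, finishes the proof.
\<close>

section \<open>Modules\<close>

text \<open>The proof never establishes that \<open>gr_algebra\<close> is a ring or that
  \<open>gr_module\<close> is a module over it, so on the graded side the tensor product is not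
  identified with a quotient of the dual. Levelness is instead read off from the presentation.
  Injectivity of the canonical map puts the difference of the generators
  \<open>(\<phi>, \<one>)\<close> and \<open>(\<zero>, \<one>)\<close> into the subgroup generated
  by the tensor relations. A homomorphism from the free abelian group to the functions from one step
  of the filtration of \<open>C\<close> to \<open>k\<close> is then tested on each kind of relation;
  the balancing relation is the one that produces elements of F^1 A times the dual. Local freeness
  gives bases only after inverting some f, with exponents and coefficients depending on the element.
  Each global statement is therefore recast as the claim that a certain ideal of scalars contains 1.
  The Noetherian hypothesis provides maximal ideals above proper ones, and a single power of f that
  kills all f-power torsion; the latter turns coordinates chosen element by element into linear
  maps.\<close>

lemma module_cong:
  fixes M N :: "('r, 'm) module"
  assumes "module R M" "carrier N = carrier M" "add N = add M" "ring.zero N = ring.zero M"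
    and "\<And>r x. r \<in> carrier R \<Longrightarrow> x \<in> carrier M \<Longrightarrow> r \<odot>\<^bsub>N\<^esub> x = r \<odot>\<^bsub>M\<^esub> x"
  shows "module R N"
proof -
  interpret M: module R M by fact
  have e: "add_monoid N = add_monoid M" using assms by simp
  have "abelian_group N"
    using M.abelian_group_axioms e unfolding abelian_group_def abelian_monoid_def abelian_group_axioms_def
    by simp
  then show ?thesis
    by (intro moduleI) (use assms in \<open>auto simp: M.is_cring M.smult_l_distr M.smult_r_distr M.smult_assoc1\<close>)
qed

section \<open>Quotients and submodules of a fixed module\<close>

context
  fixes R :: "('r, 'x) ring_scheme" and M :: "('r, 'm) module"
  assumes R_M_module: "module R M"
begin

interpretation module R M by (rule R_M_module)

lemma submodule_abelian_subgroup:
  assumes "submodule N R M"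
  shows "abelian_subgroup N M"
  using assms by (intro abelian_subgroupI3 additive_subgroup.intro)
    (auto simp: submodule_def M.abelian_group_axioms)

lemma coset_eq_iff:
  assumes "submodule N R M" "x \<in> carrier M" "y \<in> carrier M"
  shows "N +>\<^bsub>M\<^esub> x = N +>\<^bsub>M\<^esub> y \<longleftrightarrow> x \<ominus>\<^bsub>M\<^esub> y \<in> N"
proof -
  interpret N: abelian_subgroup N M by (rule submodule_abelian_subgroup) fact
  have "N +>\<^bsub>M\<^esub> x = N +>\<^bsub>M\<^esub> y \<longleftrightarrow> x \<in> N +>\<^bsub>M\<^esub> y"
    using assms(2,3) N.a_repr_independence'[of x y] N.a_repr_independenceD[of x y] by metis
  then show ?thesis
    using assms(2,3) N.a_rcos_module[of y x] by (simp add: a_minus_def)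
qed

lemma coset_eq_self_iff:
  assumes "submodule N R M" "x \<in> carrier M"
  shows "N +>\<^bsub>M\<^esub> x = N \<longleftrightarrow> x \<in> N"
proof -
  interpret N: abelian_subgroup N M by (rule submodule_abelian_subgroup) fact
  show ?thesis using assms N.a_rcos_const N.a_rcos_self by blast
qed

lemma carrier_quot_module:
  "carrier (quot_module M N) = (\<lambda>x. N +>\<^bsub>M\<^esub> x) ` carrier M"
  by (auto simp: quot_module_def A_RCOSETS_def')

lemma quot_module_add:
  assumes "submodule N R M" "x \<in> carrier M" "y \<in> carrier M"
  shows "(N +>\<^bsub>M\<^esub> x) \<oplus>\<^bsub>quot_module M N\<^esub> (N +>\<^bsub>M\<^esub> y) = N +>\<^bsub>M\<^esub> (x \<oplus>\<^bsub>M\<^esub> y)"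
proof -
  interpret N: abelian_subgroup N M by (rule submodule_abelian_subgroup) fact
  show ?thesis using assms by (simp add: quot_module_def N.a_rcos_sum)
qed

text \<open>Scalars act on a coset by a union over all its representatives. The union collapses
  because two representatives differ by an element of \<open>N\<close>, and \<open>N\<close> is
  stable under scalars.\<close>

lemma quot_module_smult:
  assumes "submodule N R M" "r \<in> carrier R" "x \<in> carrier M"
  shows "r \<odot>\<^bsub>quot_module M N\<^esub> (N +>\<^bsub>M\<^esub> x) = N +>\<^bsub>M\<^esub> (r \<odot>\<^bsub>M\<^esub> x)"
proof -
  interpret N: abelian_subgroup N M by (rule submodule_abelian_subgroup) fact
  have "N +>\<^bsub>M\<^esub> (r \<odot>\<^bsub>M\<^esub> y) = N +>\<^bsub>M\<^esub> (r \<odot>\<^bsub>M\<^esub> x)" if y: "y \<in> N +>\<^bsub>M\<^esub> x" for y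
  proof -
    have yc: "y \<in> carrier M" using N.a_elemrcos_carrier assms y by blast
    have "y \<ominus>\<^bsub>M\<^esub> x \<in> N" using N.a_rcos_module_imp[OF assms(3) y] by (simp add: a_minus_def)
    then have "r \<odot>\<^bsub>M\<^esub> (y \<ominus>\<^bsub>M\<^esub> x) \<in> N" using submodule.smult_closed[OF assms(1,2)] by metis
    moreover have "r \<odot>\<^bsub>M\<^esub> (y \<ominus>\<^bsub>M\<^esub> x) = r \<odot>\<^bsub>M\<^esub> y \<ominus>\<^bsub>M\<^esub> r \<odot>\<^bsub>M\<^esub> x"
      using assms(2,3) yc
      by (simp only: a_minus_def smult_r_distr smult_r_minus M.a_inv_closed smult_closed)
    ultimately show ?thesis
      using coset_eq_iff[OF assms(1) smult_closed[OF assms(2) yc] smult_closed[OF assms(2,3)]]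
      by metis
  qed
  moreover have "x \<in> N +>\<^bsub>M\<^esub> x" using N.a_rcos_self assms by blast
  ultimately have "(\<Union>y\<in>N +>\<^bsub>M\<^esub> x. N +>\<^bsub>M\<^esub> (r \<odot>\<^bsub>M\<^esub> y)) = N +>\<^bsub>M\<^esub> (r \<odot>\<^bsub>M\<^esub> x)"
    by blast
  then show ?thesis by (simp add: quot_module_def)
qed

lemma quot_module_zero: "\<zero>\<^bsub>quot_module M N\<^esub> = N"
  by (simp add: quot_module_def)

lemma quot_module_is_module:
  assumes "submodule N R M"
  shows "module R (quot_module M N)" (is "module R ?Q")
proof -
  interpret N: abelian_subgroup N M by (rule submodule_abelian_subgroup) fact
  have N0: "N = N +>\<^bsub>M\<^esub> \<zero>\<^bsub>M\<^esub>" using coset_eq_self_iff[OF assms M.zero_closed] N.zero_closed by simp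
  note q = carrier_quot_module quot_module_add[OF assms] quot_module_zero
  have "abelian_group ?Q"
  proof (rule abelian_groupI)
    show "\<zero>\<^bsub>?Q\<^esub> \<in> carrier ?Q" using N0 by (auto simp: q)
    fix U assume "U \<in> carrier ?Q"
    then obtain x where x: "x \<in> carrier M" and U: "U = N +>\<^bsub>M\<^esub> x" by (auto simp: q)
    have "\<zero>\<^bsub>?Q\<^esub> \<oplus>\<^bsub>?Q\<^esub> U = N +>\<^bsub>M\<^esub> (\<zero>\<^bsub>M\<^esub> \<oplus>\<^bsub>M\<^esub> x)"
      using quot_module_add[OF assms M.zero_closed x] N0 by (simp add: quot_module_zero U)
    then show "\<zero>\<^bsub>?Q\<^esub> \<oplus>\<^bsub>?Q\<^esub> U = U" using x by (simp add: U)
    have "(N +>\<^bsub>M\<^esub> (\<ominus>\<^bsub>M\<^esub> x)) \<oplus>\<^bsub>?Q\<^esub> U = \<zero>\<^bsub>?Q\<^esub>"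
      using x N0 by (simp add: U q M.l_neg)
    then show "\<exists>V\<in>carrier ?Q. V \<oplus>\<^bsub>?Q\<^esub> U = \<zero>\<^bsub>?Q\<^esub>"
      using x by (auto simp: carrier_quot_module)
  qed (auto simp: q M.a_ac)
  then show ?thesis
    using assms by (intro moduleI)
      (auto simp: carrier_quot_module quot_module_add quot_module_smult is_cring
        smult_l_distr smult_r_distr smult_assoc1)
qed

lemma submodule_of_is_module:
  assumes "submodule N R M"
  shows "module R (submodule_of M N)"
  using submodule.submodule_is_module[OF assms module_axioms] by (simp add: submodule_of_def)

lemma submodule_of_submodule:
  assumes "submodule N R M" "submodule L R M" "N \<subseteq> L"
  shows "submodule N R (submodule_of M L)"
proof -
  interpret L: module R "submodule_of M L" by (rule submodule_of_is_module) fact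
  have "module R (M\<lparr>carrier := N\<rparr>)"
    using submodule.submodule_is_module[OF assms(1) module_axioms] .
  then show ?thesis
    by (intro L.module_incl_imp_submodule) (use assms in \<open>auto simp: submodule_of_def\<close>)
qed

end

section \<open>Ideals and the local-to-global principle\<close>

text \<open>In a Noetherian ring the union of a nonempty chain of ideals is a member of the chain,
  so the upper bound required by Zorn's lemma is again an ideal above \<open>I\<close> avoiding
  1.\<close>

lemma (in noetherian_ring) exists_maximalideal_above:
  assumes I: "ideal I R" and "I \<noteq> carrier R"
  shows "\<exists>P. maximalideal P R \<and> I \<subseteq> P"
proof -
  let ?A = "{J. ideal J R \<and> I \<subseteq> J \<and> \<one> \<notin> J}"
  have one: "\<one> \<notin> I" using assms ideal.one_imp_carrier by blast
  have "\<exists>P\<in>?A. \<forall>X\<in>?A. P \<subseteq> X \<longrightarrow> X = P"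
  proof (rule subset_Zorn_nonempty)
    show "?A \<noteq> {}" using I one by blast
    fix C assume C: "C \<noteq> {}" "subset.chain ?A C"
    then have "subset.chain {I. ideal I R} C" by (auto simp: subset.chain_def)
    then have "\<Union>C \<in> C" using ideal_chain_is_trivial C by blast
    then show "\<Union>C \<in> ?A" using C by (auto simp: subset.chain_def)
  qed
  then obtain P where PA: "P \<in> ?A" and max': "\<forall>X\<in>?A. P \<subseteq> X \<longrightarrow> X = P" by (elim bexE)
  have P: "ideal P R" "I \<subseteq> P" "\<one> \<notin> P" using PA by simp_all
  have max: "X = P" if "ideal X R" "I \<subseteq> X" "\<one> \<notin> X" "P \<subseteq> X" for X
    using max' that by simp
  have "maximalideal P R"
  proof (rule maximalidealI[OF P(1)])
    show "carrier R \<noteq> P" using P(3) one_closed by metis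
    fix J assume J: "ideal J R" "P \<subseteq> J" "J \<subseteq> carrier R"
    then show "J = P \<or> J = carrier R"
      using max[OF J(1)] P(2) ideal.one_imp_carrier[OF J(1)] by (metis order.trans)
  qed
  with P show ?thesis by blast
qed

text \<open>A proper ideal would lie in a maximal, hence prime, ideal P, and powers of an f outside
  P stay outside P. This is the only passage from local to global: a property is encoded as the
  ideal of scalars that achieve it, and the property holds outright once 1 is among them.\<close>

lemma one_in_ideal_if_locally:
  assumes "cring R" "noetherian_ring R" "ideal I R"
    and loc: "\<And>P. primeideal P R \<Longrightarrow> \<exists>f\<in>carrier R - P. \<exists>n::nat. f [^]\<^bsub>R\<^esub> n \<in> I"
  shows "\<one>\<^bsub>R\<^esub> \<in> I"
proof (rule ccontr)
  interpret cring R by fact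
  interpret noetherian_ring R by fact
  assume "\<one>\<^bsub>R\<^esub> \<notin> I"
  then have "I \<noteq> carrier R" by auto
  then obtain P where P: "maximalideal P R" "I \<subseteq> P"
    using exists_maximalideal_above assms by blast
  then have pr: "primeideal P R" by (simp add: maximalideal_prime)
  then obtain f n where f: "f \<in> carrier R - P" and fn: "f [^]\<^bsub>R\<^esub> (n::nat) \<in> I" using loc by blast
  interpret P: primeideal P R by fact
  have "f [^]\<^bsub>R\<^esub> m \<notin> P" for m :: nat
  proof (induction m)
    case 0 then show ?case using P.I_notcarr P.one_imp_carrier by (metis nat_pow_0)
  next
    case (Suc m)
    have "f \<in> carrier R" using f by blast
    then show ?case using f Suc P.I_prime[of "f [^]\<^bsub>R\<^esub> m" f] by (auto simp only: nat_pow_Suc nat_pow_closed)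
  qed
  then show False using fn P by blast
qed

section \<open>Localization\<close>

lemma self_module_is_module:
  assumes "cring R"
  shows "module R (self_module R)"
proof -
  interpret cring R by fact
  have "abelian_group (self_module R)"
    by (rule abelian_groupI) (auto simp: self_module_def a_ac intro: l_neg)
  then show ?thesis
    by (intro moduleI assms) (auto simp: self_module_def l_distr r_distr m_assoc)
qed

lemma ex1_unique: "\<exists>!x. P x \<Longrightarrow> P a \<Longrightarrow> P b \<Longrightarrow> a = b"
  by blast

text \<open>Operations on fractions are unions over all representing pairs; such a union collapses
  once every pair gives the same value.\<close>

lemma UN_pair_const:
  assumes "(a, b) \<in> U" and "\<And>x y. (x, y) \<in> U \<Longrightarrow> f x y = X"
  shows "(\<Union>(x, y)\<in>U. f x y) = X"
  using assms by (auto simp: split_beta)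

locale localization = module R M
  for R :: "('r, 'x) ring_scheme" (structure) and M :: "('r, 'm) module" +
  fixes S :: "'r set"
  assumes S_subset: "S \<subseteq> carrier R"
    and one_in_S: "\<one>\<^bsub>R\<^esub> \<in> S"
    and mult_in_S: "s \<in> S \<Longrightarrow> t \<in> S \<Longrightarrow> s \<otimes>\<^bsub>R\<^esub> t \<in> S"
begin

abbreviation "L \<equiv> loc_module R S M"
abbreviation scale (infixl \<open>\<cdot>\<close> 70) where "r \<cdot> x \<equiv> r \<odot>\<^bsub>M\<^esub> x"

lemma S_closed: "s \<in> S \<Longrightarrow> s \<in> carrier R"
  using S_subset by blast

lemma mem_fraction_iff:
  "(n, t) \<in> fraction M S m s \<longleftrightarrow> n \<in> carrier M \<and> t \<in> S \<and>
     (\<exists>u\<in>S. u \<cdot> (t \<cdot> m) = u \<cdot> (s \<cdot> n))"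
  by (auto simp: fraction_def)

lemma fraction_self: "m \<in> carrier M \<Longrightarrow> s \<in> S \<Longrightarrow> (m, s) \<in> fraction M S m s"
  using one_in_S by (auto simp: mem_fraction_iff)

text \<open>Transitivity of equality of fractions. Zero divisors are allowed, so the cancelling
  factors \<open>u\<close> and \<open>v\<close> of the two equations are multiplied together and
  with the middle denominator \<open>s\<close>.\<close>

lemma fraction_subset:
  assumes "m \<in> carrier M" "n \<in> carrier M" "s \<in> S" "t \<in> S" "v \<in> S"
    and v: "v \<cdot> (t \<cdot> m) = v \<cdot> (s \<cdot> n)"
  shows "fraction M S m s \<subseteq> fraction M S n t"
proof clarify
  fix p r assume "(p, r) \<in> fraction M S m s"
  then obtain u where p: "p \<in> carrier M" and r: "r \<in> S" and uS: "u \<in> S"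
    and u: "u \<cdot> (r \<cdot> m) = u \<cdot> (s \<cdot> p)"
    by (auto simp: mem_fraction_iff)
  note c = S_closed[OF assms(3)] S_closed[OF assms(4)] S_closed[OF assms(5)]
    S_closed[OF r] S_closed[OF uS] assms(1,2) p
  have "(u \<otimes> v \<otimes> s) \<cdot> (r \<cdot> n) = (u \<otimes> r) \<cdot> (v \<cdot> (s \<cdot> n))"
    using c by (simp add: smult_assoc1[symmetric] m_ac)
  also have "\<dots> = (v \<otimes> t) \<cdot> (u \<cdot> (r \<cdot> m))"
    using c by (simp only: v[symmetric]) (simp add: smult_assoc1[symmetric] m_ac)
  also have "\<dots> = (u \<otimes> v \<otimes> s) \<cdot> (t \<cdot> p)"
    using c by (simp only: u) (simp add: smult_assoc1[symmetric] m_ac)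
  finally show "(p, r) \<in> fraction M S n t"
    using assms mult_in_S p r uS by (auto simp: mem_fraction_iff)
qed

lemma fraction_eqI:
  assumes "m \<in> carrier M" "n \<in> carrier M" "s \<in> S" "t \<in> S" "v \<in> S"
    and "v \<cdot> (t \<cdot> m) = v \<cdot> (s \<cdot> n)"
  shows "fraction M S m s = fraction M S n t"
  using fraction_subset[OF assms] fraction_subset[OF assms(2,1,4,3,5) assms(6)[symmetric]] by blast

lemma fraction_eqD:
  assumes "fraction M S m s = fraction M S n t" "n \<in> carrier M" "t \<in> S"
  shows "\<exists>u\<in>S. u \<cdot> (t \<cdot> m) = u \<cdot> (s \<cdot> n)"
  using fraction_self[OF assms(2,3)] unfolding assms(1)[symmetric] mem_fraction_iff by blast

text \<open>Independence of the representing pairs: \<open>u\<close> witnesses the change of the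
  first pair and \<open>v\<close> that of the second, so their product cancels in both summands at
  once.\<close>

lemma loc_module_add:
  assumes m: "m \<in> carrier M" and n: "n \<in> carrier M" and s: "s \<in> S" and t: "t \<in> S"
  shows "fraction M S m s \<oplus>\<^bsub>L\<^esub> fraction M S n t =
    fraction M S ((t \<cdot> m) \<oplus>\<^bsub>M\<^esub> (s \<cdot> n)) (s \<otimes> t)" (is "_ = ?F")
proof -
  have "fraction M S ((t' \<cdot> m') \<oplus>\<^bsub>M\<^esub> (s' \<cdot> n')) (s' \<otimes> t') = ?F"
    if "(m', s') \<in> fraction M S m s" "(n', t') \<in> fraction M S n t" for m' s' n' t'
  proof -
    from that obtain u v where
      mn: "m' \<in> carrier M" "n' \<in> carrier M" and st: "s' \<in> S" "t' \<in> S" and uv: "u \<in> S" "v \<in> S"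
      and u: "u \<cdot> (s' \<cdot> m) = u \<cdot> (s \<cdot> m')"
      and v: "v \<cdot> (t' \<cdot> n) = v \<cdot> (t \<cdot> n')"
      by (auto simp: mem_fraction_iff)
    note c = mn m n st[THEN S_closed] uv[THEN S_closed] S_closed[OF s] S_closed[OF t]
    have 1: "(u \<otimes> v \<otimes> s \<otimes> t \<otimes> t') \<cdot> m' = (u \<otimes> v \<otimes> s' \<otimes> t \<otimes> t') \<cdot> m"
    proof -
      have "(u \<otimes> v \<otimes> s \<otimes> t \<otimes> t') \<cdot> m' = (v \<otimes> t \<otimes> t') \<cdot> (u \<cdot> (s \<cdot> m'))"
        using c by (simp add: smult_assoc1[symmetric] m_ac)
      also have "\<dots> = (u \<otimes> v \<otimes> s' \<otimes> t \<otimes> t') \<cdot> m"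
        using c by (simp only: u[symmetric]) (simp add: smult_assoc1[symmetric] m_ac)
      finally show ?thesis .
    qed
    have 2: "(u \<otimes> v \<otimes> s \<otimes> t \<otimes> s') \<cdot> n' = (u \<otimes> v \<otimes> s \<otimes> s' \<otimes> t') \<cdot> n"
    proof -
      have "(u \<otimes> v \<otimes> s \<otimes> t \<otimes> s') \<cdot> n' = (u \<otimes> s \<otimes> s') \<cdot> (v \<cdot> (t \<cdot> n'))"
        using c by (simp add: smult_assoc1[symmetric] m_ac)
      also have "\<dots> = (u \<otimes> v \<otimes> s \<otimes> s' \<otimes> t') \<cdot> n"
        using c by (simp only: v[symmetric]) (simp add: smult_assoc1[symmetric] m_ac)
      finally show ?thesis .
    qed
    show ?thesis
    proof (rule fraction_eqI[where v = "u \<otimes> v"])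
      have "(u \<otimes> v) \<cdot> ((s \<otimes> t) \<cdot> (t' \<cdot> m' \<oplus>\<^bsub>M\<^esub> s' \<cdot> n')) =
        (u \<otimes> v \<otimes> s \<otimes> t \<otimes> t') \<cdot> m' \<oplus>\<^bsub>M\<^esub> (u \<otimes> v \<otimes> s \<otimes> t \<otimes> s') \<cdot> n'"
        using c by (simp add: smult_r_distr smult_assoc1[symmetric] m_ac)
      also have "\<dots> = (u \<otimes> v) \<cdot> ((s' \<otimes> t') \<cdot> (t \<cdot> m \<oplus>\<^bsub>M\<^esub> s \<cdot> n))"
        using c by (simp only: 1 2) (simp add: smult_r_distr smult_assoc1[symmetric] m_ac)
      finally show "(u \<otimes> v) \<cdot> ((s \<otimes> t) \<cdot> (t' \<cdot> m' \<oplus>\<^bsub>M\<^esub> s' \<cdot> n')) =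
        (u \<otimes> v) \<cdot> ((s' \<otimes> t') \<cdot> (t \<cdot> m \<oplus>\<^bsub>M\<^esub> s \<cdot> n))" .
    qed (use c st uv s t mult_in_S in simp_all)
  qed
  then have "(\<Union>(m, s)\<in>fraction M S m s. \<Union>(n, t)\<in>fraction M S n t.
       fraction M S ((t \<cdot> m) \<oplus>\<^bsub>M\<^esub> (s \<cdot> n)) (s \<otimes>\<^bsub>R\<^esub> t)) = ?F"
    by (intro UN_pair_const[OF fraction_self[OF m s]] UN_pair_const[OF fraction_self[OF n t]])
  then show ?thesis by (simp add: loc_module_def)
qed

lemma loc_module_smult:
  assumes r: "r \<in> carrier R" and n: "n \<in> carrier M" and s: "s \<in> S" and t: "t \<in> S"
  shows "fraction (self_module R) S r s \<odot>\<^bsub>L\<^esub> fraction M S n t =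
    fraction M S (r \<cdot> n) (s \<otimes> t)" (is "_ = ?F")
proof -
  have self: "carrier (self_module R) = carrier R" "smult (self_module R) = monoid.mult R"
    by (simp_all add: self_module_def)
  have "fraction M S (r' \<cdot> n') (s' \<otimes> t') = ?F"
    if "(r', s') \<in> fraction (self_module R) S r s" "(n', t') \<in> fraction M S n t" for r' s' n' t'
  proof -
    from that obtain u v where
      mn: "r' \<in> carrier R" "n' \<in> carrier M" and st: "s' \<in> S" "t' \<in> S" and uv: "u \<in> S" "v \<in> S"
      and u: "u \<otimes> (s' \<otimes> r) = u \<otimes> (s \<otimes> r')"
      and v: "v \<cdot> (t' \<cdot> n) = v \<cdot> (t \<cdot> n')"
      by (auto simp: mem_fraction_iff fraction_def self)
    note c = mn r n st[THEN S_closed] uv[THEN S_closed] S_closed[OF s] S_closed[OF t]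
    have "(u \<otimes> v) \<cdot> ((s \<otimes> t) \<cdot> (r' \<cdot> n')) =
        (u \<otimes> (s \<otimes> r')) \<cdot> (v \<cdot> (t \<cdot> n'))"
      using c by (simp add: smult_assoc1[symmetric] m_ac)
    also have "\<dots> = (u \<otimes> v) \<cdot> ((s' \<otimes> t') \<cdot> (r \<cdot> n))"
      using c by (simp only: u[symmetric] v[symmetric]) (simp add: smult_assoc1[symmetric] m_ac)
    finally show ?thesis
      using c st uv s t mult_in_S by (intro fraction_eqI[where v = "u \<otimes> v"]) simp_all
  qed
  moreover have "(r, s) \<in> fraction (self_module R) S r s"
    using r s one_in_S by (auto simp: fraction_def self)
  ultimately have "(\<Union>(r, s)\<in>fraction (self_module R) S r s. \<Union>(m, t)\<in>fraction M S n t.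
      fraction M S (r \<cdot> m) (s \<otimes>\<^bsub>R\<^esub> t)) = ?F"
    by (intro UN_pair_const[of r s] UN_pair_const[OF fraction_self[OF n t]])
  then show ?thesis by (simp add: loc_module_def)
qed

lemma fraction_in_carrier [simp]:
  "m \<in> carrier M \<Longrightarrow> s \<in> S \<Longrightarrow> fraction M S m s \<in> carrier L"
  by (auto simp: loc_module_def)

lemma carrier_loc_moduleE:
  assumes "U \<in> carrier L"
  obtains m s where "m \<in> carrier M" "s \<in> S" "U = fraction M S m s"
  using assms by (auto simp: loc_module_def)

lemma zero_loc_module: "\<zero>\<^bsub>L\<^esub> = fraction M S \<zero>\<^bsub>M\<^esub> \<one>"
  by (simp add: loc_module_def)

text \<open>This gives meaning to finite sums in the localization, through which
  \<open>free_of_rank\<close> speaks of coordinates.\<close>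

lemma loc_module_abelian_monoid: "abelian_monoid L"
proof (rule abelian_monoidI)
  show "\<zero>\<^bsub>L\<^esub> \<in> carrier L"
    by (simp add: zero_loc_module one_in_S)
  fix U assume "U \<in> carrier L"
  then obtain m s where U: "m \<in> carrier M" "s \<in> S" "U = fraction M S m s" by (rule carrier_loc_moduleE)
  show "\<zero>\<^bsub>L\<^esub> \<oplus>\<^bsub>L\<^esub> U = U"
    using U S_closed by (simp add: zero_loc_module loc_module_add one_in_S)
  fix V assume "V \<in> carrier L"
  then obtain n t where V: "n \<in> carrier M" "t \<in> S" "V = fraction M S n t" by (rule carrier_loc_moduleE)
  show "U \<oplus>\<^bsub>L\<^esub> V \<in> carrier L"
    using U V S_closed mult_in_S by (simp add: loc_module_add)
  show "U \<oplus>\<^bsub>L\<^esub> V = V \<oplus>\<^bsub>L\<^esub> U"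
    using U V S_closed mult_in_S by (simp add: loc_module_add M.a_comm m_comm)
  fix W assume "W \<in> carrier L"
  then obtain p r where W: "p \<in> carrier M" "r \<in> S" "W = fraction M S p r" by (rule carrier_loc_moduleE)
  show "U \<oplus>\<^bsub>L\<^esub> V \<oplus>\<^bsub>L\<^esub> W = U \<oplus>\<^bsub>L\<^esub> (V \<oplus>\<^bsub>L\<^esub> W)"
    using U V W S_closed mult_in_S
    by (simp add: loc_module_add smult_r_distr smult_assoc1[symmetric] m_ac M.a_ac)
qed

text \<open>Bringing the terms to a common denominator moves all denominators, those of the
  \<open>c i\<close> and the \<open>s i\<close>, into \<open>w\<close> and leaves a combination of
  the numerators \<open>x i\<close> over \<open>R\<close>. The carrier clause travels with the
  induction because splitting off one term of a finite sum requires it.\<close>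

lemma finsum_loc_module:
  assumes "finite I" "x \<in> I \<rightarrow> carrier M" "s \<in> I \<rightarrow> S" "c \<in> I \<rightarrow> carrier (loc_ring R S)"
  shows "(\<lambda>i. c i \<odot>\<^bsub>L\<^esub> fraction M S (x i) (s i)) \<in> I \<rightarrow> carrier L \<and>
    (\<exists>c'\<in>I \<rightarrow> carrier R. \<exists>w\<in>S.
    (\<Oplus>\<^bsub>L\<^esub>i\<in>I. c i \<odot>\<^bsub>L\<^esub> fraction M S (x i) (s i)) =
    fraction M S (\<Oplus>\<^bsub>M\<^esub>i\<in>I. c' i \<cdot> x i) w)"
  using assms
proof (induction I rule: finite_induct)
  case empty
  interpret L_abelian: abelian_monoid "L" by (rule loc_module_abelian_monoid)
  show ?case by (auto simp: zero_loc_module one_in_S)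
next
  case (insert j I)
  interpret L_abelian: abelian_monoid "L" by (rule loc_module_abelian_monoid)
  from insert obtain c' w where c': "c' \<in> I \<rightarrow> carrier R" and w: "w \<in> S"
    and eq: "(\<Oplus>\<^bsub>L\<^esub>i\<in>I. c i \<odot>\<^bsub>L\<^esub> fraction M S (x i) (s i)) =
      fraction M S (\<Oplus>\<^bsub>M\<^esub>i\<in>I. c' i \<cdot> x i) w"
    and clI: "(\<lambda>i. c i \<odot>\<^bsub>L\<^esub> fraction M S (x i) (s i)) \<in> I \<rightarrow> carrier L"
    by auto
  have "c j \<in> carrier (loc_ring R S)" using insert by auto
  then obtain r t where r: "r \<in> carrier R" and t: "t \<in> S" and cj: "c j = fraction (self_module R) S r t"
    by (auto simp: loc_ring_def loc_module_def Let_def self_module_def)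
  have j: "x j \<in> carrier M" "s j \<in> S" and xI: "x \<in> I \<rightarrow> carrier M" using insert by auto
  have sum_cl: "(\<Oplus>\<^bsub>M\<^esub>i\<in>I. c' i \<cdot> x i) \<in> carrier M" using c' xI by (intro M.finsum_closed) auto
  have trm: "c j \<odot>\<^bsub>L\<^esub> fraction M S (x j) (s j) = fraction M S (r \<cdot> x j) (t \<otimes> s j)"
    using r t j by (simp add: cj loc_module_smult)
  \<comment> \<open>Cross multiplication of the new term, with denominator
    \<open>t \<otimes> s j\<close>, and the old sum, with denominator \<open>w\<close>: the new
    coefficient is scaled by \<open>w\<close> and every old one by
    \<open>t \<otimes> s j\<close>.\<close>
  let ?e = "\<lambda>i. if i = j then w \<otimes> r else (t \<otimes> s j) \<otimes> c' i"
  have cl: "(\<lambda>i. c i \<odot>\<^bsub>L\<^esub> fraction M S (x i) (s i)) \<in> insert j I \<rightarrow> carrier L"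
    using clI trm r t j mult_in_S by auto
  have e: "?e \<in> insert j I \<rightarrow> carrier R" using Pi_mem[OF c'] r t j w S_closed by auto
  have "(\<Oplus>\<^bsub>M\<^esub>i\<in>insert j I. ?e i \<cdot> x i) = (w \<otimes> r) \<cdot> x j \<oplus>\<^bsub>M\<^esub> (\<Oplus>\<^bsub>M\<^esub>i\<in>I. ?e i \<cdot> x i)"
    using insert.hyps Pi_mem[OF xI] Pi_mem[OF c'] r t j w S_closed by (subst M.finsum_insert) auto
  also have "(\<Oplus>\<^bsub>M\<^esub>i\<in>I. ?e i \<cdot> x i) = (\<Oplus>\<^bsub>M\<^esub>i\<in>I. (t \<otimes> s j) \<cdot> (c' i \<cdot> x i))"
    by (rule M.finsum_cong') (use insert.hyps Pi_mem[OF xI] Pi_mem[OF c'] r t j w S_closed in \<open>auto simp: smult_assoc1\<close>)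
  also have "\<dots> = (t \<otimes> s j) \<cdot> (\<Oplus>\<^bsub>M\<^esub>i\<in>I. c' i \<cdot> x i)"
    using insert.hyps xI c' t j S_closed by (subst finsum_smult_ldistr) auto
  finally have sumeq: "(\<Oplus>\<^bsub>M\<^esub>i\<in>insert j I. ?e i \<cdot> x i) =
    (w \<otimes> r) \<cdot> x j \<oplus>\<^bsub>M\<^esub> (t \<otimes> s j) \<cdot> (\<Oplus>\<^bsub>M\<^esub>i\<in>I. c' i \<cdot> x i)" .
  have "(\<Oplus>\<^bsub>L\<^esub>i\<in>insert j I. c i \<odot>\<^bsub>L\<^esub> fraction M S (x i) (s i)) =
    fraction M S (r \<cdot> x j) (t \<otimes> s j) \<oplus>\<^bsub>L\<^esub> fraction M S (\<Oplus>\<^bsub>M\<^esub>i\<in>I. c' i \<cdot> x i) w"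
    using cl insert.hyps by (subst L_abelian.finsum_insert) (auto simp: eq trm)
  also have "\<dots> = fraction M S (\<Oplus>\<^bsub>M\<^esub>i\<in>insert j I. ?e i \<cdot> x i) (t \<otimes> s j \<otimes> w)"
    unfolding sumeq using r t j w S_closed mult_in_S sum_cl
    by (subst loc_module_add) (auto simp: smult_assoc1)
  finally show ?case
    by (intro conjI cl bexI[of _ ?e] bexI[of _ "t \<otimes> s j \<otimes> w"] e mult_in_S t j w)
qed

lemma finsum_loc_module_fractions:
  assumes "finite I" "x \<in> I \<rightarrow> carrier M"
  shows "(\<Oplus>\<^bsub>L\<^esub>i\<in>I. fraction M S (x i) \<one>) = fraction M S (\<Oplus>\<^bsub>M\<^esub>i\<in>I. x i) \<one>"
  using assms
proof (induction I rule: finite_induct)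
  case empty
  interpret L_abelian: abelian_monoid "L" by (rule loc_module_abelian_monoid)
  show ?case by (simp add: zero_loc_module)
next
  case (insert j I)
  interpret L_abelian: abelian_monoid "L" by (rule loc_module_abelian_monoid)
  have "(\<lambda>i. fraction M S (x i) \<one>) \<in> I \<rightarrow> carrier L"
    using insert.prems one_in_S by (auto simp: Pi_iff)
  then show ?case using insert one_in_S by (auto simp: loc_module_add M.finsum_closed)
qed

text \<open>Clearing denominators in a basis of the localization. Existence of coordinates makes the
  numerators generate \<open>M\<close> up to a factor in \<open>S\<close>; uniqueness makes the
  coefficients of every relation among them torsion with respect to \<open>S\<close>.\<close>

lemma free_localization_generators:
  assumes "free_of_rank (loc_ring R S) L n"
  shows "\<exists>x\<in>{..<n} \<rightarrow> carrier M.
    (\<forall>q\<in>carrier M. \<exists>u\<in>S. \<exists>c\<in>{..<n} \<rightarrow> carrier R. u \<cdot> q = (\<Oplus>\<^bsub>M\<^esub>i\<in>{..<n}. c i \<cdot> x i)) \<and>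
    (\<forall>c\<in>{..<n} \<rightarrow> carrier R. (\<Oplus>\<^bsub>M\<^esub>i\<in>{..<n}. c i \<cdot> x i) = \<zero>\<^bsub>M\<^esub> \<longrightarrow> (\<forall>i<n. \<exists>u\<in>S. u \<otimes> c i = \<zero>))"
proof -
  interpret L_abelian: abelian_monoid "L" by (rule loc_module_abelian_monoid)
  let ?I = "{..<n}"
  interpret R1: localization R "self_module R" S
    using self_module_is_module[OF is_cring] S_subset one_in_S mult_in_S
    by (simp add: localization_def localization_axioms_def)
  have self: "carrier (self_module R) = carrier R" "smult (self_module R) = monoid.mult R"
    "ring.zero (self_module R) = ring.zero R"
    by (simp_all add: self_module_def)
  have cLR: "carrier (loc_ring R S) = carrier (loc_module R S (self_module R))"
    by (simp add: loc_ring_def Let_def)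
  from assms obtain b where b: "b \<in> ?I \<rightarrow> carrier L"
    and all: "\<forall>X\<in>carrier L. \<exists>!c. c \<in> ?I \<rightarrow>\<^sub>E carrier (loc_ring R S) \<and>
      X = (\<Oplus>\<^bsub>L\<^esub>i\<in>?I. c i \<odot>\<^bsub>L\<^esub> b i)"
    unfolding free_of_rank_def by (elim bexE)
  note ex1 = bspec[OF all]
  have "\<forall>i\<in>?I. \<exists>m s. m \<in> carrier M \<and> s \<in> S \<and> b i = fraction M S m s"
    using b carrier_loc_moduleE by (metis Pi_mem)
  then obtain x s where xs: "\<And>i. i \<in> ?I \<Longrightarrow> x i \<in> carrier M \<and> s i \<in> S \<and> b i = fraction M S (x i) (s i)"
    by metis
  then have x: "x \<in> ?I \<rightarrow> carrier M" and s: "s \<in> ?I \<rightarrow> S" by auto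
  show ?thesis
  proof (intro bexI[OF _ x] conjI ballI impI allI)
    fix q assume q: "q \<in> carrier M"
    obtain c where c: "c \<in> ?I \<rightarrow>\<^sub>E carrier (loc_ring R S)"
      and eq: "fraction M S q \<one> = (\<Oplus>\<^bsub>L\<^esub>i\<in>?I. c i \<odot>\<^bsub>L\<^esub> b i)"
      using ex1_implies_ex[OF ex1[OF fraction_in_carrier[OF q one_in_S]]] by (elim exE conjE)
    have c2: "c \<in> ?I \<rightarrow> carrier (loc_ring R S)" using c by auto
    from finsum_loc_module[OF _ x s c2] obtain c' w where
      cl: "(\<lambda>i. c i \<odot>\<^bsub>L\<^esub> fraction M S (x i) (s i)) \<in> ?I \<rightarrow> carrier L"
      and c': "c' \<in> ?I \<rightarrow> carrier R" and w: "w \<in> S"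
      and "(\<Oplus>\<^bsub>L\<^esub>i\<in>?I. c i \<odot>\<^bsub>L\<^esub> fraction M S (x i) (s i)) =
        fraction M S (\<Oplus>\<^bsub>M\<^esub>i\<in>?I. c' i \<cdot> x i) w" by auto
    moreover have "(\<Oplus>\<^bsub>L\<^esub>i\<in>?I. c i \<odot>\<^bsub>L\<^esub> b i) =
        (\<Oplus>\<^bsub>L\<^esub>i\<in>?I. c i \<odot>\<^bsub>L\<^esub> fraction M S (x i) (s i))"
      by (rule L_abelian.finsum_cong') (use cl xs in auto)
    ultimately have "fraction M S q \<one> = fraction M S (\<Oplus>\<^bsub>M\<^esub>i\<in>?I. c' i \<cdot> x i) w" using eq by simp
    moreover have sc: "(\<Oplus>\<^bsub>M\<^esub>i\<in>?I. c' i \<cdot> x i) \<in> carrier M"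
      using c' x by (intro M.finsum_closed) auto
    ultimately obtain u where u: "u \<in> S"
      and ueq: "u \<cdot> (w \<cdot> q) = u \<cdot> (\<one> \<cdot> (\<Oplus>\<^bsub>M\<^esub>i\<in>?I. c' i \<cdot> x i))"
      using fraction_eqD w by blast
    have "(u \<otimes> w) \<cdot> q = u \<cdot> (\<Oplus>\<^bsub>M\<^esub>i\<in>?I. c' i \<cdot> x i)"
      using ueq q u w sc S_closed by (simp add: smult_assoc1)
    also have "\<dots> = (\<Oplus>\<^bsub>M\<^esub>i\<in>?I. u \<cdot> (c' i \<cdot> x i))"
      using u c' x S_closed by (intro finsum_smult_ldistr) auto
    also have "\<dots> = (\<Oplus>\<^bsub>M\<^esub>i\<in>?I. (u \<otimes> c' i) \<cdot> x i)"
      by (rule M.finsum_cong') (use u c' x S_closed in \<open>auto simp: smult_assoc1 Pi_iff\<close>)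
    finally show "\<exists>u\<in>S. \<exists>c\<in>?I \<rightarrow> carrier R. u \<cdot> q = (\<Oplus>\<^bsub>M\<^esub>i\<in>?I. c i \<cdot> x i)"
      using u w mult_in_S c' S_closed by (intro bexI[of _ "u \<otimes> w"] bexI[of _ "\<lambda>i. u \<otimes> c' i"]) auto
  next
    fix c j assume c: "c \<in> ?I \<rightarrow> carrier R" and z: "(\<Oplus>\<^bsub>M\<^esub>i\<in>?I. c i \<cdot> x i) = \<zero>\<^bsub>M\<^esub>" and j: "j < n"
    \<comment> \<open>A basis element is \<open>x i\<close> over \<open>s i\<close>, so a relation
      with coefficients \<open>d i\<close> represents zero with coordinates
      \<open>d i \<otimes> s i\<close> over 1. Uniqueness compares them with the coordinates that
      come from the zero relation.\<close>
    let ?fr = "\<lambda>d. \<lambda>i\<in>?I. fraction (self_module R) S (d i \<otimes> s i) \<one>"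
    have key: "?fr d \<in> ?I \<rightarrow>\<^sub>E carrier (loc_ring R S) \<and>
        \<zero>\<^bsub>L\<^esub> = (\<Oplus>\<^bsub>L\<^esub>i\<in>?I. ?fr d i \<odot>\<^bsub>L\<^esub> b i)"
      if d: "d \<in> ?I \<rightarrow> carrier R" and dz: "(\<Oplus>\<^bsub>M\<^esub>i\<in>?I. d i \<cdot> x i) = \<zero>\<^bsub>M\<^esub>" for d
    proof
      show "?fr d \<in> ?I \<rightarrow>\<^sub>E carrier (loc_ring R S)"
        using d s S_closed one_in_S by (auto simp: cLR Pi_iff self intro!: R1.fraction_in_carrier)
      have t: "?fr d i \<odot>\<^bsub>L\<^esub> b i = fraction M S (d i \<cdot> x i) \<one>" if i: "i \<in> ?I" for i
      proof -
        have di: "d i \<in> carrier R" "x i \<in> carrier M" "s i \<in> S" "s i \<in> carrier R"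
          using i d x s S_closed by auto
        have "?fr d i \<odot>\<^bsub>L\<^esub> b i = fraction M S ((d i \<otimes> s i) \<cdot> x i) (\<one> \<otimes> s i)"
          using i xs[OF i] di one_in_S by (simp add: loc_module_smult)
        also have "\<dots> = fraction M S (d i \<cdot> x i) \<one>"
          by (rule fraction_eqI[where v = \<one>])
            (use di one_in_S mult_in_S in \<open>auto simp: smult_assoc1[symmetric] m_ac\<close>)
        finally show ?thesis .
      qed
      have "(\<Oplus>\<^bsub>L\<^esub>i\<in>?I. ?fr d i \<odot>\<^bsub>L\<^esub> b i) =
          (\<Oplus>\<^bsub>L\<^esub>i\<in>?I. fraction M S (d i \<cdot> x i) \<one>)"
        by (rule L_abelian.finsum_cong') (use t Pi_mem[OF d] Pi_mem[OF x] one_in_S in \<open>auto simp del: restrict_apply\<close>)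
      also have "\<dots> = fraction M S (\<Oplus>\<^bsub>M\<^esub>i\<in>?I. d i \<cdot> x i) \<one>"
        using d x by (intro finsum_loc_module_fractions) auto
      finally show "\<zero>\<^bsub>L\<^esub> = (\<Oplus>\<^bsub>L\<^esub>i\<in>?I. ?fr d i \<odot>\<^bsub>L\<^esub> b i)"
        by (simp add: dz zero_loc_module)
    qed
    have z0: "(\<Oplus>\<^bsub>M\<^esub>i\<in>?I. \<zero> \<cdot> x i) = \<zero>\<^bsub>M\<^esub>"
    proof -
      have "(\<Oplus>\<^bsub>M\<^esub>i\<in>?I. \<zero> \<cdot> x i) = (\<Oplus>\<^bsub>M\<^esub>i\<in>?I. \<zero>\<^bsub>M\<^esub>)"
        by (rule M.finsum_cong') (use Pi_mem[OF x] in auto)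
      then show ?thesis by simp
    qed
    have zd: "(\<lambda>_. \<zero>) \<in> ?I \<rightarrow> carrier R" by simp
    have "?fr c = ?fr (\<lambda>_. \<zero>)"
      by (rule ex1_unique[OF ex1[OF L_abelian.zero_closed]]) (rule key[OF c z], rule key[OF zd z0])
    then have "?fr c j = ?fr (\<lambda>_. \<zero>) j" by (rule fun_cong)
    then have fe: "fraction (self_module R) S (c j \<otimes> s j) \<one> = fraction (self_module R) S \<zero> \<one>"
      using j s S_closed by (auto simp: Pi_iff)
    have cs: "c j \<in> carrier R" "s j \<in> carrier R" "s j \<in> S" using j c s S_closed by auto
    obtain u where "u \<in> S" "u \<otimes> (\<one> \<otimes> (c j \<otimes> s j)) = u \<otimes> (\<one> \<otimes> \<zero>)"
      using R1.fraction_eqD[OF fe] one_in_S by (auto simp: self)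
    then have "u \<otimes> s j \<in> S" "(u \<otimes> s j) \<otimes> c j = \<zero>"
      using cs S_closed mult_in_S by (auto simp: m_ac)
    then show "\<exists>u\<in>S. u \<otimes> c j = \<zero>" by blast
  qed
qed

end

lemma powers_of_localization:
  assumes "module R M" "f \<in> carrier R"
  shows "localization R M (powers_of R f)"
proof -
  interpret module R M by fact
  have "f [^]\<^bsub>R\<^esub> (0::nat) = \<one>\<^bsub>R\<^esub>" by simp
  then show ?thesis
    using assms by unfold_locales (auto simp: powers_of_def nat_pow_mult intro: exI[of _ 0])
qed

section \<open>Linear functionals and locally free modules\<close>

abbreviation functionals ::
    "('r, 'x) ring_scheme \<Rightarrow> ('r, 'm) module \<Rightarrow> ('m \<Rightarrow> 'r) set" where
  "functionals R V \<equiv> lin_maps R V (self_module R)"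

lemma functionals_iff:
  "f \<in> functionals R V \<longleftrightarrow> f \<in> extensional (carrier V) \<and>
     (\<forall>x\<in>carrier V. f x \<in> carrier R) \<and>
     (\<forall>x\<in>carrier V. \<forall>y\<in>carrier V. f (x \<oplus>\<^bsub>V\<^esub> y) = f x \<oplus>\<^bsub>R\<^esub> f y) \<and>
     (\<forall>r\<in>carrier R. \<forall>x\<in>carrier V. f (r \<odot>\<^bsub>V\<^esub> x) = r \<otimes>\<^bsub>R\<^esub> f x)"
  by (auto simp: lin_maps_def self_module_def PiE_iff)

context
  fixes R :: "('r, 'x) ring_scheme" and V :: "('r, 'm) module" and f
  assumes f: "f \<in> functionals R V"
begin

lemma functional_closed: "x \<in> carrier V \<Longrightarrow> f x \<in> carrier R"
  and functional_add: "x \<in> carrier V \<Longrightarrow> y \<in> carrier V \<Longrightarrow> f (x \<oplus>\<^bsub>V\<^esub> y) = f x \<oplus>\<^bsub>R\<^esub> f y"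
  and functional_smult: "r \<in> carrier R \<Longrightarrow> x \<in> carrier V \<Longrightarrow> f (r \<odot>\<^bsub>V\<^esub> x) = r \<otimes>\<^bsub>R\<^esub> f x"
  and functional_extensional: "f \<in> extensional (carrier V)"
  using f unfolding functionals_iff by blast+

lemma functional_zero:
  assumes "module R V"
  shows "f \<zero>\<^bsub>V\<^esub> = \<zero>\<^bsub>R\<^esub>"
proof -
  interpret module R V by fact
  have "f (\<zero>\<^bsub>R\<^esub> \<odot>\<^bsub>V\<^esub> \<zero>\<^bsub>V\<^esub>) = \<zero>\<^bsub>R\<^esub> \<otimes>\<^bsub>R\<^esub> f \<zero>\<^bsub>V\<^esub>" by (rule functional_smult) simp_all
  then show ?thesis using functional_closed[of "\<zero>\<^bsub>V\<^esub>"] by simp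
qed

lemma functional_minus:
  assumes "module R V" "x \<in> carrier V"
  shows "f (\<ominus>\<^bsub>V\<^esub> x) = \<ominus>\<^bsub>R\<^esub> f x"
proof -
  interpret module R V by fact
  have "f (\<ominus>\<^bsub>V\<^esub> x) \<oplus>\<^bsub>R\<^esub> f x = \<zero>\<^bsub>R\<^esub>"
    using functional_add[of "\<ominus>\<^bsub>V\<^esub> x" x] functional_zero[OF assms(1)] assms(2) by (simp add: M.l_neg)
  then show ?thesis
    using functional_closed[of x] functional_closed[of "\<ominus>\<^bsub>V\<^esub> x"] assms(2)
    by (simp add: R.minus_equality)
qed

end

text \<open>Prepares the linear map that \<open>functional_extension\<close> subtracts from a
  multiple of \<open>y\<close> in order to land in the submodule; the \<open>d i\<close> are
  coordinates on the quotient and the \<open>z i\<close> are lifts of the local basis.\<close>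

lemma finsum_lin_maps:
  assumes "module R V" "module R M" "finite I"
    and d': "\<forall>i\<in>I. d i \<in> functionals R V" and z': "\<forall>i\<in>I. z i \<in> carrier M"
  defines "p \<equiv> \<lambda>y. \<Oplus>\<^bsub>M\<^esub>i\<in>I. d i y \<odot>\<^bsub>M\<^esub> z i"
  shows "y \<in> carrier V \<Longrightarrow> p y \<in> carrier M"
    and "y \<in> carrier V \<Longrightarrow> y' \<in> carrier V \<Longrightarrow> p (y \<oplus>\<^bsub>V\<^esub> y') = p y \<oplus>\<^bsub>M\<^esub> p y'"
    and "r \<in> carrier R \<Longrightarrow> y \<in> carrier V \<Longrightarrow> p (r \<odot>\<^bsub>V\<^esub> y) = r \<odot>\<^bsub>M\<^esub> p y"
proof -
  interpret M: module R M by fact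
  note d = d'[rule_format] and z = z'[rule_format]
  have dc: "d i y \<in> carrier R" if "i \<in> I" "y \<in> carrier V" for i y
    using functional_closed[OF d[OF that(1)] that(2)] .
  show "p y \<in> carrier M" if "y \<in> carrier V"
    unfolding p_def using dc z that by (intro M.finsum_closed) auto
  show "p (y \<oplus>\<^bsub>V\<^esub> y') = p y \<oplus>\<^bsub>M\<^esub> p y'" if y: "y \<in> carrier V" "y' \<in> carrier V"
  proof -
    have "p (y \<oplus>\<^bsub>V\<^esub> y') = (\<Oplus>\<^bsub>M\<^esub>i\<in>I. d i y \<odot>\<^bsub>M\<^esub> z i \<oplus>\<^bsub>M\<^esub> d i y' \<odot>\<^bsub>M\<^esub> z i)"
      unfolding p_def using dc z y
      by (intro M.finsum_cong') (auto simp: functional_add[OF d] M.smult_l_distr)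
    then show ?thesis unfolding p_def using dc z y by (simp add: M.finsum_addf Pi_def)
  qed
  show "p (r \<odot>\<^bsub>V\<^esub> y) = r \<odot>\<^bsub>M\<^esub> p y" if y: "r \<in> carrier R" "y \<in> carrier V"
  proof -
    have "p (r \<odot>\<^bsub>V\<^esub> y) = (\<Oplus>\<^bsub>M\<^esub>i\<in>I. r \<odot>\<^bsub>M\<^esub> (d i y \<odot>\<^bsub>M\<^esub> z i))"
      unfolding p_def using dc z y
      by (intro M.finsum_cong') (auto simp: functional_smult[OF d] M.smult_assoc1)
    then show ?thesis
      unfolding p_def using dc z y assms(3) by (simp add: M.finsum_smult_ldistr Pi_def)
  qed
qed

section \<open>Global consequences of local freeness\<close>

lemma (in cring) idealI_cring:
  assumes "I \<subseteq> carrier R" "\<zero> \<in> I"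
    and add: "\<And>a b. a \<in> I \<Longrightarrow> b \<in> I \<Longrightarrow> a \<oplus> b \<in> I"
    and mult: "\<And>a r. a \<in> I \<Longrightarrow> r \<in> carrier R \<Longrightarrow> r \<otimes> a \<in> I"
  shows "ideal I R"
proof (rule idealI)
  show "subgroup I (add_monoid R)"
  proof (rule add.subgroupI)
    fix a assume a: "a \<in> I"
    then have "(\<ominus> \<one>) \<otimes> a \<in> I" by (intro mult) simp_all
    then show "\<ominus> a \<in> I" using a assms(1) by (simp add: l_minus subset_iff)
  qed (use assms in auto)
next
  fix a x assume "a \<in> I" "x \<in> carrier R"
  then show "x \<otimes> a \<in> I" "a \<otimes> x \<in> I" using assms(1) mult m_comm[of a x] by auto
qed (rule ring_axioms)

text \<open>Replaces the binomial expansion: one factor \<open>a \<oplus> b\<close> is split off at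
  a time and the resulting \<open>a\<close> or \<open>b\<close> is absorbed into \<open>c\<close>.
  This is why the statement carries an arbitrary \<open>c\<close>.\<close>

lemma (in cring) add_pow_in_ideal:
  assumes J: "ideal J R" and ab: "a \<in> carrier R" "b \<in> carrier R"
  shows "c \<in> carrier R \<Longrightarrow> c \<otimes> a [^] (m::nat) \<in> J \<Longrightarrow> c \<otimes> b [^] (n::nat) \<in> J \<Longrightarrow>
    c \<otimes> (a \<oplus> b) [^] (m + n) \<in> J"
proof (induction "m + n" arbitrary: m n c)
  case 0
  then show ?case by simp
next
  case (Suc t)
  interpret J: ideal J R by (rule J)
  consider "m = 0" | "n = 0" | m' n' where "m = Suc m'" "n = Suc n'"
    by (cases m; cases n) auto
  then show ?case
  proof cases
    case 1
    then show ?thesis using Suc.prems ab J.I_r_closed by simp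
  next
    case 2
    then show ?thesis using Suc.prems ab J.I_r_closed by simp
  next
    case 3
    have pw: "a [^] m = a \<otimes> a [^] m'" "b [^] n = b \<otimes> b [^] n'"
      using 3 ab by (simp_all add: m_comm)
    have "(c \<otimes> a) \<otimes> b [^] n = a \<otimes> (c \<otimes> b [^] n)" "(c \<otimes> b) \<otimes> a [^] m = b \<otimes> (c \<otimes> a [^] m)"
      using Suc.prems(1) ab by (simp_all add: m_ac)
    then have 1: "(c \<otimes> a) \<otimes> b [^] n \<in> J" "(c \<otimes> b) \<otimes> a [^] m \<in> J"
      using Suc.prems J.I_l_closed ab by simp_all
    have 2: "(c \<otimes> a) \<otimes> a [^] m' \<in> J" "(c \<otimes> b) \<otimes> b [^] n' \<in> J"
      using Suc.prems ab pw by (simp_all add: m_assoc)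
    have "(c \<otimes> a) \<otimes> (a \<oplus> b) [^] (m' + n) \<in> J"
      using 1(1) 2(1) Suc.prems(1) ab Suc.hyps(2) 3 by (intro Suc.hyps(1)) auto
    moreover have "(c \<otimes> b) \<otimes> (a \<oplus> b) [^] (m + n') \<in> J"
      using 1(2) 2(2) Suc.prems(1) ab Suc.hyps(2) 3 by (intro Suc.hyps(1)) auto
    moreover have "c \<otimes> (a \<oplus> b) [^] (m + n) =
        (c \<otimes> a) \<otimes> (a \<oplus> b) [^] (m' + n) \<oplus> (c \<otimes> b) \<otimes> (a \<oplus> b) [^] (m + n')"
    proof -
      define w where "w = (a \<oplus> b) [^] (m' + n)"
      have mn: "m + n = Suc (m' + n)" "m + n' = m' + n" using 3 by auto
      have w: "w \<in> carrier R" using ab by (simp add: w_def)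
      show ?thesis
        unfolding mn nat_pow_Suc w_def[symmetric]
        using w Suc.prems(1) ab by (simp add: m_ac r_distr)
    qed
    ultimately show ?thesis by simp
  qed
qed

text \<open>What a basis of the localization at \<open>f\<close> leaves behind over \<open>R\<close>
  itself. The exponent may depend on the element or on the relation; making it uniform is the
  content of \<open>local_coordinates\<close>.\<close>

definition local_basis ::
    "('r, 'x) ring_scheme \<Rightarrow> ('r, 'm) module \<Rightarrow> 'r \<Rightarrow> nat \<Rightarrow> (nat \<Rightarrow> 'm) \<Rightarrow> bool" where
  "local_basis R Q f n x \<longleftrightarrow> x \<in> {..<n} \<rightarrow> carrier Q \<and>
     (\<forall>q\<in>carrier Q. \<exists>e::nat. \<exists>c\<in>{..<n} \<rightarrow> carrier R.
        (f [^]\<^bsub>R\<^esub> e) \<odot>\<^bsub>Q\<^esub> q = (\<Oplus>\<^bsub>Q\<^esub>i\<in>{..<n}. c i \<odot>\<^bsub>Q\<^esub> x i)) \<and>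
     (\<forall>c\<in>{..<n} \<rightarrow> carrier R. (\<Oplus>\<^bsub>Q\<^esub>i\<in>{..<n}. c i \<odot>\<^bsub>Q\<^esub> x i) = \<zero>\<^bsub>Q\<^esub> \<longrightarrow>
        (\<forall>i<n. \<exists>e::nat. f [^]\<^bsub>R\<^esub> e \<otimes>\<^bsub>R\<^esub> c i = \<zero>\<^bsub>R\<^esub>))"

lemma locally_free_local_basis:
  fixes R (structure)
  assumes "module R Q" "locally_free_of_rank R Q r" "primeideal P R"
  obtains f n x where "f \<in> carrier R - P" "int n = r" "local_basis R Q f n x"
proof -
  from assms obtain f n where f: "f \<in> carrier R - P" and n: "int n = r"
    and free: "free_of_rank (loc_ring R (powers_of R f)) (loc_module R (powers_of R f) Q) n"
    using assms(2)[unfolded locally_free_of_rank_def, rule_format, OF assms(3)]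
    by (elim bexE exE conjE)
  interpret localization R Q "powers_of R f"
    using f by (intro powers_of_localization[OF assms(1)]) simp
  have mem: "(\<exists>u\<in>powers_of R f. T u) \<longleftrightarrow> (\<exists>e::nat. T (f [^] e))" for T
    by (auto simp: powers_of_def)
  have "\<exists>x. local_basis R Q f n x"
    using free_localization_generators[OF free] unfolding mem local_basis_def by (simp only: Bex_def)
  then show thesis using that[OF f n] by (elim exE)
qed

text \<open>Near each prime the basis is empty, so a power of f kills \<open>q\<close>; hence the
  annihilator of \<open>q\<close> contains 1.\<close>

lemma locally_free_of_rank_0:
  fixes R (structure)
  assumes "cring R" "noetherian_ring R" "module R Q" "locally_free_of_rank R Q 0" "q \<in> carrier Q"
  shows "q = \<zero>\<^bsub>Q\<^esub>"
proof -
  interpret module R Q by fact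
  let ?I = "{a \<in> carrier R. a \<odot>\<^bsub>Q\<^esub> q = \<zero>\<^bsub>Q\<^esub>}"
  have "\<one> \<in> ?I"
  proof (rule one_in_ideal_if_locally[OF assms(1,2)])
    show "ideal ?I R"
      using assms(5) by (intro R.idealI_cring) (auto simp: smult_l_distr smult_assoc1)
    fix P assume "primeideal P R"
    then obtain f n x where f: "f \<in> carrier R - P" and "int n = 0" and lb: "local_basis R Q f n x"
      by (rule locally_free_local_basis[OF assms(3,4)])
    then have "\<exists>e::nat. (f [^] e) \<odot>\<^bsub>Q\<^esub> q = \<zero>\<^bsub>Q\<^esub>" using lb assms(5) by (auto simp: local_basis_def)
    then show "\<exists>f\<in>carrier R - P. \<exists>n::nat. f [^] n \<in> ?I" using f by auto
  qed
  then show ?thesis using assms(5) by simp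
qed

text \<open>Takes the place of compactness of the spectrum: the scalars \<open>a\<close> for which
  some finite set generates \<open>Q\<close> after inverting \<open>a\<close> form an ideal, since
  generators for \<open>a\<close> and for \<open>b\<close> together serve
  \<open>a \<oplus> b\<close>. Generation is phrased through submodules containing the set, which
  avoids choosing coefficients.\<close>

lemma locally_free_finitely_generated:
  fixes R (structure)
  assumes "cring R" "noetherian_ring R" "module R Q" "locally_free_of_rank R Q r"
  shows "\<exists>X. finite X \<and> X \<subseteq> carrier Q \<and> (\<forall>N. submodule N R Q \<longrightarrow> X \<subseteq> N \<longrightarrow> N = carrier Q)"
proof -
  interpret module R Q by fact
  define gen where "gen = (\<lambda>X a. finite X \<and> X \<subseteq> carrier Q \<and>
    (\<forall>N. submodule N R Q \<longrightarrow> X \<subseteq> N \<longrightarrow> (\<forall>q\<in>carrier Q. \<exists>e::nat. (a [^] e) \<odot>\<^bsub>Q\<^esub> q \<in> N)))"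
  let ?I = "{a \<in> carrier R. \<exists>X. gen X a}"
  have "\<one> \<in> ?I"
  proof (rule one_in_ideal_if_locally[OF assms(1,2)])
    show "ideal ?I R"
    proof (rule R.idealI_cring)
      \<comment> \<open>The exponent has to be positive here, since the power of zero with exponent
        0 is 1.\<close>
      have "gen {} \<zero>"
        using submoduleE(2)[of _] subgroup.one_closed
        by (auto simp: gen_def submodule_def intro!: exI[of _ "Suc 0"] dest: subgroup.one_closed)
      then show "\<zero> \<in> ?I" by auto
      fix a assume "a \<in> ?I"
      then obtain X where a: "a \<in> carrier R" and X: "gen X a" by auto
      {
        fix s assume s: "s \<in> carrier R"
        have "gen X (s \<otimes> a)"
          unfolding gen_def
        proof (intro conjI allI impI ballI)
          fix N q assume N: "submodule N R Q" "X \<subseteq> N" and q: "q \<in> carrier Q"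
          then obtain e :: nat where "(a [^] e) \<odot>\<^bsub>Q\<^esub> q \<in> N" using X unfolding gen_def by blast
          then have "(s [^] e) \<odot>\<^bsub>Q\<^esub> ((a [^] e) \<odot>\<^bsub>Q\<^esub> q) \<in> N"
            using submodule.smult_closed[OF N(1)] s by simp
          then have "((s \<otimes> a) [^] e) \<odot>\<^bsub>Q\<^esub> q \<in> N"
            using a s q by (simp add: R.nat_pow_distrib smult_assoc1)
          then show "\<exists>e::nat. ((s \<otimes> a) [^] e) \<odot>\<^bsub>Q\<^esub> q \<in> N" by blast
        qed (use X in \<open>auto simp: gen_def\<close>)
        then show "s \<otimes> a \<in> ?I" using a s by auto
      }
      fix b assume "b \<in> ?I"
      then obtain Y where b: "b \<in> carrier R" and Y: "gen Y b" by auto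
      have "gen (X \<union> Y) (a \<oplus> b)"
        unfolding gen_def
      proof (intro conjI allI impI ballI)
        fix N q assume N: "submodule N R Q" "X \<union> Y \<subseteq> N" and q: "q \<in> carrier Q"
        then obtain e e' :: nat where e: "(a [^] e) \<odot>\<^bsub>Q\<^esub> q \<in> N" "(b [^] e') \<odot>\<^bsub>Q\<^esub> q \<in> N"
          using X Y unfolding gen_def by (metis le_sup_iff)
        \<comment> \<open>For this fixed \<open>q\<close>, the scalars that carry \<open>q\<close>
          into \<open>N\<close>. The ideal contains a power of \<open>a\<close> and a power of
          \<open>b\<close>, hence one of their sum.\<close>
        let ?J = "{c \<in> carrier R. c \<odot>\<^bsub>Q\<^esub> q \<in> N}"
        have "ideal ?J R"
          using N(1) q submodule.smult_closed[OF N(1)] subgroup.one_closed[of N "add_monoid Q"] submoduleE(5)[OF N(1)]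
          by (intro R.idealI_cring) (auto simp: smult_l_distr smult_assoc1 submodule_def)
        from R.add_pow_in_ideal[OF this a b R.one_closed, of e e']
        show "\<exists>e::nat. ((a \<oplus> b) [^] e) \<odot>\<^bsub>Q\<^esub> q \<in> N"
          using e a b by auto
      qed (use X Y in \<open>auto simp: gen_def\<close>)
      then show "a \<oplus> b \<in> ?I" using a b by auto
    qed auto
    fix P assume "primeideal P R"
    then obtain f n x where f: "f \<in> carrier R - P" and lb: "local_basis R Q f n x"
      by (rule locally_free_local_basis[OF assms(3,4)])
    then have x: "x \<in> {..<n} \<rightarrow> carrier Q" by (simp add: local_basis_def)
    have "gen (x ` {..<n}) f"
      unfolding gen_def
    proof (intro conjI allI impI ballI)
      fix N q assume N: "submodule N R Q" "x ` {..<n} \<subseteq> N" and q: "q \<in> carrier Q"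
      from lb q obtain e :: nat and c where c: "c \<in> {..<n} \<rightarrow> carrier R"
        and eq: "(f [^] e) \<odot>\<^bsub>Q\<^esub> q = (\<Oplus>\<^bsub>Q\<^esub>i\<in>{..<n}. c i \<odot>\<^bsub>Q\<^esub> x i)"
        unfolding local_basis_def by meson
      have "(\<Oplus>\<^bsub>Q\<^esub>i\<in>I. c i \<odot>\<^bsub>Q\<^esub> x i) \<in> N" if "I \<subseteq> {..<n}" "finite I" for I
        using that(2,1)
      proof (induction I rule: finite_induct)
        case empty
        then show ?case using N(1) subgroup.one_closed[of N "add_monoid Q"] by (simp add: submodule_def)
      next
        case (insert j I)
        have "c j \<odot>\<^bsub>Q\<^esub> x j \<in> N"
          using insert.prems Pi_mem[OF c] N by (intro submodule.smult_closed[OF N(1)]) auto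
        moreover have "(\<lambda>i. c i \<odot>\<^bsub>Q\<^esub> x i) \<in> insert j I \<rightarrow> carrier Q"
          using insert.prems Pi_mem[OF c] Pi_mem[OF x] by auto
        ultimately show ?case
          using insert submoduleE(5)[OF N(1)] by auto
      qed
      then show "\<exists>e::nat. (f [^] e) \<odot>\<^bsub>Q\<^esub> q \<in> N" using eq by (metis finite_lessThan order_refl)
    qed (use x in auto)
    then show "\<exists>f\<in>carrier R - P. \<exists>n::nat. f [^] n \<in> ?I"
      using f by (intro bexI[of _ f] exI[of _ 1]) auto
  qed
  then obtain X where X: "gen X \<one>" by blast
  have "N = carrier Q" if N: "submodule N R Q" "X \<subseteq> N" for N
    using X N submoduleE(1)[OF N(1)] by (auto simp: gen_def)
  with X show ?thesis by (auto simp: gen_def)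
qed

text \<open>The annihilators of the powers of \<open>f\<close> form an ascending chain of ideals, so
  one of them contains all the others.\<close>

lemma (in noetherian_ring) bounded_torsion:
  assumes "cring R" "f \<in> carrier R"
  shows "\<exists>t::nat. \<forall>c\<in>carrier R. \<forall>e::nat. f [^] e \<otimes> c = \<zero> \<longrightarrow> f [^] t \<otimes> c = \<zero>"
proof -
  interpret cring R by fact
  let ?ann = "\<lambda>e::nat. {c \<in> carrier R. f [^] e \<otimes> c = \<zero>}"
  have mono: "?ann e \<subseteq> ?ann e'" if "e \<le> e'" for e e'
  proof clarify
    fix c assume c: "c \<in> carrier R" "f [^] e \<otimes> c = \<zero>"
    have "f [^] e' = f [^] (e' - e) \<otimes> f [^] e"
      using assms(2) that by (simp add: nat_pow_mult)
    then show "f [^] e' \<otimes> c = \<zero>" using c assms(2) by (simp add: m_assoc)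
  qed
  have "\<Union>(range ?ann) \<in> range ?ann"
  proof (rule ideal_chain_is_trivial)
    have "ideal (?ann e) R" for e
      using assms(2) by (intro idealI_cring) (auto simp: r_distr m_lcomm)
    moreover have "?ann e \<subseteq> ?ann e' \<or> ?ann e' \<subseteq> ?ann e" for e e'
      using mono[of e e'] mono[of e' e] by (cases "e \<le> e'") auto
    ultimately show "subset.chain {I. ideal I R} (range ?ann)"
      unfolding subset.chain_def by blast
  qed simp
  then obtain t where "\<Union>(range ?ann) = ?ann t" by auto
  then show ?thesis by blast
qed

text \<open>Two choices are made uniform. Finite generation yields one exponent \<open>e\<close> for
  which every multiple by \<open>f [^] e\<close> is a combination of the \<open>x i\<close>. The
  coefficients, chosen element by element, are unique up to f-power torsion; multiplying them by
  \<open>f [^] t\<close>, which kills all such torsion, makes them unique and therefore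
  linear.\<close>

lemma local_coordinates:
  fixes R (structure)
  assumes "cring R" "noetherian_ring R" "module R Q" "f \<in> carrier R"
    and fg: "finite X" "X \<subseteq> carrier Q" "\<forall>N. submodule N R Q \<longrightarrow> X \<subseteq> N \<longrightarrow> N = carrier Q"
    and lb: "local_basis R Q f n x"
  shows "\<exists>u::nat. \<exists>d. (\<forall>i<n. d i \<in> functionals R Q) \<and>
    (\<forall>q\<in>carrier Q. (f [^] u) \<odot>\<^bsub>Q\<^esub> q = (\<Oplus>\<^bsub>Q\<^esub>i\<in>{..<n}. d i q \<odot>\<^bsub>Q\<^esub> x i))"
proof -
  interpret module R Q by fact
  interpret N: noetherian_ring R by fact
  have x: "x \<in> {..<n} \<rightarrow> carrier Q"
    and gen: "\<And>q. q \<in> carrier Q \<Longrightarrow> \<exists>e::nat. \<exists>c\<in>{..<n} \<rightarrow> carrier R.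
           (f [^] e) \<odot>\<^bsub>Q\<^esub> q = (\<Oplus>\<^bsub>Q\<^esub>i\<in>{..<n}. c i \<odot>\<^bsub>Q\<^esub> x i)"
    and ind: "\<And>c i. c \<in> {..<n} \<rightarrow> carrier R \<Longrightarrow> (\<Oplus>\<^bsub>Q\<^esub>i\<in>{..<n}. c i \<odot>\<^bsub>Q\<^esub> x i) = \<zero>\<^bsub>Q\<^esub> \<Longrightarrow> i < n \<Longrightarrow>
           \<exists>e::nat. f [^] e \<otimes> c i = \<zero>"
    using lb by (simp_all add: local_basis_def)
  let ?I = "{..<n}"
  let ?C = "?I \<rightarrow> carrier R"
  define lc where "lc = (\<lambda>c. \<Oplus>\<^bsub>Q\<^esub>i\<in>?I. c i \<odot>\<^bsub>Q\<^esub> x i)"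
  have lc_closed: "lc c \<in> carrier Q" if "c \<in> ?C" for c
    unfolding lc_def using Pi_mem[OF that] Pi_mem[OF x] by (intro M.finsum_closed) auto
  have lc_add: "lc (\<lambda>i. c i \<oplus> c' i) = lc c \<oplus>\<^bsub>Q\<^esub> lc c'" if c: "c \<in> ?C" "c' \<in> ?C" for c c'
  proof -
    note cc = Pi_mem[OF c(1)] Pi_mem[OF c(2)] Pi_mem[OF x]
    have "lc (\<lambda>i. c i \<oplus> c' i) = (\<Oplus>\<^bsub>Q\<^esub>i\<in>?I. c i \<odot>\<^bsub>Q\<^esub> x i \<oplus>\<^bsub>Q\<^esub> c' i \<odot>\<^bsub>Q\<^esub> x i)"
      unfolding lc_def using cc by (intro M.finsum_cong') (auto simp: smult_l_distr)
    also have "\<dots> = lc c \<oplus>\<^bsub>Q\<^esub> lc c'"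
      unfolding lc_def using cc by (intro M.finsum_addf) auto
    finally show ?thesis .
  qed
  have lc_smult: "lc (\<lambda>i. r \<otimes> c i) = r \<odot>\<^bsub>Q\<^esub> lc c" if c: "c \<in> ?C" and r: "r \<in> carrier R" for c r
  proof -
    note cc = Pi_mem[OF c(1)] Pi_mem[OF x]
    have "lc (\<lambda>i. r \<otimes> c i) = (\<Oplus>\<^bsub>Q\<^esub>i\<in>?I. r \<odot>\<^bsub>Q\<^esub> (c i \<odot>\<^bsub>Q\<^esub> x i))"
      unfolding lc_def using cc r by (intro M.finsum_cong') (auto simp: smult_assoc1)
    also have "\<dots> = r \<odot>\<^bsub>Q\<^esub> lc c"
      unfolding lc_def using cc r by (intro finsum_smult_ldistr[symmetric]) auto
    finally show ?thesis .
  qed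
  \<comment> \<open>An ascending family of submodules. Each of the finitely many generators lies in
    some member, so one member contains them all and equals \<open>Q\<close>.\<close>
  define L where "L = (\<lambda>e::nat. {q \<in> carrier Q. \<exists>c\<in>?C. (f [^] e) \<odot>\<^bsub>Q\<^esub> q = lc c})"
  have L_sub: "submodule (L e) R Q" for e
  proof -
    have add: "a \<oplus>\<^bsub>Q\<^esub> b \<in> L e" if ab: "a \<in> L e" "b \<in> L e" for a b
    proof -
      obtain c c' where "a \<in> carrier Q" "b \<in> carrier Q" "c \<in> ?C" "c' \<in> ?C"
        "(f [^] e) \<odot>\<^bsub>Q\<^esub> a = lc c" "(f [^] e) \<odot>\<^bsub>Q\<^esub> b = lc c'" using ab by (auto simp: L_def)
      then show ?thesis
        using assms(4) lc_add by (auto simp: L_def smult_r_distr intro!: bexI[of _ "\<lambda>i. c i \<oplus> c' i"])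
    qed
    have sm: "r \<odot>\<^bsub>Q\<^esub> a \<in> L e" if a: "a \<in> L e" and r: "r \<in> carrier R" for a r
    proof -
      obtain c where c: "a \<in> carrier Q" "c \<in> ?C" "(f [^] e) \<odot>\<^bsub>Q\<^esub> a = lc c" using a by (auto simp: L_def)
      have "(f [^] e) \<odot>\<^bsub>Q\<^esub> (r \<odot>\<^bsub>Q\<^esub> a) = r \<odot>\<^bsub>Q\<^esub> ((f [^] e) \<odot>\<^bsub>Q\<^esub> a)"
        using c(1) r assms(4) by (simp add: smult_assoc1[symmetric] R.m_comm)
      then show ?thesis
        using c r assms(4) lc_smult by (auto simp: L_def intro!: bexI[of _ "\<lambda>i. r \<otimes> c i"])
    qed
    have Lc: "L e \<subseteq> carrier Q" by (auto simp: L_def)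
    have "lc (\<lambda>_. \<zero>) = \<zero>\<^bsub>Q\<^esub>"
      using lc_smult[of "\<lambda>_. \<zero>" "\<zero>"] lc_closed[of "\<lambda>_. \<zero>"] by simp
    then have z: "\<zero>\<^bsub>Q\<^esub> \<in> L e"
      using assms(4) by (auto simp: L_def intro!: bexI[of _ "\<lambda>_. \<zero>"])
    have mi: "\<ominus>\<^bsub>Q\<^esub> a \<in> L e" if a: "a \<in> L e" for a
      using sm[OF a, of "\<ominus> \<one>"] a Lc smult_l_minus[of "\<one>" a] by auto
    show ?thesis by (rule submoduleI[OF Lc z mi add sm])
  qed
  have L_mono: "L e \<subseteq> L e'" if "e \<le> e'" for e e'
  proof
    fix q assume "q \<in> L e"
    then obtain c where c: "q \<in> carrier Q" "c \<in> ?C" "(f [^] e) \<odot>\<^bsub>Q\<^esub> q = lc c" by (auto simp: L_def)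
    have "f [^] e' = f [^] (e' - e) \<otimes> f [^] e"
      using assms(4) that by (simp add: R.nat_pow_mult)
    then have "(f [^] e') \<odot>\<^bsub>Q\<^esub> q = lc (\<lambda>i. f [^] (e' - e) \<otimes> c i)"
      using c assms(4) by (simp add: lc_smult smult_assoc1)
    then show "q \<in> L e'"
      using c assms(4) by (auto simp: L_def intro!: bexI[of _ "\<lambda>i. f [^] (e' - e) \<otimes> c i"])
  qed
  have "\<forall>q\<in>X. \<exists>e. q \<in> L e" using gen fg(2) unfolding L_def lc_def by blast
  then obtain ee where ee: "\<And>q. q \<in> X \<Longrightarrow> q \<in> L (ee q)" by metis
  \<comment> \<open>Inserting 0 keeps \<open>Max\<close> meaningful when the generating set is
    empty.\<close>
  define e where "e = Max (insert 0 (ee ` X))"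
  have "X \<subseteq> L e"
  proof
    fix q assume "q \<in> X"
    then have "ee q \<le> e" using fg(1) by (auto simp: e_def intro: Max_ge)
    then show "q \<in> L e" using ee[OF \<open>q \<in> X\<close>] L_mono by blast
  qed
  then have "L e = carrier Q" using fg(3) L_sub by blast
  then have "\<forall>q\<in>carrier Q. \<exists>c\<in>?C. (f [^] e) \<odot>\<^bsub>Q\<^esub> q = lc c" unfolding L_def by blast
  then obtain c where c: "\<And>q. q \<in> carrier Q \<Longrightarrow> c q \<in> ?C"
    and c_eq: "\<And>q. q \<in> carrier Q \<Longrightarrow> (f [^] e) \<odot>\<^bsub>Q\<^esub> q = lc (c q)" by metis
  obtain t :: nat where t: "\<And>c e'. c \<in> carrier R \<Longrightarrow> f [^] (e'::nat) \<otimes> c = \<zero> \<Longrightarrow> f [^] t \<otimes> c = \<zero>"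
    using N.bounded_torsion[OF assms(1,4)] by blast
  \<comment> \<open>Two coordinate vectors of one element differ by a relation among the
    \<open>x i\<close>, whose coefficients are f-power torsion.\<close>
  have uniq: "f [^] t \<otimes> a i = f [^] t \<otimes> b i"
    if ab: "a \<in> ?C" "b \<in> ?C" "lc a = lc b" "i < n" for a b i
  proof -
    have ai: "a i \<in> carrier R" "b i \<in> carrier R" using Pi_mem[OF ab(1)] Pi_mem[OF ab(2)] ab(4) by auto
    have mb: "(\<lambda>i. \<ominus> \<one> \<otimes> b i) \<in> ?C" using Pi_mem[OF ab(2)] by auto
    have "lc (\<lambda>i. a i \<oplus> (\<ominus> \<one> \<otimes> b i)) = lc a \<oplus>\<^bsub>Q\<^esub> (\<ominus> \<one>) \<odot>\<^bsub>Q\<^esub> lc b"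
      using lc_add[OF ab(1) mb] lc_smult[OF ab(2)] by simp
    also have "\<dots> = \<zero>\<^bsub>Q\<^esub>"
      using lc_closed[OF ab(2)] ab(3) by (simp add: smult_l_minus M.r_neg)
    finally obtain e' :: nat where "f [^] e' \<otimes> (a i \<oplus> (\<ominus> \<one> \<otimes> b i)) = \<zero>"
      using ind[of "\<lambda>i. a i \<oplus> (\<ominus> \<one> \<otimes> b i)" i] ab(4) Pi_mem[OF ab(1)] Pi_mem[OF mb]
      by (auto simp: lc_def)
    then have "f [^] t \<otimes> (a i \<oplus> (\<ominus> \<one> \<otimes> b i)) = \<zero>"
      using ai by (intro t[of _ e']) auto
    then have "f [^] t \<otimes> a i \<oplus> \<ominus> (f [^] t \<otimes> b i) = \<zero>"
      using ai assms(4) by (simp add: R.r_distr R.l_minus R.r_minus)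
    then show ?thesis
      using ai assms(4) by (metis R.r_right_minus_eq a_minus_def R.m_closed R.nat_pow_closed)
  qed
  let ?d = "\<lambda>i. \<lambda>q\<in>carrier Q. f [^] t \<otimes> c q i"
  have ci: "c q i \<in> carrier R" if "q \<in> carrier Q" "i < n" for q i using Pi_mem[OF c[OF that(1)]] that(2) by simp
  show ?thesis
  proof (intro exI[of _ "t + e"] exI[of _ ?d] conjI allI impI ballI)
    fix i assume i: "i < n"
    have add: "f [^] t \<otimes> c (q \<oplus>\<^bsub>Q\<^esub> q') i = f [^] t \<otimes> c q i \<oplus> f [^] t \<otimes> c q' i"
      if q: "q \<in> carrier Q" "q' \<in> carrier Q" for q q'
    proof -
      have "lc (c (q \<oplus>\<^bsub>Q\<^esub> q')) = lc (\<lambda>i. c q i \<oplus> c q' i)"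
        using q assms(4) by (simp add: c_eq[symmetric] lc_add c smult_r_distr)
      then have "f [^] t \<otimes> c (q \<oplus>\<^bsub>Q\<^esub> q') i = f [^] t \<otimes> (c q i \<oplus> c q' i)"
        using q ci i by (intro uniq) (auto intro: c)
      then show ?thesis using ci[OF q(1) i] ci[OF q(2) i] assms(4) by (simp add: R.r_distr)
    qed
    have sm: "f [^] t \<otimes> c (r \<odot>\<^bsub>Q\<^esub> q) i = r \<otimes> (f [^] t \<otimes> c q i)"
      if q: "q \<in> carrier Q" "r \<in> carrier R" for q r
    proof -
      have "(f [^] e) \<odot>\<^bsub>Q\<^esub> (r \<odot>\<^bsub>Q\<^esub> q) = r \<odot>\<^bsub>Q\<^esub> ((f [^] e) \<odot>\<^bsub>Q\<^esub> q)"
        using q assms(4) by (simp add: smult_assoc1[symmetric] R.m_comm)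
      then have "lc (c (r \<odot>\<^bsub>Q\<^esub> q)) = lc (\<lambda>i. r \<otimes> c q i)"
        using q assms(4) by (simp add: c_eq lc_smult c)
      then have "f [^] t \<otimes> c (r \<odot>\<^bsub>Q\<^esub> q) i = f [^] t \<otimes> (r \<otimes> c q i)"
        using q ci i by (intro uniq) (auto intro: c)
      then show ?thesis using ci[OF q(1) i] assms(4) q by (simp add: R.m_lcomm)
    qed
    show "?d i \<in> functionals R Q"
      using add sm ci i assms(4) by (auto simp: functionals_iff)
  next
    fix q assume q: "q \<in> carrier Q"
    have "(f [^] (t + e)) \<odot>\<^bsub>Q\<^esub> q = (f [^] t) \<odot>\<^bsub>Q\<^esub> ((f [^] e) \<odot>\<^bsub>Q\<^esub> q)"
      using q assms(4) by (simp add: smult_assoc1[symmetric] R.nat_pow_mult)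
    also have "\<dots> = lc (\<lambda>i. f [^] t \<otimes> c q i)"
      using q assms(4) by (simp add: c_eq lc_smult c)
    finally show "(f [^] (t + e)) \<odot>\<^bsub>Q\<^esub> q = (\<Oplus>\<^bsub>Q\<^esub>i\<in>?I. ?d i q \<odot>\<^bsub>Q\<^esub> x i)"
      using q by (simp add: lc_def)
  qed
qed

section \<open>Extending functionals across a locally free quotient\<close>

lemma finsum_quot_module:
  assumes "module R M" "submodule N R M" "finite I" "\<And>i. i \<in> I \<Longrightarrow> z i \<in> carrier M"
  shows "(\<Oplus>\<^bsub>quot_module M N\<^esub>i\<in>I. N +>\<^bsub>M\<^esub> z i) = N +>\<^bsub>M\<^esub> (\<Oplus>\<^bsub>M\<^esub>i\<in>I. z i)"
proof -
  interpret M: module R M by fact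
  interpret Q: module R "quot_module M N" by (rule quot_module_is_module) fact+
  show ?thesis
    using assms(3,4)
  proof (induction I rule: finite_induct)
    case empty
    then show ?case
      using coset_eq_self_iff[OF assms(1,2) M.M.zero_closed] submodule.axioms(1)[OF assms(2)]
        subgroup.one_closed[of N "add_monoid M"] by (simp add: quot_module_zero[OF assms(1)])
  next
    case (insert j I)
    then show ?case
      by (simp add: carrier_quot_module[OF assms(1)] quot_module_add[OF assms(1,2)] Pi_def
          M.M.finsum_closed)
  qed
qed

lemma functional_extension:
  fixes R (structure)
  assumes "cring R" "noetherian_ring R" "module R M" "submodule N R M"
    and lf: "locally_free_of_rank R (quot_module M N) r"
    and g: "g \<in> functionals R (submodule_of M N)"
  shows "\<exists>G\<in>functionals R M. \<forall>y\<in>N. G y = g y"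
proof -
  interpret module R M by fact
  let ?Q = "quot_module M N"
  have Q: "module R ?Q" by (rule quot_module_is_module) fact+
  have NM: "N \<subseteq> carrier M" using submoduleE(1)[OF assms(4)] .
  have gN: "submodule_of M N = M\<lparr>carrier := N\<rparr>" by (simp add: submodule_of_def)
  note g_closed = functional_closed[OF g, unfolded gN, simplified]
    and g_add = functional_add[OF g, unfolded gN, simplified]
    and g_smult = functional_smult[OF g, unfolded gN, simplified]
  \<comment> \<open>Where \<open>M / N\<close> is free on \<open>x\<^sub>i\<close> after inverting \<open>f\<close>, clearing denominators gives coordinates \<open>d\<^sub>i\<close> with
    \<open>f\<^sup>u y - \<Sum> d\<^sub>i(y) x\<^sub>i \<in> N\<close> for all \<open>y\<close>, so that \<open>f\<^sup>u g\<close> extends to \<open>M\<close>.\<close>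
  let ?I = "{a \<in> carrier R. \<exists>G\<in>functionals R M. \<forall>y\<in>N. G y = a \<otimes> g y}"
  have "\<one> \<in> ?I"
  proof (rule one_in_ideal_if_locally[OF assms(1,2)])
    show "ideal ?I R"
    proof (rule R.idealI_cring)
      have "(\<lambda>x\<in>carrier M. \<zero>) \<in> functionals R M" by (auto simp: functionals_iff)
      then show "\<zero> \<in> ?I" using NM g_closed by (auto intro!: bexI[of _ "\<lambda>x\<in>carrier M. \<zero>"])
    next
      fix a b assume "a \<in> ?I" "b \<in> ?I"
      then obtain G H where ab: "a \<in> carrier R" "b \<in> carrier R"
        and G: "G \<in> functionals R M" "\<And>y. y \<in> N \<Longrightarrow> G y = a \<otimes> g y"
        and H: "H \<in> functionals R M" "\<And>y. y \<in> N \<Longrightarrow> H y = b \<otimes> g y" by auto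
      have "(\<lambda>x\<in>carrier M. G x \<oplus> H x) \<in> functionals R M"
        using G(1) H(1) by (auto simp: functionals_iff R.a_ac R.r_distr)
      moreover have "\<forall>y\<in>N. (\<lambda>x\<in>carrier M. G x \<oplus> H x) y = (a \<oplus> b) \<otimes> g y"
        using NM G(2) H(2) ab g_closed by (auto simp: R.l_distr)
      ultimately show "a \<oplus> b \<in> ?I" using ab by blast
    next
      fix a s assume "a \<in> ?I" and s: "s \<in> carrier R"
      then obtain G where a: "a \<in> carrier R"
        and G: "G \<in> functionals R M" "\<And>y. y \<in> N \<Longrightarrow> G y = a \<otimes> g y" by auto
      have "(\<lambda>x\<in>carrier M. s \<otimes> G x) \<in> functionals R M"
        using G(1) s by (auto simp: functionals_iff R.m_lcomm R.r_distr)
      moreover have "\<forall>y\<in>N. (\<lambda>x\<in>carrier M. s \<otimes> G x) y = (s \<otimes> a) \<otimes> g y"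
        using NM G(2) a s g_closed by (auto simp: R.m_assoc)
      ultimately show "s \<otimes> a \<in> ?I" using a s by blast
    qed auto
    fix P assume "primeideal P R"
    then obtain f n x where f: "f \<in> carrier R - P" and lb: "local_basis R ?Q f n x"
      by (rule locally_free_local_basis[OF Q lf])
    then have x: "x \<in> {..<n} \<rightarrow> carrier ?Q" by (simp add: local_basis_def)
    obtain X where X: "finite X" "X \<subseteq> carrier ?Q" "\<forall>L. submodule L R ?Q \<longrightarrow> X \<subseteq> L \<longrightarrow> L = carrier ?Q"
      using locally_free_finitely_generated[OF assms(1,2) Q lf] by (elim exE conjE)
    have fc: "f \<in> carrier R" using f by blast
    obtain u :: nat and d where d': "\<forall>i<n. d i \<in> functionals R ?Q"
      and d_eq': "\<forall>q\<in>carrier ?Q. (f [^] u) \<odot>\<^bsub>?Q\<^esub> q = (\<Oplus>\<^bsub>?Q\<^esub>i\<in>{..<n}. d i q \<odot>\<^bsub>?Q\<^esub> x i)"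
      using local_coordinates[OF assms(1,2) Q fc X lb] by (elim exE conjE)
    note d = d'[rule_format] and d_eq = d_eq'[rule_format]
    have "\<forall>i\<in>{..<n}. \<exists>z\<in>carrier M. x i = N +>\<^bsub>M\<^esub> z"
      using x by (auto simp: carrier_quot_module[OF assms(3)])
    then obtain z where z: "\<And>i. i \<in> {..<n} \<Longrightarrow> z i \<in> carrier M" "\<And>i. i \<in> {..<n} \<Longrightarrow> x i = N +>\<^bsub>M\<^esub> z i"
      by metis
    let ?w = "f [^] u"
    have w: "?w \<in> carrier R" using fc by simp
    let ?c = "\<lambda>y. N +>\<^bsub>M\<^esub> y"
    define p where "p = (\<lambda>U. \<Oplus>\<^bsub>M\<^esub>i\<in>{..<n}. d i U \<odot>\<^bsub>M\<^esub> z i)"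
    have dI: "\<forall>i\<in>{..<n}. d i \<in> functionals R ?Q" and zI: "\<forall>i\<in>{..<n}. z i \<in> carrier M"
      using d z(1) by simp_all
    have p: "U \<in> carrier ?Q \<Longrightarrow> p U \<in> carrier M"
      "U \<in> carrier ?Q \<Longrightarrow> V \<in> carrier ?Q \<Longrightarrow> p (U \<oplus>\<^bsub>?Q\<^esub> V) = p U \<oplus>\<^bsub>M\<^esub> p V"
      "s \<in> carrier R \<Longrightarrow> U \<in> carrier ?Q \<Longrightarrow> p (s \<odot>\<^bsub>?Q\<^esub> U) = s \<odot>\<^bsub>M\<^esub> p U" for U V s
      unfolding p_def using finsum_lin_maps[OF Q assms(3) finite_lessThan dI zI] by blast+
    have cQ: "?c y \<in> carrier ?Q" if "y \<in> carrier M" for y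
      using that by (auto simp: carrier_quot_module[OF assms(3)])
    define D where "D = (\<lambda>y. ?w \<odot>\<^bsub>M\<^esub> y \<ominus>\<^bsub>M\<^esub> p (?c y))"
    have D_N: "D y \<in> N" if y: "y \<in> carrier M" for y
    proof -
      have "?c (?w \<odot>\<^bsub>M\<^esub> y) = (\<Oplus>\<^bsub>?Q\<^esub>i\<in>{..<n}. d i (?c y) \<odot>\<^bsub>?Q\<^esub> x i)"
        using d_eq[OF cQ[OF y]] quot_module_smult[OF assms(3,4) w y] by simp
      also have "\<dots> = (\<Oplus>\<^bsub>?Q\<^esub>i\<in>{..<n}. ?c (d i (?c y) \<odot>\<^bsub>M\<^esub> z i))"
      proof -
        interpret Q: module R ?Q by (rule Q)
        show ?thesis
          using z functional_closed[OF d cQ[OF y]]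
          by (intro Q.M.finsum_cong') (auto simp: quot_module_smult[OF assms(3,4)] intro!: cQ)
      qed
      also have "\<dots> = ?c (p (?c y))"
        unfolding p_def using z functional_closed[OF d cQ[OF y]]
        by (intro finsum_quot_module[OF assms(3,4)]) auto
      finally show ?thesis
        unfolding D_def using coset_eq_iff[OF assms(3,4)] y w p(1)[OF cQ[OF y]] by simp
    qed
    have D_add: "D (y \<oplus>\<^bsub>M\<^esub> y') = D y \<oplus>\<^bsub>M\<^esub> D y'" if y: "y \<in> carrier M" "y' \<in> carrier M" for y y'
    proof -
      have "p (?c (y \<oplus>\<^bsub>M\<^esub> y')) = p (?c y) \<oplus>\<^bsub>M\<^esub> p (?c y')"
        using p(2)[OF cQ[OF y(1)] cQ[OF y(2)]] quot_module_add[OF assms(3,4) y] by simp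
      then show ?thesis
        using y w p(1)[OF cQ[OF y(1)]] p(1)[OF cQ[OF y(2)]]
        by (simp add: D_def smult_r_distr a_minus_def M.minus_add M.a_ac)
    qed
    have D_smult: "D (s \<odot>\<^bsub>M\<^esub> y) = s \<odot>\<^bsub>M\<^esub> D y" if y: "y \<in> carrier M" and s: "s \<in> carrier R" for y s
    proof -
      have "p (?c (s \<odot>\<^bsub>M\<^esub> y)) = s \<odot>\<^bsub>M\<^esub> p (?c y)"
        using p(3)[OF s cQ[OF y]] quot_module_smult[OF assms(3,4) s y] by simp
      then show ?thesis
        using y w s p(1)[OF cQ[OF y]]
        by (simp add: D_def smult_r_distr a_minus_def smult_r_minus smult_assoc1[symmetric] R.m_comm)
    qed
    have D_on_N: "D y = ?w \<odot>\<^bsub>M\<^esub> y" if y: "y \<in> N" for y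
    proof -
      interpret Q: module R ?Q by (rule Q)
      have yM: "y \<in> carrier M" using y NM by blast
      have "?c y = \<zero>\<^bsub>?Q\<^esub>" using coset_eq_self_iff[OF assms(3,4) yM] y by (simp add: quot_module_def)
      \<comment> \<open>\<open>p\<close> kills zero because it commutes with scalars and zero is
        zero times itself.\<close>
      then have "p (?c y) = \<zero> \<odot>\<^bsub>M\<^esub> p \<zero>\<^bsub>?Q\<^esub>"
        using p(3)[OF R.zero_closed Q.M.zero_closed] by simp
      then show ?thesis
        using yM w p(1)[OF Q.M.zero_closed] by (simp add: D_def M.minus_eq)
    qed
    have "(\<lambda>y\<in>carrier M. g (D y)) \<in> functionals R M"
      using D_N by (auto simp: functionals_iff D_add D_smult g_add g_smult g_closed)
    moreover have "\<forall>y\<in>N. (\<lambda>y\<in>carrier M. g (D y)) y = ?w \<otimes> g y"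
      using NM w by (auto simp: D_on_N g_smult)
    ultimately have "?w \<in> ?I" using w by blast
    then show "\<exists>f\<in>carrier R - P. \<exists>n::nat. f [^] n \<in> ?I" using f by blast
  qed
  then show ?thesis using g_closed by auto
qed

section \<open>Tensor products\<close>

lemma subgroup_hom_vimage:
  assumes "group G" "group H" "h \<in> hom G H" "subgroup W H"
  shows "subgroup {z \<in> carrier G. h z \<in> W} G"
proof -
  interpret group_hom G H h using assms by (simp add: group_hom_def group_hom_axioms_def)
  show ?thesis
    using subgroup.one_closed[OF assms(4)] subgroup.m_inv_closed[OF assms(4)] subgroup.m_closed[OF assms(4)]
    by (intro G.subgroupI) auto
qed

abbreviation "supp \<equiv> Poly_Mapping.keys"

text \<open>Closure of the operations is all that the relation subgroup and the group of classes
  rest on. This weak form also covers \<open>GD\<close> over \<open>GA\<close>, for which module and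
  ring axioms are not established.\<close>

locale tensor =
  fixes R :: "('r, 'x) ring_scheme" and M :: "('r, 'm) module" and N :: "('r, 'n) module"
  assumes left_add: "x \<in> carrier M \<Longrightarrow> x' \<in> carrier M \<Longrightarrow> x \<oplus>\<^bsub>M\<^esub> x' \<in> carrier M"
    and right_add: "y \<in> carrier N \<Longrightarrow> y' \<in> carrier N \<Longrightarrow> y \<oplus>\<^bsub>N\<^esub> y' \<in> carrier N"
    and left_smult: "r \<in> carrier R \<Longrightarrow> x \<in> carrier M \<Longrightarrow> r \<odot>\<^bsub>M\<^esub> x \<in> carrier M"
    and right_smult: "r \<in> carrier R \<Longrightarrow> y \<in> carrier N \<Longrightarrow> r \<odot>\<^bsub>N\<^esub> y \<in> carrier N"
begin

abbreviation "S \<equiv> carrier M \<times> carrier N"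
abbreviation "Fr \<equiv> free_Abelian_group S"
abbreviation "Kr \<equiv> tensor_kernel R M N"
abbreviation "cl \<equiv> tensor_class R M N"
abbreviation "T \<equiv> tensor_product R M N"

lemma diff_in_Fr:
  assumes "a \<in> carrier Fr" "b \<in> carrier Fr"
  shows "a - b \<in> carrier Fr"
  using assms keys_diff[of a b] unfolding carrier_free_Abelian_group_iff by blast

lemma tensor_rels_subset: "tensor_rels R M N \<subseteq> carrier Fr"
proof
  fix z assume z: "z \<in> tensor_rels R M N"
  have fr: "frag_of (x, y) \<in> carrier Fr" if "x \<in> carrier M" "y \<in> carrier N" for x y
    using that by simp
  from z show "z \<in> carrier Fr"
    unfolding tensor_rels_def
    by (elim UnE CollectE exE conjE; hypsubst; intro diff_in_Fr fr left_add right_add left_smult right_smult)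
qed

lemma tensor_relsE:
  assumes "w \<in> tensor_rels R M N"
  obtains (left) x x' y where "x \<in> carrier M" "x' \<in> carrier M" "y \<in> carrier N"
      "w = frag_of (x \<oplus>\<^bsub>M\<^esub> x', y) - frag_of (x, y) - frag_of (x', y)"
    | (right) x y y' where "x \<in> carrier M" "y \<in> carrier N" "y' \<in> carrier N"
      "w = frag_of (x, y \<oplus>\<^bsub>N\<^esub> y') - frag_of (x, y) - frag_of (x, y')"
    | (smult) s x y where "s \<in> carrier R" "x \<in> carrier M" "y \<in> carrier N"
      "w = frag_of (s \<odot>\<^bsub>M\<^esub> x, y) - frag_of (x, s \<odot>\<^bsub>N\<^esub> y)"
  using assms unfolding tensor_rels_def
  by (elim UnE CollectE exE conjE) (rule left right smult; assumption)+

lemma tensor_kernel_subgroup: "subgroup Kr Fr"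
  unfolding tensor_kernel_def
  by (rule group.generate_is_subgroup[OF group_free_Abelian_group tensor_rels_subset])

lemma tensor_kernel_keys: "z \<in> Kr \<Longrightarrow> supp z \<subseteq> S"
  using subsetD[OF subgroup.subset[OF tensor_kernel_subgroup]] by simp

lemma tensor_kernel_zero: "0 \<in> Kr"
  using subgroup.one_closed[OF tensor_kernel_subgroup] by simp

lemma tensor_kernel_add: "z \<in> Kr \<Longrightarrow> z' \<in> Kr \<Longrightarrow> z + z' \<in> Kr"
  using subgroup.m_closed[OF tensor_kernel_subgroup] by simp

lemma tensor_kernel_minus: "z \<in> Kr \<Longrightarrow> - z \<in> Kr"
  using subgroup.m_inv_closed[OF tensor_kernel_subgroup, of z] tensor_kernel_keys[of z] by simp

lemma tensor_kernel_diff: "z \<in> Kr \<Longrightarrow> z' \<in> Kr \<Longrightarrow> z - z' \<in> Kr"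
  using tensor_kernel_add[OF _ tensor_kernel_minus] by (metis diff_conv_add_uminus)

lemma rel_left:
  "x \<in> carrier M \<Longrightarrow> x' \<in> carrier M \<Longrightarrow> y \<in> carrier N \<Longrightarrow>
    frag_of (x \<oplus>\<^bsub>M\<^esub> x', y) - frag_of (x, y) - frag_of (x', y) \<in> Kr"
  and rel_right:
  "x \<in> carrier M \<Longrightarrow> y \<in> carrier N \<Longrightarrow> y' \<in> carrier N \<Longrightarrow>
    frag_of (x, y \<oplus>\<^bsub>N\<^esub> y') - frag_of (x, y) - frag_of (x, y') \<in> Kr"
  and rel_smult:
  "r \<in> carrier R \<Longrightarrow> x \<in> carrier M \<Longrightarrow> y \<in> carrier N \<Longrightarrow>
    frag_of (r \<odot>\<^bsub>M\<^esub> x, y) - frag_of (x, r \<odot>\<^bsub>N\<^esub> y) \<in> Kr"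
  unfolding tensor_kernel_def tensor_rels_def by (rule generate.incl, blast)+

text \<open>The preimage of \<open>W\<close> is a subgroup, so it suffices that it contains the
  relations. The target \<open>W\<close> will be the relation subgroup itself, the trivial subgroup,
  and finally the group of restrictions of elements of \<open>ID\<close>.\<close>

lemma hom_tensor_kernel:
  assumes "group G" "h \<in> hom Fr G" "subgroup W G" "\<And>z. z \<in> tensor_rels R M N \<Longrightarrow> h z \<in> W" "z \<in> Kr"
  shows "h z \<in> W"
proof -
  have "subgroup {z \<in> carrier Fr. h z \<in> W} Fr"
    by (rule subgroup_hom_vimage) (use assms in auto)
  moreover have "tensor_rels R M N \<subseteq> {z \<in> carrier Fr. h z \<in> W}" using assms(4) tensor_rels_subset by blast
  ultimately show ?thesis
    using group.generate_subgroup_incl[OF group_free_Abelian_group] assms(5)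
    unfolding tensor_kernel_def by blast
qed

lemma tensor_class_iff: "w \<in> cl z \<longleftrightarrow> w - z \<in> Kr"
proof -
  have "w \<in> cl z \<longleftrightarrow> (\<exists>k\<in>Kr. w = k + z)" by (auto simp: tensor_class_def r_coset_def)
  also have "\<dots> \<longleftrightarrow> w - z \<in> Kr" by (metis add_diff_cancel_right' diff_add_cancel)
  finally show ?thesis .
qed

lemma tensor_class_eq_iff: "cl z = cl z' \<longleftrightarrow> z - z' \<in> Kr"
proof
  assume "cl z = cl z'"
  moreover have "z \<in> cl z" by (simp add: tensor_class_iff tensor_kernel_zero)
  ultimately show "z - z' \<in> Kr" by (simp add: tensor_class_iff)
next
  assume zz: "z - z' \<in> Kr"
  show "cl z = cl z'"
  proof (rule Set.set_eqI)
    fix w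
    show "w \<in> cl z \<longleftrightarrow> w \<in> cl z'"
      using tensor_kernel_add[OF zz, of "w - z"] tensor_kernel_diff[OF _ zz, of "w - z'"]
      by (auto simp: tensor_class_iff algebra_simps)
  qed
qed

lemma carrier_tensor: "carrier T = cl ` {z. supp z \<subseteq> S}"
  by (auto simp: tensor_product_def Let_def FactGroup_def RCOSETS_def tensor_class_def)

lemma tensor_add:
  assumes "supp z \<subseteq> S" "supp z' \<subseteq> S"
  shows "cl z \<oplus>\<^bsub>T\<^esub> cl z' = cl (z + z')"
proof (rule Set.set_eqI)
  fix w
  have "w \<in> cl z \<oplus>\<^bsub>T\<^esub> cl z' \<longleftrightarrow> (\<exists>a b. a - z \<in> Kr \<and> b - z' \<in> Kr \<and> w = a + b)"
    unfolding tensor_product_def Let_def FactGroup_def set_mult_def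
    by (auto simp: tensor_class_iff Bex_def)
  also have "\<dots> \<longleftrightarrow> w - (z + z') \<in> Kr"
  proof
    assume "\<exists>a b. a - z \<in> Kr \<and> b - z' \<in> Kr \<and> w = a + b"
    then obtain a b where ab: "a - z \<in> Kr" "b - z' \<in> Kr" "w = a + b" by blast
    from tensor_kernel_add[OF ab(1,2)] show "w - (z + z') \<in> Kr" by (simp add: ab(3) algebra_simps)
  next
    assume "w - (z + z') \<in> Kr"
    then show "\<exists>a b. a - z \<in> Kr \<and> b - z' \<in> Kr \<and> w = a + b"
      by (intro exI[of _ "w - z'"] exI[of _ z']) (simp add: tensor_kernel_zero algebra_simps)
  qed
  finally show "w \<in> cl z \<oplus>\<^bsub>T\<^esub> cl z' \<longleftrightarrow> w \<in> cl (z + z')" by (simp add: tensor_class_iff)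
qed

abbreviation "act r \<equiv> frag_extend (\<lambda>(x, y). frag_of (r \<odot>\<^bsub>M\<^esub> x, y))"

lemma act_keys:
  assumes "r \<in> carrier R" "supp z \<subseteq> S"
  shows "supp (act r z) \<subseteq> S"
proof -
  have "supp (act r z) \<subseteq>
    (\<Union>x\<in>supp z. supp ((\<lambda>(x, y). frag_of (r \<odot>\<^bsub>M\<^esub> x, y) :: _ \<Rightarrow>\<^sub>0 int) x))"
    by (rule keys_frag_extend)
  also have "\<dots> \<subseteq> S" using assms left_smult by auto
  finally show ?thesis .
qed

end

locale module_tensor = tensor R M N + M: module R M + N: module R N
  for R :: "('r, 'x) ring_scheme" and M :: "('r, 'm) module" and N :: "('r, 'n) module"
begin

text \<open>Acting on the left factor turns each relation into one of the same kind; for the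
  balancing relation this uses that \<open>r\<close> and \<open>s\<close> commute. Hence scalars act
  on classes independently of representatives.\<close>

lemma act_tensor_kernel:
  assumes r: "r \<in> carrier R" and z: "z \<in> Kr"
  shows "act r z \<in> Kr"
proof (rule hom_tensor_kernel[OF group_free_Abelian_group _ tensor_kernel_subgroup _ z])
  show "act r \<in> hom Fr Fr"
    using act_keys[OF r] by (intro homI) (simp_all add: frag_extend_add)
  fix w assume "w \<in> tensor_rels R M N"
  then show "act r w \<in> Kr"
  proof (cases rule: tensor_relsE)
    case (left x x' y)
    then show ?thesis
      using rel_left[of "r \<odot>\<^bsub>M\<^esub> x" "r \<odot>\<^bsub>M\<^esub> x'" y] r by (simp add: frag_extend_diff M.smult_r_distr)
  next
    case (right x y y')
    then show ?thesis
      using rel_right[of "r \<odot>\<^bsub>M\<^esub> x" y y'] r by (simp add: frag_extend_diff)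
  next
    case (smult s x y)
    have "r \<odot>\<^bsub>M\<^esub> (s \<odot>\<^bsub>M\<^esub> x) = s \<odot>\<^bsub>M\<^esub> (r \<odot>\<^bsub>M\<^esub> x)"
      using smult r by (simp add: M.smult_assoc1[symmetric] M.m_comm)
    then show ?thesis
      using smult rel_smult[of s "r \<odot>\<^bsub>M\<^esub> x" y] r by (simp add: frag_extend_diff)
  qed
qed

lemma tensor_smult:
  assumes "r \<in> carrier R" "supp z \<subseteq> S"
  shows "r \<odot>\<^bsub>T\<^esub> cl z = cl (act r z)"
proof -
  have "cl (act r w) = cl (act r z)" if "w \<in> cl z" for w
    using act_tensor_kernel[OF assms(1), of "w - z"] that
    by (simp add: tensor_class_iff tensor_class_eq_iff frag_extend_diff)
  moreover have "z \<in> cl z" by (simp add: tensor_class_iff tensor_kernel_zero)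
  ultimately have "(\<Union>w\<in>cl z. cl (act r w)) = cl (act r z)" by blast
  then show ?thesis by (simp add: tensor_product_def Let_def)
qed

end

section \<open>Base change to the residue ring\<close>

lemma residue_module_is_module:
  assumes "cring A" "cring k" "\<epsilon> \<in> ring_hom A k"
  shows "module A (residue_module k \<epsilon>)"
proof -
  interpret k: cring k by fact
  have "abelian_group (residue_module k \<epsilon>)"
    by (rule abelian_groupI) (auto simp: residue_module_def k.a_ac intro: k.l_neg)
  then show ?thesis
    using assms(3) by (intro moduleI assms(1))
      (auto simp: residue_module_def k.l_distr k.r_distr k.m_assoc ring_hom_closed[OF assms(3)]
        ring_hom_add[OF assms(3)] ring_hom_mult[OF assms(3)] ring_hom_one[OF assms(3)])
qed

text \<open>Base change along \<open>\<epsilon>\<close> divides out the products with its kernel.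
  \<open>H_sup\<close> makes the map to the quotient by \<open>H\<close> well defined on the
  relations and \<open>H_sub\<close> makes it injective. The section \<open>\<sigma>\<close> moves
  every scalar of \<open>k\<close> to the left factor, so each element is a pure tensor with right
  factor 1.\<close>

lemma tensor_residue_iso:
  fixes k (structure)
  assumes "module A D" "cring k" and \<epsilon>: "\<epsilon> \<in> ring_hom A k" and \<sigma>: "\<sigma> \<in> ring_hom k A"
    and sect: "\<And>c. c \<in> carrier k \<Longrightarrow> \<epsilon> (\<sigma> c) = c"
    and H: "submodule H A D"
    and H_sup: "\<And>a f. a \<in> carrier A \<Longrightarrow> \<epsilon> a = \<zero> \<Longrightarrow> f \<in> carrier D \<Longrightarrow> a \<odot>\<^bsub>D\<^esub> f \<in> H"
    and H_sub: "H \<subseteq> generate (add_monoid D) {a \<odot>\<^bsub>D\<^esub> f | a f. a \<in> carrier A \<and> \<epsilon> a = \<zero> \<and> f \<in> carrier D}"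
  shows "\<exists>\<phi>\<in>lin_maps A (tensor_product A D (residue_module k \<epsilon>)) (quot_module D H).
    bij_betw \<phi> (carrier (tensor_product A D (residue_module k \<epsilon>))) (carrier (quot_module D H)) \<and>
    (\<forall>f\<in>carrier D. \<forall>c\<in>carrier k. \<phi> (pure_tensor A D (residue_module k \<epsilon>) f c) = H +>\<^bsub>D\<^esub> (\<sigma> c \<odot>\<^bsub>D\<^esub> f))"
proof -
  let ?K = "residue_module k \<epsilon>"
  let ?Q = "quot_module D H"
  interpret D: module A D by fact
  interpret k: cring k by fact
  interpret K: module A ?K by (rule residue_module_is_module) (use assms D.is_cring in auto)
  interpret Q: module A ?Q by (rule quot_module_is_module) fact+
  interpret module_tensor A D ?K
    by unfold_locales auto
  have K: "carrier ?K = carrier k" "add ?K = add k" "smult ?K = (\<lambda>a c. \<epsilon> a \<otimes> c)"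
    by (simp_all add: residue_module_def)
  note \<sigma>c [simp] = ring_hom_closed[OF \<sigma>] and \<epsilon>c [simp] = ring_hom_closed[OF \<epsilon>]
  have \<sigma>1: "\<sigma> \<one> = \<one>\<^bsub>A\<^esub>" by (rule ring_hom_one[OF \<sigma>])
  note quot = quot_module_add[OF assms(1) H] quot_module_smult[OF assms(1) H]
  have cQ: "H +>\<^bsub>D\<^esub> f \<in> carrier ?Q" if "f \<in> carrier D" for f
    using that by (auto simp: carrier_quot_module[OF assms(1)])
  have "(\<lambda>(f, c). H +>\<^bsub>D\<^esub> (\<sigma> c \<odot>\<^bsub>D\<^esub> f)) ` S \<subseteq> carrier (add_monoid ?Q)"
    using cQ by (auto simp: K)
  then obtain h where h: "h \<in> hom Fr (add_monoid ?Q)"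
    and h_of': "\<And>p. p \<in> S \<Longrightarrow> h (frag_of p) = (\<lambda>(f, c). H +>\<^bsub>D\<^esub> (\<sigma> c \<odot>\<^bsub>D\<^esub> f)) p"
    using comm_group.free_Abelian_group_universal[OF Q.M.a_comm_group] by blast
  have h_of: "h (frag_of (f, c)) = H +>\<^bsub>D\<^esub> (\<sigma> c \<odot>\<^bsub>D\<^esub> f)" if "f \<in> carrier D" "c \<in> carrier k" for f c
    using h_of'[of "(f, c)"] that by (simp add: K)
  interpret h: group_hom Fr "add_monoid ?Q" h
    using h Q.M.a_group by (simp add: group_hom_def group_hom_axioms_def)
  have h_add: "h (z + w) = h z \<oplus>\<^bsub>?Q\<^esub> h w" if "supp z \<subseteq> S" "supp w \<subseteq> S" for z w
    using h.hom_mult[of z w] that by simp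
  have eq0: "u \<ominus>\<^bsub>?Q\<^esub> v = \<zero>\<^bsub>?Q\<^esub> \<longleftrightarrow> u = v" if "u \<in> carrier ?Q" "v \<in> carrier ?Q" for u v
    using that Q.M.minus_equality[of u "\<ominus>\<^bsub>?Q\<^esub> v"] by (auto simp: a_minus_def Q.M.r_neg)
  have h_closed: "h z \<in> carrier ?Q" if "supp z \<subseteq> S" for z
    using h.hom_closed[of z] that by simp
  have h_minus: "h (- z) = \<ominus>\<^bsub>?Q\<^esub> h z" if "supp z \<subseteq> S" for z
    using h.hom_inv[of z] that by (simp add: a_inv_def)
  have h_diff: "h (z - w) = h z \<ominus>\<^bsub>?Q\<^esub> h w" if "supp z \<subseteq> S" "supp w \<subseteq> S" for z w
    using h_add[of z "- w"] h_minus[of w] that by (simp add: a_minus_def)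
  have eq_cosetI: "H +>\<^bsub>D\<^esub> f = H +>\<^bsub>D\<^esub> g" if "f \<in> carrier D" "g \<in> carrier D" "f \<ominus>\<^bsub>D\<^esub> g \<in> H" for f g
    using coset_eq_iff[OF assms(1) H that(1,2)] that(3) by simp
  have h_rel3: "h (frag_of (a \<odot>\<^bsub>D\<^esub> f, c)) = h (frag_of (f, \<epsilon> a \<otimes> c))"
    if a: "a \<in> carrier A" and f: "f \<in> carrier D" and c: "c \<in> carrier k" for a f c
  proof -
    \<comment> \<open>The difference of the two scalars by which the sides act on \<open>f\<close>.
      It lies in the kernel of \<open>\<epsilon>\<close> because \<open>\<epsilon>\<close> inverts
      \<open>\<sigma>\<close>.\<close>
    let ?b = "\<sigma> c \<otimes>\<^bsub>A\<^esub> a \<ominus>\<^bsub>A\<^esub> \<sigma> (\<epsilon> a \<otimes> c)"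
    have b: "?b \<in> carrier A" using a c by simp
    have "\<epsilon> ?b = \<epsilon> (\<sigma> c \<otimes>\<^bsub>A\<^esub> a) \<ominus> \<epsilon> (\<sigma> (\<epsilon> a \<otimes> c))"
    proof -
      interpret e: ring_hom_cring A k \<epsilon>
        using D.is_cring k.is_cring \<epsilon> by (simp add: ring_hom_cring_def ring_hom_cring_axioms_def)
      show ?thesis using a c by (simp add: a_minus_def)
    qed
    also have "\<dots> = \<zero>"
      using a c by (simp add: ring_hom_mult[OF \<epsilon>] sect k.m_comm k.r_neg a_minus_def)
    finally have "?b \<odot>\<^bsub>D\<^esub> f \<in> H" using H_sup b f by blast
    moreover have "?b \<odot>\<^bsub>D\<^esub> f = \<sigma> c \<odot>\<^bsub>D\<^esub> (a \<odot>\<^bsub>D\<^esub> f) \<ominus>\<^bsub>D\<^esub> \<sigma> (\<epsilon> a \<otimes> c) \<odot>\<^bsub>D\<^esub> f"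
      using a c f by (simp add: a_minus_def D.smult_l_distr D.smult_l_minus D.smult_assoc1)
    ultimately show ?thesis
      using a c f by (simp add: h_of) (intro eq_cosetI, simp_all)
  qed
  have h_Kr: "h z = \<zero>\<^bsub>?Q\<^esub>" if z: "z \<in> Kr" for z
  proof -
    have "h z \<in> {\<zero>\<^bsub>?Q\<^esub>}"
    proof (rule hom_tensor_kernel[OF Q.M.a_group h _ _ z])
      show "subgroup {\<zero>\<^bsub>?Q\<^esub>} (add_monoid ?Q)"
        using group.triv_subgroup[OF Q.M.a_group] by simp
      have fr: "supp (frag_of (f, c) :: _ \<Rightarrow>\<^sub>0 int) \<subseteq> S" if "f \<in> carrier D" "c \<in> carrier k" for f c
        using that by (simp add: K)
      have dk: "supp (z - w) \<subseteq> S" if "supp z \<subseteq> S" "supp w \<subseteq> S"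
        for z w :: "_ \<Rightarrow>\<^sub>0 int"
        using that keys_diff[of z w] by blast
      have canc: "(u \<oplus>\<^bsub>?Q\<^esub> v) \<ominus>\<^bsub>?Q\<^esub> u \<ominus>\<^bsub>?Q\<^esub> v = \<zero>\<^bsub>?Q\<^esub>" if "u \<in> carrier ?Q" "v \<in> carrier ?Q" for u v
        using that Q.M.r_neg[of "u \<oplus>\<^bsub>?Q\<^esub> v"] by (simp add: a_minus_def Q.M.a_assoc Q.M.minus_add)
      fix w assume "w \<in> tensor_rels A D ?K"
      then show "h w \<in> {\<zero>\<^bsub>?Q\<^esub>}"
      proof (cases rule: tensor_relsE)
        case (left x x' y)
        have "h (frag_of (x \<oplus>\<^bsub>D\<^esub> x', y)) = h (frag_of (x, y)) \<oplus>\<^bsub>?Q\<^esub> h (frag_of (x', y))"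
          using left[unfolded K] by (simp add: h_of D.smult_r_distr quot)
        then show ?thesis
          using left[unfolded K] fr dk h_closed by (simp add: h_diff canc)
      next
        case (right x y y')
        have "h (frag_of (x, y \<oplus> y')) = h (frag_of (x, y)) \<oplus>\<^bsub>?Q\<^esub> h (frag_of (x, y'))"
          using right[unfolded K] by (simp add: h_of ring_hom_add[OF \<sigma>] D.smult_l_distr quot)
        then show ?thesis
          using right[unfolded K] fr dk h_closed by (simp add: h_diff canc)
      next
        case (smult s x y)
        show ?thesis
          using smult[unfolded K] fr h_closed[of "frag_of (x, \<epsilon> s \<otimes> y)"]
          by (simp add: h_diff h_rel3 a_minus_def Q.M.r_neg)
      qed
    qed
    then show ?thesis by simp
  qed
  have h_act: "h (act r z) = r \<odot>\<^bsub>?Q\<^esub> h z" if r: "r \<in> carrier A" and z: "supp z \<subseteq> S" for r z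
    using z
  proof (induction z rule: free_Abelian_group_induct[consumes 1, case_names zero diff one])
    case zero
    have "h 0 = \<zero>\<^bsub>?Q\<^esub>" using h_Kr tensor_kernel_zero by blast
    then show ?case using r by simp
  next
    case (diff z w)
    then show ?case
      using r act_keys[OF r] h_closed
      by (simp add: frag_extend_diff h_diff a_minus_def Q.smult_r_distr Q.smult_r_minus)
  next
    case (one p)
    obtain f c where p: "p = (f, c)" "f \<in> carrier D" "c \<in> carrier k" using one by (auto simp: K)
    have "\<sigma> c \<odot>\<^bsub>D\<^esub> (r \<odot>\<^bsub>D\<^esub> f) = r \<odot>\<^bsub>D\<^esub> (\<sigma> c \<odot>\<^bsub>D\<^esub> f)"
      using p r by (simp add: D.smult_assoc1[symmetric] D.m_comm)
    then show ?case using p r by (simp add: h_of quot)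
  qed
  have pure: "\<exists>f\<in>carrier D. z - frag_of (f, \<one>) \<in> Kr" if z: "supp z \<subseteq> S" for z
    using z
  proof (induction z rule: free_Abelian_group_induct[consumes 1, case_names zero diff one])
    case zero
    have "frag_of (\<zero>\<^bsub>D\<^esub> \<oplus>\<^bsub>D\<^esub> \<zero>\<^bsub>D\<^esub>, \<one>) - frag_of (\<zero>\<^bsub>D\<^esub>, \<one>) - frag_of (\<zero>\<^bsub>D\<^esub>, \<one>) \<in> Kr"
      by (rule rel_left) (simp_all add: K)
    then show ?case by (intro bexI[of _ "\<zero>\<^bsub>D\<^esub>"]) simp_all
  next
    case (diff z w)
    then obtain f g where fg: "f \<in> carrier D" "g \<in> carrier D"
      "z - frag_of (f, \<one>) \<in> Kr" "w - frag_of (g, \<one>) \<in> Kr" by blast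
    have "frag_of ((f \<ominus>\<^bsub>D\<^esub> g) \<oplus>\<^bsub>D\<^esub> g, \<one>) - frag_of (f \<ominus>\<^bsub>D\<^esub> g, \<one>) - frag_of (g, \<one>) \<in> Kr"
      using fg by (intro rel_left) (simp_all add: K)
    moreover have "(f \<ominus>\<^bsub>D\<^esub> g) \<oplus>\<^bsub>D\<^esub> g = f"
      using fg by (simp add: a_minus_def D.M.a_assoc D.M.l_neg)
    ultimately have "frag_of (f, \<one>) - frag_of (f \<ominus>\<^bsub>D\<^esub> g, \<one>) - frag_of (g, \<one>) \<in> Kr" by simp
    from tensor_kernel_add[OF this tensor_kernel_diff[OF fg(3,4)]]
    show ?case using fg by (intro bexI[of _ "f \<ominus>\<^bsub>D\<^esub> g"]) (simp_all add: algebra_simps)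
  next
    case (one p)
    obtain f c where p: "p = (f, c)" "f \<in> carrier D" "c \<in> carrier k" using one by (auto simp: K)
    have "frag_of (\<sigma> c \<odot>\<^bsub>D\<^esub> f, \<one>) - frag_of (f, \<sigma> c \<odot>\<^bsub>?K\<^esub> \<one>) \<in> Kr"
      using p by (intro rel_smult) (simp_all add: K)
    then have "frag_of (\<sigma> c \<odot>\<^bsub>D\<^esub> f, \<one>) - frag_of (f, c) \<in> Kr" using p by (simp add: K sect)
    from tensor_kernel_minus[OF this] show ?case
      using p by (intro bexI[of _ "\<sigma> c \<odot>\<^bsub>D\<^esub> f"]) simp_all
  qed
  have zero_right: "frag_of (f, \<zero>) \<in> Kr" if f: "f \<in> carrier D" for f
  proof -
    have "frag_of (f, \<zero> \<oplus>\<^bsub>?K\<^esub> \<zero>) - frag_of (f, \<zero>) - frag_of (f, \<zero>) \<in> Kr"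
      using f by (intro rel_right) (simp_all add: K)
    from tensor_kernel_minus[OF this] show ?thesis by (simp add: K)
  qed
  \<comment> \<open>A scalar \<open>a\<close> in the kernel of \<open>\<epsilon>\<close> crosses the
    tensor sign and becomes zero. The inverse of a generator is again of this form, with the sign
    moved to \<open>f\<close>.\<close>
  have gen_Kr: "f \<in> carrier D \<and> frag_of (f, \<one>) \<in> Kr"
    if "f \<in> generate (add_monoid D) {a \<odot>\<^bsub>D\<^esub> f | a f. a \<in> carrier A \<and> \<epsilon> a = \<zero> \<and> f \<in> carrier D}" for f
    using that
  proof (induction rule: generate.induct)
    case one
    have "frag_of (\<zero>\<^bsub>D\<^esub> \<oplus>\<^bsub>D\<^esub> \<zero>\<^bsub>D\<^esub>, \<one>) - frag_of (\<zero>\<^bsub>D\<^esub>, \<one>) - frag_of (\<zero>\<^bsub>D\<^esub>, \<one>) \<in> Kr"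
      by (rule rel_left) (simp_all add: K)
    from tensor_kernel_minus[OF this] show ?case by simp
  next
    case (incl g)
    then obtain a f where af: "a \<in> carrier A" "\<epsilon> a = \<zero>" "f \<in> carrier D" "g = a \<odot>\<^bsub>D\<^esub> f" by blast
    have "frag_of (a \<odot>\<^bsub>D\<^esub> f, \<one>) - frag_of (f, a \<odot>\<^bsub>?K\<^esub> \<one>) \<in> Kr"
      using af by (intro rel_smult) (simp_all add: K)
    then have "frag_of (g, \<one>) - frag_of (f, \<zero>) \<in> Kr" using af by (simp add: K)
    from tensor_kernel_add[OF this zero_right[OF af(3)]] show ?case using af by simp
  next
    case (inv g)
    then obtain a f where af: "a \<in> carrier A" "\<epsilon> a = \<zero>" "f \<in> carrier D" "g = a \<odot>\<^bsub>D\<^esub> f" by blast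
    have g: "inv\<^bsub>add_monoid D\<^esub> g = a \<odot>\<^bsub>D\<^esub> (\<ominus>\<^bsub>D\<^esub> f)"
      using af by (simp add: D.smult_r_minus) (simp add: a_inv_def)
    have "frag_of (a \<odot>\<^bsub>D\<^esub> (\<ominus>\<^bsub>D\<^esub> f), \<one>) - frag_of (\<ominus>\<^bsub>D\<^esub> f, a \<odot>\<^bsub>?K\<^esub> \<one>) \<in> Kr"
      using af by (intro rel_smult) (simp_all add: K)
    then have "frag_of (a \<odot>\<^bsub>D\<^esub> (\<ominus>\<^bsub>D\<^esub> f), \<one>) - frag_of (\<ominus>\<^bsub>D\<^esub> f, \<zero>) \<in> Kr" using af by (simp add: K)
    from tensor_kernel_add[OF this zero_right[of "\<ominus>\<^bsub>D\<^esub> f"]] show ?case unfolding g using af(1,3) by simp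
  next
    case (eng f g)
    have "frag_of (f \<oplus>\<^bsub>D\<^esub> g, \<one>) - frag_of (f, \<one>) - frag_of (g, \<one>) \<in> Kr"
      using eng by (intro rel_left) (simp_all add: K)
    from tensor_kernel_add[OF this tensor_kernel_add[of "frag_of (f, \<one>)" "frag_of (g, \<one>)"]]
    show ?case using eng by simp
  qed
  have h_one: "h (frag_of (f, \<one>)) = H +>\<^bsub>D\<^esub> f" if "f \<in> carrier D" for f
    using that by (simp add: h_of \<sigma>1)
  \<comment> \<open>Modulo relations \<open>z\<close> is the generator (f, 1); vanishing of its
    image puts \<open>f\<close> in \<open>H\<close>, where \<open>gen_Kr\<close> applies.\<close>
  have h_inj: "z \<in> Kr" if z: "supp z \<subseteq> S" and hz: "h z = \<zero>\<^bsub>?Q\<^esub>" for z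
  proof -
    obtain f where f: "f \<in> carrier D" and zf: "z - frag_of (f, \<one>) \<in> Kr" using pure[OF z] by blast
    have fr: "supp (frag_of (f, \<one>) :: _ \<Rightarrow>\<^sub>0 int) \<subseteq> S" using f by (simp add: K)
    have "\<zero>\<^bsub>?Q\<^esub> = h z \<ominus>\<^bsub>?Q\<^esub> h (frag_of (f, \<one>))" using h_Kr[OF zf] h_diff[OF z fr] by simp
    then have "h (frag_of (f, \<one>)) = \<zero>\<^bsub>?Q\<^esub>"
      using hz h_closed[OF fr] eq0[OF Q.M.zero_closed h_closed[OF fr]] by simp
    then have "f \<in> H"
      using h_one[OF f] coset_eq_self_iff[OF assms(1) H f] by (simp add: quot_module_zero[OF assms(1)])
    then have "frag_of (f, \<one>) \<in> Kr" using gen_Kr H_sub by blast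
    from tensor_kernel_add[OF zf this] show ?thesis by simp
  qed
  have h_eq_iff: "h z = h w \<longleftrightarrow> cl z = cl w"
    if z: "supp z \<subseteq> S" and w: "supp w \<subseteq> S" for z w
  proof -
    have zw: "supp (z - w) \<subseteq> S" using z w keys_diff[of z w] by blast
    have "h z = h w \<longleftrightarrow> h (z - w) = \<zero>\<^bsub>?Q\<^esub>"
      using h_diff[OF z w] h_closed[OF z] h_closed[OF w] eq0
      by metis
    also have "\<dots> \<longleftrightarrow> cl z = cl w" using h_inj[OF zw] h_Kr tensor_class_eq_iff by blast
    finally show ?thesis .
  qed
  \<comment> \<open>Classes are sets, so the map is evaluated at a chosen representative;
    \<open>h_eq_iff\<close> makes the choice immaterial.\<close>
  define rep where "rep = (\<lambda>U. SOME z. supp z \<subseteq> S \<and> U = cl z)"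
  have rep: "supp (rep (cl z)) \<subseteq> S \<and> cl z = cl (rep (cl z))" if "supp z \<subseteq> S" for z
    unfolding rep_def by (rule someI[of _ z]) (use that in simp)
  define \<phi> where "\<phi> = (\<lambda>U\<in>carrier T. h (rep U))"
  have \<phi>: "\<phi> (cl z) = h z" if z: "supp z \<subseteq> S" for z
    using rep[OF z] h_eq_iff[OF z, of "rep (cl z)"] z by (auto simp: \<phi>_def carrier_tensor)
  have "\<phi> \<in> lin_maps A T ?Q"
    unfolding lin_maps_def
  proof (intro CollectI conjI ballI)
    show "\<phi> \<in> carrier T \<rightarrow>\<^sub>E carrier ?Q"
      by (auto simp: \<phi>_def carrier_tensor intro!: h_closed dest: rep)
    fix U V assume "U \<in> carrier T" "V \<in> carrier T"
    then obtain z w where zw: "supp z \<subseteq> S" "U = cl z" "supp w \<subseteq> S" "V = cl w"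
      by (auto simp: carrier_tensor)
    have "supp (z + w) \<subseteq> S" using keys_add[of z w] zw by blast
    then show "\<phi> (U \<oplus>\<^bsub>T\<^esub> V) = \<phi> U \<oplus>\<^bsub>?Q\<^esub> \<phi> V" using zw by (simp add: tensor_add \<phi> h_add)
  next
    fix r U assume r: "r \<in> carrier A" and "U \<in> carrier T"
    then obtain z where z: "supp z \<subseteq> S" "U = cl z" by (auto simp: carrier_tensor)
    then show "\<phi> (r \<odot>\<^bsub>T\<^esub> U) = r \<odot>\<^bsub>?Q\<^esub> \<phi> U"
      using r act_keys[OF r] by (simp add: tensor_smult \<phi> h_act)
  qed
  moreover have "bij_betw \<phi> (carrier T) (carrier ?Q)"
  proof (rule bij_betw_imageI)
    show "inj_on \<phi> (carrier T)"
      unfolding inj_on_def using h_eq_iff by (auto simp: carrier_tensor \<phi>)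
    show "\<phi> ` carrier T = carrier ?Q"
    proof
      show "\<phi> ` carrier T \<subseteq> carrier ?Q" using h_closed by (auto simp: carrier_tensor \<phi>)
      show "carrier ?Q \<subseteq> \<phi> ` carrier T"
      proof
        fix U assume "U \<in> carrier ?Q"
        then obtain f where f: "f \<in> carrier D" "U = H +>\<^bsub>D\<^esub> f" by (auto simp: carrier_quot_module[OF assms(1)])
        have fr: "supp (frag_of (f, \<one>) :: _ \<Rightarrow>\<^sub>0 int) \<subseteq> S" using f by (simp add: K)
        have "U = \<phi> (cl (frag_of (f, \<one>)))" using \<phi>[OF fr] h_one f by simp
        then show "U \<in> \<phi> ` carrier T" using fr by (auto simp: carrier_tensor)
      qed
    qed
  qed
  moreover have "\<phi> (pure_tensor A D ?K f c) = H +>\<^bsub>D\<^esub> (\<sigma> c \<odot>\<^bsub>D\<^esub> f)" if "f \<in> carrier D" "c \<in> carrier k" for f c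
    using that \<phi>[of "frag_of (f, c)"] h_of by (simp add: pure_tensor_def K)
  ultimately show ?thesis by blast
qed

section \<open>Duals\<close>

lemma carrier_restrict_scalars [simp]: "carrier (restrict_scalars k A M) = carrier M"
  and add_restrict_scalars [simp]: "add (restrict_scalars k A M) = add M"
  and zero_restrict_scalars [simp]: "ring.zero (restrict_scalars k A M) = ring.zero M"
  and smult_restrict_scalars: "smult (restrict_scalars k A M) = (\<lambda>c x. (c \<odot>\<^bsub>A\<^esub> \<one>\<^bsub>A\<^esub>) \<odot>\<^bsub>M\<^esub> x)"
  and coset_restrict_scalars [simp]: "(+>\<^bsub>restrict_scalars k A M\<^esub>) = (+>\<^bsub>M\<^esub>)"
  and minus_restrict_scalars [simp]: "a_inv (restrict_scalars k A M) = a_inv M"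
  by (simp_all add: restrict_scalars_def a_r_coset_def' a_inv_def fun_eq_iff m_inv_def)

lemma restrict_scalars_quot_module:
  "restrict_scalars k A (quot_module C N) = quot_module (restrict_scalars k A C) N"
  by (simp add: restrict_scalars_def quot_module_def a_r_coset_def' A_RCOSETS_def' set_add_def' fun_eq_iff)

lemma restrict_scalars_submodule_of:
  "restrict_scalars k A (submodule_of C N) = submodule_of (restrict_scalars k A C) N"
  by (simp add: restrict_scalars_def submodule_of_def)

lemma (in algebra) scalar_hom: "(\<lambda>c. c \<odot>\<^bsub>M\<^esub> \<one>\<^bsub>M\<^esub>) \<in> ring_hom R M"
proof (rule ring_hom_memI)
  fix c d assume cd: "c \<in> carrier R" "d \<in> carrier R"
  show "(c \<otimes>\<^bsub>R\<^esub> d) \<odot>\<^bsub>M\<^esub> \<one>\<^bsub>M\<^esub> = (c \<odot>\<^bsub>M\<^esub> \<one>\<^bsub>M\<^esub>) \<otimes>\<^bsub>M\<^esub> (d \<odot>\<^bsub>M\<^esub> \<one>\<^bsub>M\<^esub>)"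
    using cd by (simp add: smult_assoc1 smult_assoc2)
qed (auto simp: smult_l_distr)

lemma restrict_scalars_is_module:
  fixes A :: "('k, 'a) module" and M :: "('a, 'm) module"
  assumes "algebra k A" "module A M"
  shows "module k (restrict_scalars k A M)"
proof -
  interpret A: algebra k A by fact
  interpret M: module A M by fact
  let ?V = "restrict_scalars k A M"
  note \<sigma> = A.scalar_hom
  have "abelian_group ?V"
    by (rule abelian_groupI) (auto simp: M.M.a_ac intro: M.M.l_neg)
  then show ?thesis
    by (intro moduleI A.R_cring)
      (auto simp: smult_restrict_scalars M.smult_r_distr M.smult_l_distr A.smult_l_distr
        ring_hom_mult[OF \<sigma>] M.smult_assoc1)
qed

lemma submodule_restrict_scalars:
  fixes A :: "('k, 'a) module" and M :: "('a, 'm) module"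
  assumes "algebra k A" "module A M" "submodule N A M"
  shows "submodule N k (restrict_scalars k A M)"
proof -
  interpret A: algebra k A by fact
  interpret M: module A M by fact
  interpret V: module k "restrict_scalars k A M" by (rule restrict_scalars_is_module) fact+
  have z: "\<zero>\<^bsub>M\<^esub> \<in> N"
    using subgroup.one_closed[OF submodule.axioms(1)[OF assms(3)]] by simp
  show ?thesis
    using M.submoduleE[OF assms(3)] z
    by (intro V.submoduleI) (auto simp: smult_restrict_scalars)
qed

lemma carrier_dual: "carrier (dual k A C) = functionals k (restrict_scalars k A C)"
  by (simp add: dual_def)

lemma dual_add: "f \<oplus>\<^bsub>dual k A C\<^esub> g = (\<lambda>x\<in>carrier C. f x \<oplus>\<^bsub>k\<^esub> g x)"
  and dual_smult: "a \<odot>\<^bsub>dual k A C\<^esub> f = (\<lambda>x\<in>carrier C. f (a \<odot>\<^bsub>C\<^esub> x))"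
  and dual_zero: "\<zero>\<^bsub>dual k A C\<^esub> = (\<lambda>x\<in>carrier C. \<zero>\<^bsub>k\<^esub>)"
  by (simp_all add: dual_def)

text \<open>The assumption speaks of scalars in \<open>k\<close> alone, so that the lemma also
  serves the dual of \<open>GC\<close>, where the module axioms at hand are those over
  \<open>k\<close>.\<close>

lemma dual_abelian_group:
  assumes "module k (restrict_scalars k A C)"
  shows "abelian_group (dual k A C)" (is "abelian_group ?D")
proof -
  interpret V: module k "restrict_scalars k A C" by fact
  have Vc: "x \<oplus>\<^bsub>C\<^esub> y \<in> carrier C" if "x \<in> carrier C" "y \<in> carrier C" for x y
    using V.M.a_closed[of x y] that by simp
  have Vs: "(c \<odot>\<^bsub>A\<^esub> \<one>\<^bsub>A\<^esub>) \<odot>\<^bsub>C\<^esub> x \<in> carrier C" if "c \<in> carrier k" "x \<in> carrier C" for x c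
    using V.smult_closed[of c x] that by (simp add: smult_restrict_scalars)
  show ?thesis
  proof (rule abelian_groupI)
    fix f assume f: "f \<in> carrier ?D"
    have "(\<lambda>x\<in>carrier C. \<ominus>\<^bsub>k\<^esub> f x) \<in> carrier ?D"
      using f by (auto simp: carrier_dual functionals_iff V.R.minus_add V.R.r_minus Vc Vs smult_restrict_scalars V.R.a_ac)
    moreover have "(\<lambda>x\<in>carrier C. \<ominus>\<^bsub>k\<^esub> f x) \<oplus>\<^bsub>?D\<^esub> f = \<zero>\<^bsub>?D\<^esub>"
      using f by (auto simp: carrier_dual functionals_iff dual_add dual_zero V.R.l_neg intro!: restrict_ext)
    ultimately show "\<exists>g\<in>carrier ?D. g \<oplus>\<^bsub>?D\<^esub> f = \<zero>\<^bsub>?D\<^esub>" by blast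
    show "\<zero>\<^bsub>?D\<^esub> \<oplus>\<^bsub>?D\<^esub> f = f"
      using f by (auto simp: carrier_dual functionals_iff dual_add dual_zero extensional_def fun_eq_iff)
  qed (auto simp: carrier_dual functionals_iff dual_add dual_zero V.R.a_ac V.R.r_distr Vc Vs
        smult_restrict_scalars intro!: restrict_ext)
qed

lemma dual_minus:
  assumes "module k (restrict_scalars k A C)" "f \<in> carrier (dual k A C)" "x \<in> carrier C"
  shows "(\<ominus>\<^bsub>dual k A C\<^esub> f) x = \<ominus>\<^bsub>k\<^esub> f x"
proof -
  interpret V: module k "restrict_scalars k A C" by fact
  interpret D: abelian_group "dual k A C" by (rule dual_abelian_group) fact
  have "(\<ominus>\<^bsub>dual k A C\<^esub> f) x \<oplus>\<^bsub>k\<^esub> f x = \<zero>\<^bsub>k\<^esub>"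
    using fun_cong[OF D.l_neg[OF assms(2)], of x] assms(3) by (simp add: dual_add dual_zero)
  moreover have "f x \<in> carrier k" "(\<ominus>\<^bsub>dual k A C\<^esub> f) x \<in> carrier k"
    using assms(2,3) D.a_inv_closed[OF assms(2)] by (simp_all add: carrier_dual functionals_iff)
  ultimately show ?thesis by (simp add: V.R.minus_equality)
qed

lemma dual_is_module:
  fixes A :: "('k, 'a) module" and C :: "('a, 'm) module"
  assumes "algebra k A" "module A C"
  shows "module A (dual k A C)"
proof -
  interpret C: module A C by fact
  interpret A: algebra k A by fact
  have V: "module k (restrict_scalars k A C)" by (rule restrict_scalars_is_module) fact+
  have comm: "a \<odot>\<^bsub>C\<^esub> ((c \<odot>\<^bsub>A\<^esub> \<one>\<^bsub>A\<^esub>) \<odot>\<^bsub>C\<^esub> x) = (c \<odot>\<^bsub>A\<^esub> \<one>\<^bsub>A\<^esub>) \<odot>\<^bsub>C\<^esub> (a \<odot>\<^bsub>C\<^esub> x)"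
    if "a \<in> carrier A" "c \<in> carrier k" "x \<in> carrier C" for a c x
    using that by (simp add: C.smult_assoc1[symmetric] C.m_comm)
  have comm2: "a \<odot>\<^bsub>C\<^esub> (b \<odot>\<^bsub>C\<^esub> x) = b \<odot>\<^bsub>C\<^esub> (a \<odot>\<^bsub>C\<^esub> x)"
    if "a \<in> carrier A" "b \<in> carrier A" "x \<in> carrier C" for a b x
    using that by (simp add: C.smult_assoc1[symmetric] C.m_comm)
  have assoc: "(a \<otimes>\<^bsub>A\<^esub> b) \<odot>\<^bsub>dual k A C\<^esub> f = a \<odot>\<^bsub>dual k A C\<^esub> (b \<odot>\<^bsub>dual k A C\<^esub> f)"
    if "a \<in> carrier A" "b \<in> carrier A" for a b f
    using that comm2 by (auto simp: dual_smult C.smult_assoc1 intro!: restrict_ext)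
  show ?thesis
  proof (rule moduleI)
    show "cring A" by (rule A.M_cring)
    show "abelian_group (dual k A C)" by (rule dual_abelian_group[OF V])
  qed (auto simp: assoc, auto simp: carrier_dual functionals_iff dual_add dual_smult smult_restrict_scalars comm
      C.smult_r_distr C.smult_l_distr C.smult_assoc1 extensional_def fun_eq_iff)
qed

text \<open>The universal property of the quotient, used to replace the embedded dual of C / F^(1-p)
  C by a vanishing condition. It asks for a submodule over \<open>k\<close>, so it applies to
  \<open>GC\<close> as well.\<close>

lemma dual_filt_eq:
  fixes k :: "('k, 'x) ring_scheme" and A :: "('k, 'a) module" and C :: "('a, 'm) module" and F p
  defines "V \<equiv> restrict_scalars k A C" and "N \<equiv> F (1 - p)"
  assumes V: "module k V" and N: "submodule N k V"
  shows "dual_filt k A C F p = {f \<in> carrier (dual k A C). \<forall>x\<in>N. f x = \<zero>\<^bsub>k\<^esub>}"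
proof -
  let ?Q = "quot_module V N"
  interpret V: module k V by fact
  interpret Q: module k ?Q by (rule quot_module_is_module) fact+
  have Vc: "carrier V = carrier C" "(+>\<^bsub>V\<^esub>) = (+>\<^bsub>C\<^esub>)" by (simp_all add: V_def)
  have NV: "N \<subseteq> carrier V" using V.submoduleE(1)[OF N] .
  have dq: "carrier (dual k A (quot_module C N)) = functionals k ?Q"
    by (simp add: carrier_dual restrict_scalars_quot_module V_def)
  have cQ: "N +>\<^bsub>V\<^esub> x \<in> carrier ?Q" if "x \<in> carrier V" for x
    using that by (auto simp: carrier_quot_module[OF V])
  note quot = quot_module_add[OF V N] quot_module_smult[OF V N]
  show ?thesis
  proof (intro Set.set_eqI iffI)
    fix f assume "f \<in> dual_filt k A C F p"
    then obtain g where g: "g \<in> functionals k ?Q" and f: "f = (\<lambda>x\<in>carrier V. g (N +>\<^bsub>V\<^esub> x))"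
      by (auto simp: dual_filt_def N_def[symmetric] dq Vc)
    have "f \<in> functionals k V"
      unfolding f functionals_iff using cQ
      by (auto simp: quot[symmetric] functional_add[OF g] functional_smult[OF g] functional_closed[OF g])
    moreover have "f x = \<zero>\<^bsub>k\<^esub>" if x: "x \<in> N" for x
    proof -
      have "N +>\<^bsub>V\<^esub> x = \<zero>\<^bsub>?Q\<^esub>"
        using coset_eq_self_iff[OF V N] x NV by (auto simp: quot_module_zero[OF V])
      then show ?thesis using x NV functional_zero[OF g Q.module_axioms] by (auto simp: f)
    qed
    ultimately show "f \<in> {f \<in> carrier (dual k A C). \<forall>x\<in>N. f x = \<zero>\<^bsub>k\<^esub>}"
      by (simp add: carrier_dual V_def[symmetric])
  next
    fix f assume "f \<in> {f \<in> carrier (dual k A C). \<forall>x\<in>N. f x = \<zero>\<^bsub>k\<^esub>}"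
    then have f: "f \<in> functionals k V" and fN: "\<And>x. x \<in> N \<Longrightarrow> f x = \<zero>\<^bsub>k\<^esub>"
      by (auto simp: carrier_dual V_def[symmetric])
    have f_eq: "f x = f y" if xy: "x \<in> carrier V" "y \<in> carrier V" "N +>\<^bsub>V\<^esub> x = N +>\<^bsub>V\<^esub> y" for x y
    proof -
      have "f (x \<ominus>\<^bsub>V\<^esub> y) = \<zero>\<^bsub>k\<^esub>" using xy coset_eq_iff[OF V N] fN by blast
      then have "f x \<oplus>\<^bsub>k\<^esub> \<ominus>\<^bsub>k\<^esub> f y = \<zero>\<^bsub>k\<^esub>"
        using xy by (simp add: a_minus_def functional_add[OF f] functional_minus[OF f V])
      then show ?thesis
        using functional_closed[OF f xy(1)] functional_closed[OF f xy(2)]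
        by (metis V.R.minus_equality V.R.minus_minus V.R.a_inv_closed)
    qed
    \<comment> \<open>The descended functional: \<open>f\<close> at a chosen representative of the
      coset, harmless by \<open>f_eq\<close>.\<close>
    define g where "g = (\<lambda>U\<in>carrier ?Q. f (SOME x. x \<in> carrier V \<and> U = N +>\<^bsub>V\<^esub> x))"
    have g_coset: "g (N +>\<^bsub>V\<^esub> x) = f x" if x: "x \<in> carrier V" for x
    proof -
      let ?y = "SOME y. y \<in> carrier V \<and> N +>\<^bsub>V\<^esub> x = N +>\<^bsub>V\<^esub> y"
      have "?y \<in> carrier V \<and> N +>\<^bsub>V\<^esub> x = N +>\<^bsub>V\<^esub> ?y" by (rule someI[of _ x]) (use x in simp)
      then show ?thesis using f_eq[of ?y x] x cQ by (simp add: g_def)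
    qed
    have "g \<in> functionals k ?Q"
      unfolding functionals_iff
    proof (intro conjI ballI)
      show "g \<in> extensional (carrier ?Q)" by (simp add: g_def)
      fix U assume "U \<in> carrier ?Q"
      then obtain x where x: "x \<in> carrier V" "U = N +>\<^bsub>V\<^esub> x" by (auto simp: carrier_quot_module[OF V])
      show "g U \<in> carrier k" using x g_coset functional_closed[OF f] by simp
      {
        fix W assume "W \<in> carrier ?Q"
        then obtain y where y: "y \<in> carrier V" "W = N +>\<^bsub>V\<^esub> y" by (auto simp: carrier_quot_module[OF V])
        show "g (U \<oplus>\<^bsub>?Q\<^esub> W) = g U \<oplus>\<^bsub>k\<^esub> g W"
          using x y g_coset by (simp add: quot functional_add[OF f])
      }
    next
      fix r U assume r: "r \<in> carrier k" and "U \<in> carrier ?Q"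
      then obtain x where x: "x \<in> carrier V" "U = N +>\<^bsub>V\<^esub> x" by (auto simp: carrier_quot_module[OF V])
      then show "g (r \<odot>\<^bsub>?Q\<^esub> U) = r \<otimes>\<^bsub>k\<^esub> g U"
        using r g_coset by (simp add: quot functional_smult[OF f])
    qed
    moreover have "f = (\<lambda>x\<in>carrier V. g (N +>\<^bsub>V\<^esub> x))"
      using functional_extensional[OF f] by (auto simp: extensional_def fun_eq_iff g_coset)
    ultimately show "f \<in> dual_filt k A C F p"
      by (auto simp: dual_filt_def N_def[symmetric] dq Vc)
  qed
qed

section \<open>The augmentation and a criterion for levelness\<close>

locale residue_algebra = filtered_algebra k A FA
  for k :: "('k, 'x) ring_scheme" (structure) and A :: "('k, 'a) module" and FA +
  assumes residue_iso: "residue_map A FA \<in> ring_iso k (A Quot FA 1)"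
begin

abbreviation (input) "\<epsilon> \<equiv> augmentation k A FA"
abbreviation (input) "\<sigma> c \<equiv> c \<odot>\<^bsub>A\<^esub> \<one>\<^bsub>A\<^esub>"

lemma residue_bij: "bij_betw (residue_map A FA) (carrier k) (a_rcosets\<^bsub>A\<^esub> FA 1)"
  using residue_iso by (simp add: ring_iso_def FactRing_def)

lemma residue_hom: "residue_map A FA \<in> ring_hom k (A Quot FA 1)"
  using residue_iso by (simp add: ring_iso_def)

lemma residue_inv:
  assumes "U \<in> a_rcosets\<^bsub>A\<^esub> FA 1"
  shows "the_inv_into (carrier k) (residue_map A FA) U \<in> carrier k"
    and "residue_map A FA (the_inv_into (carrier k) (residue_map A FA) U) = U"
  using residue_bij assms
  by (auto simp: bij_betw_def intro!: the_inv_into_into f_the_inv_into_f)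

lemma coset_in_rcosets: "a \<in> carrier A \<Longrightarrow> FA 1 +>\<^bsub>A\<^esub> a \<in> a_rcosets\<^bsub>A\<^esub> FA 1"
  by (auto simp: A_RCOSETS_def')

lemma augmentation_closed: "a \<in> carrier A \<Longrightarrow> \<epsilon> a \<in> carrier k"
  and residue_augmentation: "a \<in> carrier A \<Longrightarrow> residue_map A FA (\<epsilon> a) = FA 1 +>\<^bsub>A\<^esub> a"
  using residue_inv[OF coset_in_rcosets] by (simp_all add: augmentation_def)

lemma augmentation_eqI:
  assumes "a \<in> carrier A" "c \<in> carrier k" "residue_map A FA c = FA 1 +>\<^bsub>A\<^esub> a"
  shows "\<epsilon> a = c"
  using assms residue_bij residue_augmentation[OF assms(1)] augmentation_closed[OF assms(1)]
  by (metis bij_betw_def inj_on_def)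

lemma augmentation_hom: "\<epsilon> \<in> ring_hom A k"
proof (rule ring_hom_memI)
  interpret I: ideal "FA 1" A by (rule filt_ideal)
  note q = I.rcos_ring_hom
  note r = residue_hom
  fix a b assume ab: "a \<in> carrier A" "b \<in> carrier A"
  show "\<epsilon> (a \<otimes>\<^bsub>A\<^esub> b) = \<epsilon> a \<otimes> \<epsilon> b"
    using ab augmentation_closed
    by (intro augmentation_eqI) (simp_all add: ring_hom_mult[OF r] ring_hom_mult[OF q] residue_augmentation)
  show "\<epsilon> (a \<oplus>\<^bsub>A\<^esub> b) = \<epsilon> a \<oplus> \<epsilon> b"
    using ab augmentation_closed
    by (intro augmentation_eqI) (simp_all add: ring_hom_add[OF r] ring_hom_add[OF q] residue_augmentation)
next
  show "\<epsilon> \<one>\<^bsub>A\<^esub> = \<one>"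
    by (rule augmentation_eqI) (simp_all add: residue_map_def)
qed (rule augmentation_closed)

lemma augmentation_scalar: "c \<in> carrier k \<Longrightarrow> \<epsilon> (\<sigma> c) = c"
  by (intro augmentation_eqI) (simp_all add: residue_map_def)

lemma augmentation_eq_zero_iff:
  assumes a: "a \<in> carrier A"
  shows "\<epsilon> a = \<zero> \<longleftrightarrow> a \<in> FA 1"
proof -
  interpret I: ideal "FA 1" A by (rule filt_ideal)
  have sub: "abelian_subgroup (FA 1) A" ..
  have "FA 1 +>\<^bsub>A\<^esub> a = FA 1 \<longleftrightarrow> a \<in> FA 1"
    using abelian_subgroup.a_rcos_self[OF sub a] abelian_subgroup.a_rcos_const[OF sub] by blast
  moreover have z: "residue_map A FA \<zero> = FA 1"
    using abelian_subgroup.a_rcos_const[OF sub, of "\<zero>\<^bsub>A\<^esub>"] by (simp add: residue_map_def)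
  ultimately show ?thesis
    using residue_augmentation[OF a] augmentation_eqI[OF a R.zero_closed] by auto
qed

text \<open>The kernel of the augmentation is \<open>FA 1\<close>, so the tensor product is the dual
  modulo the products with \<open>FA 1\<close>, while the target is the dual modulo the functionals
  killing \<open>FC s\<close>. Assumption \<open>act\<close> puts the first subgroup into the second
  and \<open>gen\<close> gives the converse.\<close>

lemma level_if:
  fixes C :: "('a, 'c) module"
  assumes C: "module A C" and sub: "\<And>n. submodule (FC n) A C"
    and act: "\<And>a x. a \<in> FA 1 \<Longrightarrow> x \<in> FC s \<Longrightarrow> a \<odot>\<^bsub>C\<^esub> x = \<zero>\<^bsub>C\<^esub>"
    and top: "FC (s + 1) = {\<zero>\<^bsub>C\<^esub>}"
    and gen: "{f \<in> carrier (dual k A C). \<forall>x\<in>FC s. f x = \<zero>} \<subseteq>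
      generate (add_monoid (dual k A C)) {a \<odot>\<^bsub>dual k A C\<^esub> f | a f. a \<in> FA 1 \<and> f \<in> carrier (dual k A C)}"
  shows "level k A (augmentation k A FA) C FC s"
proof -
  let ?D = "dual k A C"
  let ?V = "restrict_scalars k A C"
  let ?H = "dual_filt k A C FC (1 - s)"
  have alg: "algebra k A" ..
  interpret C: module A C by fact
  have V: "module k ?V" by (rule restrict_scalars_is_module) fact+
  have D: "module A ?D" by (rule dual_is_module) fact+
  interpret D: module A ?D by (rule D)
  have subV: "submodule (FC n) k ?V" for n by (rule submodule_restrict_scalars) fact+
  have H: "?H = {f \<in> carrier ?D. \<forall>x\<in>FC s. f x = \<zero>}"
    using dual_filt_eq[where F = FC and p = "1 - s", OF V subV] by simp
  \<comment> \<open>The index is 1 - (-s) = s + 1, and vanishing on the zero submodule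
    \<open>FC (s + 1)\<close> is no condition. So the piece in degree -s is a quotient of the whole
    dual.\<close>
  have top': "dual_filt k A C FC (- s) = carrier ?D"
    using dual_filt_eq[where F = FC and p = "- s", OF V subV] functional_zero[OF _ V]
    by (auto simp: top carrier_dual add.commute[of 1 s])
  have G: "gr_piece ?D (dual_filt k A C FC) (- s) = quot_module ?D ?H"
  proof -
    have "submodule_of ?D (carrier ?D) = ?D" by (simp add: submodule_of_def)
    moreover have "- s + 1 = 1 - s" by simp
    ultimately show ?thesis by (simp add: gr_piece_def top')
  qed
  have FA1: "FA 1 \<subseteq> carrier A" using filt_decreasing[of 0 1] filt_nonpos[of 0] by simp
  have ker: "a \<in> carrier A \<and> \<epsilon> a = \<zero> \<longleftrightarrow> a \<in> FA 1" for a
    using FA1 augmentation_eq_zero_iff by blast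
  have FCc: "FC s \<subseteq> carrier C" using C.submoduleE(1)[OF sub] .
  have Hsub: "submodule ?H A ?D"
  proof (rule D.submoduleI)
    fix a f assume a: "a \<in> carrier A" and f: "f \<in> ?H"
    have "(a \<odot>\<^bsub>?D\<^esub> f) x = \<zero>" if x: "x \<in> FC s" for x
      using x f FCc C.submoduleE(4)[OF sub a x] by (auto simp: H dual_smult)
    then show "a \<odot>\<^bsub>?D\<^esub> f \<in> ?H" using a f by (simp add: H)
  next
    fix f assume f: "f \<in> ?H"
    then show "\<ominus>\<^bsub>?D\<^esub> f \<in> ?H" using FCc by (auto simp: H dual_minus[OF V])
  next
    fix f g assume "f \<in> ?H" "g \<in> ?H"
    then show "f \<oplus>\<^bsub>?D\<^esub> g \<in> ?H" using FCc by (auto simp: H) (auto simp: dual_add)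
  next
    show "\<zero>\<^bsub>?D\<^esub> \<in> ?H" using FCc by (auto simp: H) (auto simp: dual_zero)
  qed (auto simp: H)
  have Hsup: "a \<odot>\<^bsub>?D\<^esub> f \<in> ?H" if "a \<in> carrier A" "\<epsilon> a = \<zero>" "f \<in> carrier ?D" for a f
  proof -
    have a: "a \<in> FA 1" using ker that by blast
    have "(a \<odot>\<^bsub>?D\<^esub> f) x = \<zero>" if x: "x \<in> FC s" for x
      using act[OF a x] x FCc functional_zero[OF _ V, of f] \<open>f \<in> carrier ?D\<close>
      by (auto simp: dual_smult carrier_dual)
    then show ?thesis using that by (simp add: H)
  qed
  have set_eq: "{a \<odot>\<^bsub>?D\<^esub> f | a f. a \<in> carrier A \<and> \<epsilon> a = \<zero> \<and> f \<in> carrier ?D} =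
      {a \<odot>\<^bsub>?D\<^esub> f | a f. a \<in> FA 1 \<and> f \<in> carrier ?D}"
    using ker by blast
  show ?thesis
    using tensor_residue_iso[OF D R_cring augmentation_hom scalar_hom augmentation_scalar Hsub Hsup] gen
    unfolding level_def Let_def G set_eq H[symmetric] smult_restrict_scalars by blast
qed

end

section \<open>Graded pieces and direct sums\<close>

context
  fixes R :: "('r, 'x) ring_scheme" and M :: "('r, 'm) module" and F :: "int \<Rightarrow> 'm set"
  assumes mod: "module R M" and sub: "\<And>n. submodule (F n) R M" and dec: "\<And>n. F (n + 1) \<subseteq> F n"
begin

interpretation module R M by (rule mod)

lemma filt_in_carrier: "x \<in> F n \<Longrightarrow> x \<in> carrier M"
  using submoduleE(1)[OF sub] by blast

lemma coset_submodule_of: "(+>\<^bsub>submodule_of M N\<^esub>) = (+>\<^bsub>M\<^esub>)"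
  by (simp add: submodule_of_def a_r_coset_def' fun_eq_iff)

lemma gr_piece_module: "module R (gr_piece M F n)"
  unfolding gr_piece_def
  by (intro quot_module_is_module submodule_of_is_module submodule_of_submodule mod sub dec)

lemma carrier_gr_piece: "carrier (gr_piece M F n) = (\<lambda>x. F (n + 1) +>\<^bsub>M\<^esub> x) ` F n"
  unfolding gr_piece_def carrier_quot_module[OF submodule_of_is_module[OF mod sub]] coset_submodule_of
  by (simp add: submodule_of_def)

lemma gr_piece_zero: "\<zero>\<^bsub>gr_piece M F n\<^esub> = F (n + 1)"
  by (simp add: gr_piece_def quot_module_def)

lemma gr_piece_add:
  assumes "x \<in> F n" "y \<in> F n"
  shows "(F (n + 1) +>\<^bsub>M\<^esub> x) \<oplus>\<^bsub>gr_piece M F n\<^esub> (F (n + 1) +>\<^bsub>M\<^esub> y) = F (n + 1) +>\<^bsub>M\<^esub> (x \<oplus>\<^bsub>M\<^esub> y)"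
  using quot_module_add[OF submodule_of_is_module[OF mod sub] submodule_of_submodule[OF mod sub sub dec], of x n y] assms
  unfolding gr_piece_def coset_submodule_of by (simp add: submodule_of_def)

lemma gr_piece_smult:
  assumes "r \<in> carrier R" "x \<in> F n"
  shows "r \<odot>\<^bsub>gr_piece M F n\<^esub> (F (n + 1) +>\<^bsub>M\<^esub> x) = F (n + 1) +>\<^bsub>M\<^esub> (r \<odot>\<^bsub>M\<^esub> x)"
  using quot_module_smult[OF submodule_of_is_module[OF mod sub] submodule_of_submodule[OF mod sub sub dec], of r x n] assms
  unfolding gr_piece_def coset_submodule_of by (simp add: submodule_of_def)

lemma gr_piece_eq_zero_iff:
  assumes "x \<in> F n"
  shows "F (n + 1) +>\<^bsub>M\<^esub> x = \<zero>\<^bsub>gr_piece M F n\<^esub> \<longleftrightarrow> x \<in> F (n + 1)"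
  using coset_eq_self_iff[OF mod sub, of x "n + 1"] filt_in_carrier[OF assms] by (simp add: gr_piece_zero)

end

section \<open>Direct sums and additive functions on them\<close>

lemma carrier_direct_sum:
  "x \<in> carrier (direct_sum M) \<longleftrightarrow> (\<forall>n. x n \<in> carrier (M n)) \<and> finite {n. x n \<noteq> \<zero>\<^bsub>M n\<^esub>}"
  by (simp add: direct_sum_def)

lemma direct_sum_is_module:
  assumes "cring R" and M: "\<And>n. module R (M n)"
  shows "module R (direct_sum M)"
proof -
  let ?D = "direct_sum M"
  have [simp]: "add ?D = (\<lambda>x y n. x n \<oplus>\<^bsub>M n\<^esub> y n)" "ring.zero ?D = (\<lambda>n. \<zero>\<^bsub>M n\<^esub>)"
    "smult ?D = (\<lambda>r x n. r \<odot>\<^bsub>M n\<^esub> x n)"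
    by (simp_all add: direct_sum_def)
  have ag: "abelian_group (M n)" for n using M[of n] by (rule module.axioms)
  note am = abelian_group.axioms(1)[OF ag]
  have fin: "finite {n. z n \<noteq> \<zero>\<^bsub>M n\<^esub>}"
    if "finite {n. x n \<noteq> \<zero>\<^bsub>M n\<^esub>}" "finite {n. y n \<noteq> \<zero>\<^bsub>M n\<^esub>}"
      "\<And>n. x n = \<zero>\<^bsub>M n\<^esub> \<Longrightarrow> y n = \<zero>\<^bsub>M n\<^esub> \<Longrightarrow> z n = \<zero>\<^bsub>M n\<^esub>" for x y z
    by (rule finite_subset[OF _ finite_UnI[OF that(1,2)]]) (use that(3) in blast)
  note [simp] = abelian_monoid.a_closed[OF am]
    abelian_monoid.zero_closed[OF am]
    abelian_monoid.l_zero[OF am]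
    abelian_group.a_inv_closed[OF ag] abelian_group.l_neg[OF ag]
    module.smult_closed[OF M] module.smult_r_null[OF M] module.smult_one[OF M]
  show ?thesis
  proof (rule moduleI[OF assms(1)])
    show "abelian_group ?D"
    proof (rule abelian_groupI)
      fix x y assume x: "x \<in> carrier ?D" and y: "y \<in> carrier ?D"
      then show "x \<oplus>\<^bsub>?D\<^esub> y \<in> carrier ?D"
        using fin[of x y "\<lambda>n. x n \<oplus>\<^bsub>M n\<^esub> y n"] by (simp add: carrier_direct_sum)
      show "x \<oplus>\<^bsub>?D\<^esub> y = y \<oplus>\<^bsub>?D\<^esub> x"
        using x y by (auto simp: carrier_direct_sum abelian_monoid.a_comm[OF am])
      fix z assume "z \<in> carrier ?D"
      then show "x \<oplus>\<^bsub>?D\<^esub> y \<oplus>\<^bsub>?D\<^esub> z = x \<oplus>\<^bsub>?D\<^esub> (y \<oplus>\<^bsub>?D\<^esub> z)"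
        using x y by (simp add: carrier_direct_sum abelian_monoid.a_assoc[OF am])
    next
      fix x assume x: "x \<in> carrier ?D"
      have "(\<lambda>n. \<ominus>\<^bsub>M n\<^esub> x n) \<in> carrier ?D"
        using x fin[of x x "\<lambda>n. \<ominus>\<^bsub>M n\<^esub> x n"] abelian_group.minus_equality[OF ag]
        by (simp add: carrier_direct_sum)
      then show "\<exists>y\<in>carrier ?D. y \<oplus>\<^bsub>?D\<^esub> x = \<zero>\<^bsub>?D\<^esub>"
        using x by (intro bexI[of _ "\<lambda>n. \<ominus>\<^bsub>M n\<^esub> x n"]) (auto simp: carrier_direct_sum)
    qed (auto simp: carrier_direct_sum)
  next
    fix r x assume "r \<in> carrier R" "x \<in> carrier ?D"
    then show "r \<odot>\<^bsub>?D\<^esub> x \<in> carrier ?D"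
      using fin[of x x "\<lambda>n. r \<odot>\<^bsub>M n\<^esub> x n"] by (simp add: carrier_direct_sum)
  qed (auto simp: carrier_direct_sum module.smult_l_distr[OF M] module.smult_r_distr[OF M]
        module.smult_assoc1[OF M])
qed

definition homogeneous :: "(int \<Rightarrow> ('r, 'm) module) \<Rightarrow> int \<Rightarrow> 'm \<Rightarrow> int \<Rightarrow> 'm" where
  "homogeneous M n x = (\<lambda>m. if m = n then x else \<zero>\<^bsub>M m\<^esub>)"

lemma homogeneous_in_direct_sum:
  assumes "\<And>n. module R (M n)" "x \<in> carrier (M n)"
  shows "homogeneous M n x \<in> carrier (direct_sum M)"
proof -
  have "\<zero>\<^bsub>M m\<^esub> \<in> carrier (M m)" for m
    using assms(1)[of m] abelian_monoid.zero_closed abelian_group.axioms(1) module.axioms(2) by blast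
  moreover have "{m. homogeneous M n x m \<noteq> \<zero>\<^bsub>M m\<^esub>} \<subseteq> {n}" by (auto simp: homogeneous_def)
  ultimately show ?thesis
    using assms(2) finite_subset by (fastforce simp: carrier_direct_sum homogeneous_def)
qed

text \<open>The components of \<open>y\<close> in \<open>S\<close> are split off one at a time by
  additivity. \<open>S\<close> may be larger than the support of \<open>y\<close>, which lets one
  index set serve many elements.\<close>

lemma functional_direct_sum:
  assumes "cring R" and M: "\<And>n. module R (M n)"
    and \<phi>: "\<phi> \<in> carrier (direct_sum M) \<rightarrow> carrier R"
      "\<And>x y. x \<in> carrier (direct_sum M) \<Longrightarrow> y \<in> carrier (direct_sum M) \<Longrightarrow>
        \<phi> (x \<oplus>\<^bsub>direct_sum M\<^esub> y) = \<phi> x \<oplus>\<^bsub>R\<^esub> \<phi> y"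
    and S: "finite S"
  shows "y \<in> carrier (direct_sum M) \<Longrightarrow> (\<And>n. n \<notin> S \<Longrightarrow> y n = \<zero>\<^bsub>M n\<^esub>) \<Longrightarrow>
    \<phi> y = (\<Oplus>\<^bsub>R\<^esub>n\<in>S. \<phi> (homogeneous M n (y n)))"
  using S
proof (induction S arbitrary: y rule: finite_induct)
  let ?D = "direct_sum M"
  interpret R: cring R by fact
  interpret D: module R ?D by (rule direct_sum_is_module) fact+
  have add: "x \<oplus>\<^bsub>?D\<^esub> y = (\<lambda>n. x n \<oplus>\<^bsub>M n\<^esub> y n)" for x y by (simp add: direct_sum_def)
  {
    case empty
    then have "y = \<zero>\<^bsub>?D\<^esub>" by (auto simp: direct_sum_def)
    moreover have "\<phi> \<zero>\<^bsub>?D\<^esub> = \<zero>\<^bsub>R\<^esub>"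
    proof -
      have c: "\<phi> \<zero>\<^bsub>?D\<^esub> \<in> carrier R" using \<phi>(1) by auto
      have "\<phi> \<zero>\<^bsub>?D\<^esub> \<oplus>\<^bsub>R\<^esub> \<phi> \<zero>\<^bsub>?D\<^esub> = \<phi> \<zero>\<^bsub>?D\<^esub>"
        using \<phi>(2)[OF D.M.zero_closed D.M.zero_closed] by simp
      then show ?thesis using c R.add.l_cancel_one' by (metis R.add.l_cancel_one)
    qed
    ultimately show ?case by simp
  next
    case (insert j S)
    let ?y' = "y(j := \<zero>\<^bsub>M j\<^esub>)"
    have yc: "y n \<in> carrier (M n)" for n using insert.prems(1) by (simp add: carrier_direct_sum)
    have zc: "\<zero>\<^bsub>M n\<^esub> \<in> carrier (M n)" for n
      using M[of n] abelian_monoid.zero_closed abelian_group.axioms(1) module.axioms(2) by blast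
    have "finite {n. ?y' n \<noteq> \<zero>\<^bsub>M n\<^esub>}"
      by (rule finite_subset[of _ "{n. y n \<noteq> \<zero>\<^bsub>M n\<^esub>}"])
        (use insert.prems(1) in \<open>auto simp: carrier_direct_sum split: if_splits\<close>)
    then have y': "?y' \<in> carrier ?D" using yc zc by (simp add: carrier_direct_sum)
    have hj: "homogeneous M n (y n) \<in> carrier ?D" for n
      by (rule homogeneous_in_direct_sum[OF M yc])
    have "y = homogeneous M j (y j) \<oplus>\<^bsub>?D\<^esub> ?y'"
    proof
      fix n
      interpret Mn: module R "M n" by (rule M)
      interpret Mj: module R "M j" by (rule M)
      show "y n = (homogeneous M j (y j) \<oplus>\<^bsub>?D\<^esub> ?y') n"
        using yc[of n] by (cases "n = j") (simp_all add: add homogeneous_def)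
    qed
    then have "\<phi> y = \<phi> (homogeneous M j (y j)) \<oplus>\<^bsub>R\<^esub> \<phi> ?y'" using \<phi>(2)[OF hj y'] by metis
    also have "\<phi> ?y' = (\<Oplus>\<^bsub>R\<^esub>n\<in>S. \<phi> (homogeneous M n (?y' n)))"
      using insert by (intro insert.IH y') auto
    also have "\<dots> = (\<Oplus>\<^bsub>R\<^esub>n\<in>S. \<phi> (homogeneous M n (y n)))"
      using insert.hyps hj \<phi>(1) by (intro R.finsum_cong') auto
    finally show ?case
      using insert.hyps hj \<phi>(1) by (subst R.finsum_insert) (auto simp: Pi_def)
  }
qed

section \<open>The associated graded module\<close>

locale filtered_pair = residue_algebra k A FA + C: filtered_module A FA C FC
  for k :: "('k, 'x) ring_scheme" (structure) and A :: "('k, 'a) module" and FA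
    and C :: "('a, 'c) module" and FC
begin

abbreviation "GA \<equiv> gr_algebra A FA"
abbreviation "GC \<equiv> gr_module A FA C FC"
abbreviation "QA \<equiv> gr_piece A FA"
abbreviation "Q \<equiv> gr_piece C FC"
abbreviation "cls n x \<equiv> FC (n + 1) +>\<^bsub>C\<^esub> x"
abbreviation "gact \<equiv> gr_act C FC (smult C)"
abbreviation "V \<equiv> restrict_scalars k A C"
abbreviation "GV \<equiv> restrict_scalars k GA GC"

lemma alg: "algebra k A" ..
lemma modC: "module A C" ..
lemma modA: "module k A" ..

lemma A_m_comm: "a \<in> carrier A \<Longrightarrow> b \<in> carrier A \<Longrightarrow> a \<otimes>\<^bsub>A\<^esub> b = b \<otimes>\<^bsub>A\<^esub> a"
  by (rule comm_monoid.m_comm[OF cring.axioms(2)[OF M_cring]])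

lemma FC_dec: "FC (n + 1) \<subseteq> FC n" by (rule C.filt_decreasing) simp

lemma FA_dec: "FA (n + 1) \<subseteq> FA n" by (rule filt_decreasing) simp

lemma FA_carrier: "a \<in> FA n \<Longrightarrow> a \<in> carrier A"
  using ideal.axioms(1)[OF filt_ideal] additive_subgroup.a_subset by blast

lemma FA_submodule: "submodule (FA n) k A"
proof -
  interpret I: ideal "FA n" A by (rule filt_ideal)
  show ?thesis
  proof (rule submoduleI)
    fix c a assume ca: "c \<in> carrier k" "a \<in> FA n"
    have "c \<odot>\<^bsub>A\<^esub> a = (c \<odot>\<^bsub>A\<^esub> \<one>\<^bsub>A\<^esub>) \<otimes>\<^bsub>A\<^esub> a"
      using ca FA_carrier by (simp add: smult_assoc2)
    then show "c \<odot>\<^bsub>A\<^esub> a \<in> FA n" using ca I.I_l_closed by simp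
  qed (use I.a_subset in auto)
qed

lemmas FC_sub = C.filt_submodule

lemma FC_carrier: "x \<in> FC n \<Longrightarrow> x \<in> carrier C"
  using C.submoduleE(1)[OF FC_sub] by blast

lemmas Q_module = gr_piece_module[where F = FC, OF modC FC_sub FC_dec]
  and Q_carrier = carrier_gr_piece[where F = FC, OF modC FC_sub FC_dec]
  and Q_zero = gr_piece_zero[where F = FC, OF modC FC_sub FC_dec]
  and Q_add = gr_piece_add[where F = FC, OF modC FC_sub FC_dec]
  and Q_smult = gr_piece_smult[where F = FC, OF modC FC_sub FC_dec]
  and Q_eq_zero_iff = gr_piece_eq_zero_iff[where F = FC, OF modC FC_sub FC_dec]
  and QA_module = gr_piece_module[where F = FA, OF modA FA_submodule FA_dec]
  and QA_carrier = carrier_gr_piece[where F = FA, OF modA FA_submodule FA_dec]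
  and QA_zero = gr_piece_zero[where F = FA, OF modA FA_submodule FA_dec]
  and QA_smult = gr_piece_smult[where F = FA, OF modA FA_submodule FA_dec]
  and QA_eq_zero_iff = gr_piece_eq_zero_iff[where F = FA, OF modA FA_submodule FA_dec]

lemma FC_smult:
  assumes "a \<in> FA i" "x \<in> FC j" "n \<le> i + j"
  shows "a \<odot>\<^bsub>C\<^esub> x \<in> FC n"
  using C.filt_smult[OF assms(1,2)] C.filt_decreasing[OF assms(3)] by blast

text \<open>Changing both representatives alters the product by three terms, each with at least one
  factor one step deeper in its filtration, hence all in \<open>FC (i + j + 1)\<close>. So the union
  defining \<open>gr_act\<close> is a single coset.\<close>

lemma gact_coset:
  assumes a: "a \<in> FA i" and x: "x \<in> FC j"
  shows "gact i j (FA (i + 1) +>\<^bsub>A\<^esub> a) (cls j x) = cls (i + j) (a \<odot>\<^bsub>C\<^esub> x)"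
proof -
  note sub = submodule_abelian_subgroup[OF modC FC_sub] and subA = submodule_abelian_subgroup[OF modA FA_submodule]
  have "cls (i + j) (a' \<odot>\<^bsub>C\<^esub> x') = cls (i + j) (a \<odot>\<^bsub>C\<^esub> x)"
    if a': "a' \<in> FA (i + 1) +>\<^bsub>A\<^esub> a" and x': "x' \<in> cls j x" for a' x'
  proof -
    obtain \<alpha> where \<alpha>: "\<alpha> \<in> FA (i + 1)" "a' = \<alpha> \<oplus>\<^bsub>A\<^esub> a" using a' by (auto simp: a_r_coset_def')
    obtain \<xi> where \<xi>: "\<xi> \<in> FC (j + 1)" "x' = \<xi> \<oplus>\<^bsub>C\<^esub> x" using x' by (auto simp: a_r_coset_def')
    note c = FA_carrier[OF a] FC_carrier[OF x] FA_carrier[OF \<alpha>(1)] FC_carrier[OF \<xi>(1)]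
    let ?y = "a \<odot>\<^bsub>C\<^esub> \<xi> \<oplus>\<^bsub>C\<^esub> (\<alpha> \<odot>\<^bsub>C\<^esub> \<xi> \<oplus>\<^bsub>C\<^esub> \<alpha> \<odot>\<^bsub>C\<^esub> x)"
    have "?y \<in> FC (i + j + 1)"
      by (intro C.submoduleE(5)[OF FC_sub] FC_smult[OF a \<xi>(1)] FC_smult[OF \<alpha>(1) \<xi>(1)] FC_smult[OF \<alpha>(1) x]) simp_all
    moreover have "a' \<odot>\<^bsub>C\<^esub> x' = ?y \<oplus>\<^bsub>C\<^esub> a \<odot>\<^bsub>C\<^esub> x"
      using c by (simp add: \<alpha> \<xi> C.smult_l_distr C.smult_r_distr C.M.a_ac)
    ultimately have "a' \<odot>\<^bsub>C\<^esub> x' \<in> cls (i + j) (a \<odot>\<^bsub>C\<^esub> x)" by (auto simp: a_r_coset_def')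
    then show ?thesis
      using abelian_subgroup.a_repr_independence'[OF sub] c by (metis C.smult_closed)
  qed
  moreover have "a \<in> FA (i + 1) +>\<^bsub>A\<^esub> a" "x \<in> cls j x"
    using abelian_subgroup.a_rcos_self[OF sub FC_carrier[OF x]]
      abelian_subgroup.a_rcos_self[OF subA FA_carrier[OF a]] by auto
  ultimately show ?thesis unfolding gr_act_def by blast
qed

context
  fixes i n :: int and U
  assumes U: "U \<in> carrier (QA i)"
begin

lemma gact_closed: "X \<in> carrier (Q (n - i)) \<Longrightarrow> gact i (n - i) U X \<in> carrier (Q n)"
  using U FC_smult[of _ i _ "n - i" n] by (auto simp: QA_carrier Q_carrier gact_coset)

lemma gact_add:
  "X \<in> carrier (Q (n - i)) \<Longrightarrow> Y \<in> carrier (Q (n - i)) \<Longrightarrow>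
    gact i (n - i) U (X \<oplus>\<^bsub>Q (n - i)\<^esub> Y) = gact i (n - i) U X \<oplus>\<^bsub>Q n\<^esub> gact i (n - i) U Y"
proof -
  assume "X \<in> carrier (Q (n - i))" "Y \<in> carrier (Q (n - i))"
  then obtain x y where xy: "x \<in> FC (n - i)" "y \<in> FC (n - i)" "X = cls (n - i) x" "Y = cls (n - i) y"
    by (auto simp: Q_carrier)
  obtain a where a: "a \<in> FA i" "U = FA (i + 1) +>\<^bsub>A\<^esub> a" using U by (auto simp: QA_carrier)
  have "x \<oplus>\<^bsub>C\<^esub> y \<in> FC (n - i)" by (rule C.submoduleE(5)[OF FC_sub xy(1,2)])
  moreover have "a \<odot>\<^bsub>C\<^esub> x \<in> FC n" "a \<odot>\<^bsub>C\<^esub> y \<in> FC n" using FC_smult a xy by auto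
  ultimately show ?thesis
    using gact_coset[OF a(1), of _ "n - i"] xy a FA_carrier FC_carrier
    by (simp add: Q_add C.smult_r_distr)
qed

lemma gact_smult:
  "b \<in> carrier A \<Longrightarrow> X \<in> carrier (Q (n - i)) \<Longrightarrow>
    gact i (n - i) U (b \<odot>\<^bsub>Q (n - i)\<^esub> X) = b \<odot>\<^bsub>Q n\<^esub> gact i (n - i) U X"
proof -
  assume b: "b \<in> carrier A" and "X \<in> carrier (Q (n - i))"
  then obtain x where x: "x \<in> FC (n - i)" "X = cls (n - i) x" by (auto simp: Q_carrier)
  obtain a where a: "a \<in> FA i" "U = FA (i + 1) +>\<^bsub>A\<^esub> a" using U by (auto simp: QA_carrier)
  have "b \<odot>\<^bsub>C\<^esub> x \<in> FC (n - i)" by (rule C.submoduleE(4)[OF FC_sub b x(1)])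
  moreover have "a \<odot>\<^bsub>C\<^esub> x \<in> FC n" using FC_smult a x by auto
  moreover have "a \<odot>\<^bsub>C\<^esub> (b \<odot>\<^bsub>C\<^esub> x) = b \<odot>\<^bsub>C\<^esub> (a \<odot>\<^bsub>C\<^esub> x)"
    using a(1) b x(1) FA_carrier FC_carrier A_m_comm by (simp add: C.smult_assoc1[symmetric])
  ultimately show ?thesis
    using gact_coset[OF a(1), of _ "n - i"] x a b by (simp add: Q_smult)
qed

lemma gact_zero_right: "gact i (n - i) U \<zero>\<^bsub>Q (n - i)\<^esub> = \<zero>\<^bsub>Q n\<^esub>"
proof -
  interpret Q': module A "Q (n - i)" by (rule Q_module)
  interpret Q'': module A "Q n" by (rule Q_module)
  show ?thesis
    using gact_smult[OF M.zero_closed Q'.M.zero_closed] gact_closed[OF Q'.M.zero_closed] by simp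
qed

end

lemma gact_zero_left:
  assumes "X \<in> carrier (Q j)"
  shows "gact i j \<zero>\<^bsub>QA i\<^esub> X = \<zero>\<^bsub>Q (i + j)\<^esub>"
proof -
  obtain x where x: "x \<in> FC j" "X = cls j x" using assms by (auto simp: Q_carrier)
  have z: "\<zero>\<^bsub>A\<^esub> \<in> FA i" for i
    using ideal.axioms(1)[OF filt_ideal] additive_subgroup.zero_closed by blast
  have "\<zero>\<^bsub>QA i\<^esub> = FA (i + 1) +>\<^bsub>A\<^esub> \<zero>\<^bsub>A\<^esub>" using QA_eq_zero_iff[OF z] z by simp
  moreover have "\<zero>\<^bsub>C\<^esub> \<in> FC m" for m
    using subgroup.one_closed[OF submodule.axioms(1)[OF FC_sub]] by simp
  ultimately show ?thesis
    using gact_coset[OF z x(1)] x FC_carrier[OF x(1)] Q_eq_zero_iff[of "\<zero>\<^bsub>C\<^esub>" "i + j"] by simp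
qed

section \<open>The graded module as a module over \<open>k\<close>\<close>

lemma GA_carrier: "a \<in> carrier GA \<longleftrightarrow> (\<forall>i. a i \<in> carrier (QA i)) \<and> finite {i. a i \<noteq> \<zero>\<^bsub>QA i\<^esub>}"
  by (simp add: gr_algebra_def carrier_direct_sum[symmetric])

lemma GC_carrier: "x \<in> carrier GC \<longleftrightarrow> x \<in> carrier (direct_sum Q)"
  by (simp add: gr_module_def Let_def)

lemma GC_add: "x \<oplus>\<^bsub>GC\<^esub> y = (\<lambda>n. x n \<oplus>\<^bsub>Q n\<^esub> y n)"
  by (simp add: gr_module_def Let_def direct_sum_def)

lemma GC_smult:
  "a \<odot>\<^bsub>GC\<^esub> x = (\<lambda>n. \<Oplus>\<^bsub>Q n\<^esub>i\<in>{i. a i \<noteq> \<zero>\<^bsub>QA i\<^esub>}. gact i (n - i) (a i) (x (n - i)))"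
  by (simp add: gr_module_def Let_def)

text \<open>The graded pieces with scalars restricted to \<open>k\<close>. These are the modules
  assumed locally free, and over \<open>k\<close> the graded module is their direct sum.\<close>

definition kQ :: "int \<Rightarrow> ('k, 'c set) module" where
  "kQ n = restrict_scalars k A (Q n)"

lemma kQ_module: "module k (kQ n)"
  unfolding kQ_def by (rule restrict_scalars_is_module[OF alg Q_module])

lemma kQ_simps [simp]: "carrier (kQ n) = carrier (Q n)" "add (kQ n) = add (Q n)" "\<zero>\<^bsub>kQ n\<^esub> = \<zero>\<^bsub>Q n\<^esub>"
  by (simp_all add: kQ_def)

lemma kQ_smult: "c \<odot>\<^bsub>kQ n\<^esub> X = (c \<odot>\<^bsub>A\<^esub> \<one>\<^bsub>A\<^esub>) \<odot>\<^bsub>Q n\<^esub> X"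
  by (simp add: kQ_def smult_restrict_scalars)

abbreviation "\<iota>\<^sub>Q \<equiv> homogeneous kQ"

lemma direct_sum_kQ: "carrier (direct_sum kQ) = carrier GC" "add (direct_sum kQ) = add GC"
  "ring.zero (direct_sum kQ) = ring.zero GC"
  by (simp_all add: direct_sum_def gr_module_def Let_def)

text \<open>A scalar of \<open>k\<close> sits in the graded algebra in degree 0, so at most the term
  with i = 0 survives in the convolution.\<close>

lemma GC_scalar:
  assumes c: "c \<in> carrier k" and x: "x \<in> carrier GC"
  shows "(c \<odot>\<^bsub>GA\<^esub> \<one>\<^bsub>GA\<^esub>) \<odot>\<^bsub>GC\<^esub> x = c \<odot>\<^bsub>direct_sum kQ\<^esub> x"
proof
  fix n
  interpret Qn: module A "Q n" by (rule Q_module)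
  let ?a = "c \<odot>\<^bsub>GA\<^esub> \<one>\<^bsub>GA\<^esub>"
  have xn: "x n \<in> carrier (Q n)" using x by (simp add: GC_carrier carrier_direct_sum)
  then obtain y where y: "y \<in> FC n" "x n = cls n y" by (auto simp: Q_carrier)
  have one0: "\<one>\<^bsub>A\<^esub> \<in> FA 0" "c \<odot>\<^bsub>A\<^esub> \<one>\<^bsub>A\<^esub> \<in> FA 0" using filt_nonpos[of 0] c by auto
  have a0: "?a 0 = FA (0 + 1) +>\<^bsub>A\<^esub> (c \<odot>\<^bsub>A\<^esub> \<one>\<^bsub>A\<^esub>)"
    using QA_smult[OF c one0(1)] by (simp add: gr_algebra_def direct_sum_def)
  have ai: "?a i = \<zero>\<^bsub>QA i\<^esub>" if "i \<noteq> 0" for i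
    using that module.smult_r_null[OF QA_module c, of i] by (simp add: gr_algebra_def direct_sum_def)
  have val: "gact 0 n (?a 0) (x n) = (c \<odot>\<^bsub>A\<^esub> \<one>\<^bsub>A\<^esub>) \<odot>\<^bsub>Q n\<^esub> x n"
    using gact_coset[OF one0(2) y(1)] y c by (simp add: a0 Q_smult)
  have "(?a \<odot>\<^bsub>GC\<^esub> x) n = gact 0 n (?a 0) (x n)"
  \<comment> \<open>The convolution runs over the support of \<open>?a\<close>, which is empty or
    {0} according to whether the degree 0 class is zero.\<close>
  proof (cases "?a 0 = \<zero>\<^bsub>QA 0\<^esub>")
    case True
    then have "?a i = \<zero>\<^bsub>QA i\<^esub>" for i using ai[of i] by (cases "i = 0") simp_all
    then have "{i. ?a i \<noteq> \<zero>\<^bsub>QA i\<^esub>} = {}" by simp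
    then show ?thesis using True gact_zero_left[OF xn, of 0] unfolding GC_smult by simp
  next
    case False
    then have "?a i \<noteq> \<zero>\<^bsub>QA i\<^esub> \<longleftrightarrow> i = 0" for i using ai[of i] by (cases "i = 0") simp_all
    then have "{i. ?a i \<noteq> \<zero>\<^bsub>QA i\<^esub>} = {0}" by simp
    moreover have "gact 0 n (?a 0) (x n) \<in> carrier (Q n)" using val xn c by simp
    ultimately show ?thesis unfolding GC_smult by simp
  qed
  then show "(?a \<odot>\<^bsub>GC\<^esub> x) n = (c \<odot>\<^bsub>direct_sum kQ\<^esub> x) n"
    by (simp add: val direct_sum_def kQ_smult)
qed

text \<open>The axioms are transported from the direct sum of the \<open>kQ n\<close> along the
  agreement of scalars in \<open>GC_scalar\<close>, rather than from an action of the graded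
  algebra.\<close>

lemma GV_module: "module k GV"
  by (rule module_cong[OF direct_sum_is_module[where M = kQ, OF R_cring kQ_module]])
    (simp_all add: direct_sum_kQ smult_restrict_scalars GC_scalar)

lemma GV_smult: "c \<in> carrier k \<Longrightarrow> x \<in> carrier GC \<Longrightarrow>
    c \<odot>\<^bsub>GV\<^esub> x = (\<lambda>n. (c \<odot>\<^bsub>A\<^esub> \<one>\<^bsub>A\<^esub>) \<odot>\<^bsub>Q n\<^esub> x n)"
  by (simp add: smult_restrict_scalars GC_scalar) (simp add: direct_sum_def kQ_smult)

section \<open>The action of one element of the graded algebra\<close>

context
  fixes a
  assumes a: "a \<in> carrier GA"
begin

lemma GA_comp: "a i \<in> carrier (QA i)"
  and GA_finite: "finite {i. a i \<noteq> \<zero>\<^bsub>QA i\<^esub>}"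
  using a by (auto simp: GA_carrier)

lemma GC_comp: "x \<in> carrier GC \<Longrightarrow> x n \<in> carrier (Q n)"
  by (simp add: GC_carrier carrier_direct_sum)

lemma GC_smult_closed:
  assumes x: "x \<in> carrier GC"
  shows "a \<odot>\<^bsub>GC\<^esub> x \<in> carrier GC"
proof -
  let ?I = "{i. a i \<noteq> \<zero>\<^bsub>QA i\<^esub>}" and ?J = "{j. x j \<noteq> \<zero>\<^bsub>Q j\<^esub>}"
  have "(a \<odot>\<^bsub>GC\<^esub> x) n \<in> carrier (Q n)" for n
  proof -
    interpret Qn: module A "Q n" by (rule Q_module)
    show ?thesis
      unfolding GC_smult using gact_closed[OF GA_comp GC_comp[OF x]] by (intro Qn.M.finsum_closed) auto
  qed
  \<comment> \<open>Degrees add, so the support of the product lies in the sum of the two finite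
    supports.\<close>
  moreover have "{n. (a \<odot>\<^bsub>GC\<^esub> x) n \<noteq> \<zero>\<^bsub>Q n\<^esub>} \<subseteq> (\<lambda>(i, j). i + j) ` (?I \<times> ?J)"
  proof
    fix n assume n: "n \<in> {n. (a \<odot>\<^bsub>GC\<^esub> x) n \<noteq> \<zero>\<^bsub>Q n\<^esub>}"
    interpret Qn: module A "Q n" by (rule Q_module)
    have "\<exists>i\<in>?I. gact i (n - i) (a i) (x (n - i)) \<noteq> \<zero>\<^bsub>Q n\<^esub>"
    proof (rule ccontr)
      assume "\<not> (\<exists>i\<in>?I. gact i (n - i) (a i) (x (n - i)) \<noteq> \<zero>\<^bsub>Q n\<^esub>)"
      then have "(a \<odot>\<^bsub>GC\<^esub> x) n = (\<Oplus>\<^bsub>Q n\<^esub>i\<in>?I. \<zero>\<^bsub>Q n\<^esub>)"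
        unfolding GC_smult by (intro Qn.M.finsum_cong') auto
      then show False using n by simp
    qed
    then obtain i where i: "i \<in> ?I" "gact i (n - i) (a i) (x (n - i)) \<noteq> \<zero>\<^bsub>Q n\<^esub>" by blast
    then have "n - i \<in> ?J" using gact_zero_right[OF GA_comp, of i n] by auto
    then show "n \<in> (\<lambda>(i, j). i + j) ` (?I \<times> ?J)" using i by (intro image_eqI[of _ _ "(i, n - i)"]) auto
  qed
  moreover have "finite ((\<lambda>(i, j). i + j) ` (?I \<times> ?J))"
    using GA_finite x by (auto simp: GC_carrier carrier_direct_sum)
  ultimately show ?thesis using finite_subset by (auto simp: GC_carrier carrier_direct_sum)
qed

lemma GC_smult_add:
  assumes x: "x \<in> carrier GC" and y: "y \<in> carrier GC"
  shows "a \<odot>\<^bsub>GC\<^esub> (x \<oplus>\<^bsub>GC\<^esub> y) = a \<odot>\<^bsub>GC\<^esub> x \<oplus>\<^bsub>GC\<^esub> a \<odot>\<^bsub>GC\<^esub> y"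
proof
  fix n
  interpret Qn: module A "Q n" by (rule Q_module)
  show "(a \<odot>\<^bsub>GC\<^esub> (x \<oplus>\<^bsub>GC\<^esub> y)) n = (a \<odot>\<^bsub>GC\<^esub> x \<oplus>\<^bsub>GC\<^esub> a \<odot>\<^bsub>GC\<^esub> y) n"
    unfolding GC_smult GC_add
    using gact_closed[OF GA_comp GC_comp[OF x]] gact_closed[OF GA_comp GC_comp[OF y]]
    by (simp add: gact_add[OF GA_comp GC_comp[OF x] GC_comp[OF y]] Qn.M.finsum_addf Pi_def)
qed

lemma GC_smult_scalar:
  assumes x: "x \<in> carrier GC" and c: "c \<in> carrier k"
  shows "a \<odot>\<^bsub>GC\<^esub> (c \<odot>\<^bsub>GV\<^esub> x) = c \<odot>\<^bsub>GV\<^esub> (a \<odot>\<^bsub>GC\<^esub> x)"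
proof
  fix n
  interpret Qn: module A "Q n" by (rule Q_module)
  have s: "c \<odot>\<^bsub>A\<^esub> \<one>\<^bsub>A\<^esub> \<in> carrier A" using c by simp
  have "(a \<odot>\<^bsub>GC\<^esub> (c \<odot>\<^bsub>GV\<^esub> x)) n = (\<Oplus>\<^bsub>Q n\<^esub>i\<in>{i. a i \<noteq> \<zero>\<^bsub>QA i\<^esub>}. (c \<odot>\<^bsub>A\<^esub> \<one>\<^bsub>A\<^esub>) \<odot>\<^bsub>Q n\<^esub> gact i (n - i) (a i) (x (n - i)))"
    unfolding GV_smult[OF c x] GC_smult by (simp add: gact_smult[OF GA_comp s GC_comp[OF x]])
  also have "\<dots> = (c \<odot>\<^bsub>A\<^esub> \<one>\<^bsub>A\<^esub>) \<odot>\<^bsub>Q n\<^esub> (a \<odot>\<^bsub>GC\<^esub> x) n"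
    unfolding GC_smult using gact_closed[OF GA_comp GC_comp[OF x]] s GA_finite
    by (intro Qn.finsum_smult_ldistr[symmetric]) auto
  finally show "(a \<odot>\<^bsub>GC\<^esub> (c \<odot>\<^bsub>GV\<^esub> x)) n = (c \<odot>\<^bsub>GV\<^esub> (a \<odot>\<^bsub>GC\<^esub> x)) n"
    by (simp add: GV_smult[OF c GC_smult_closed[OF x]])
qed

text \<open>As \<open>X\<close> sits in degree n, degree m is reached only through the component of
  \<open>a\<close> in degree m - n. If that component is zero it is missing from the index set, but
  then its product with \<open>X\<close> is zero too.\<close>

lemma GC_smult_homogeneous:
  assumes X: "X \<in> carrier (Q n)"
  shows "(a \<odot>\<^bsub>GC\<^esub> \<iota>\<^sub>Q n X) m = gact (m - n) n (a (m - n)) X"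
proof -
  interpret Qm: module A "Q m" by (rule Q_module)
  let ?I = "{i. a i \<noteq> \<zero>\<^bsub>QA i\<^esub>}"
  let ?v = "gact (m - n) n (a (m - n)) X"
  have v: "?v \<in> carrier (Q m)" using gact_closed[OF GA_comp, of X m "m - n"] X by simp
  have t: "gact i (m - i) (a i) (\<iota>\<^sub>Q n X (m - i)) = (if m - n = i then ?v else \<zero>\<^bsub>Q m\<^esub>)" for i
    using gact_zero_right[OF GA_comp, of i m] by (auto simp: homogeneous_def)
  have "(a \<odot>\<^bsub>GC\<^esub> \<iota>\<^sub>Q n X) m = (\<Oplus>\<^bsub>Q m\<^esub>i\<in>?I. if m - n = i then ?v else \<zero>\<^bsub>Q m\<^esub>)"
    unfolding GC_smult t ..
  also have "\<dots> = ?v"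
  proof (cases "m - n \<in> ?I")
    case True
    then show ?thesis
      using Qm.M.add.finprod_singleton[OF True GA_finite, of "\<lambda>_. ?v"] v by (simp add: finsum_def)
  next
    case False
    then have "(\<Oplus>\<^bsub>Q m\<^esub>i\<in>?I. if m - n = i then ?v else \<zero>\<^bsub>Q m\<^esub>) = (\<Oplus>\<^bsub>Q m\<^esub>i\<in>?I. \<zero>\<^bsub>Q m\<^esub>)"
      by (intro Qm.M.finsum_cong') auto
    moreover have "a (m - n) = \<zero>\<^bsub>QA (m - n)\<^esub>" using False by simp
    ultimately show ?thesis using gact_zero_left[OF X, of "m - n"] by simp
  qed
  finally show ?thesis .
qed

end

end

lemma carrier_residue_module: "carrier (residue_module k \<epsilon>) = carrier k"
  by (simp add: residue_module_def)

lemma submoduleI_smult: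
  fixes M :: "('r, 'm) module"
  assumes "module R M" "N \<subseteq> carrier M" "\<zero>\<^bsub>M\<^esub> \<in> N"
    and "\<And>x y. x \<in> N \<Longrightarrow> y \<in> N \<Longrightarrow> x \<oplus>\<^bsub>M\<^esub> y \<in> N"
    and smult: "\<And>r x. r \<in> carrier R \<Longrightarrow> x \<in> N \<Longrightarrow> r \<odot>\<^bsub>M\<^esub> x \<in> N"
  shows "submodule N R M"
proof -
  interpret module R M by fact
  have "\<ominus>\<^bsub>M\<^esub> x \<in> N" if x: "x \<in> N" for x
    using smult[of "\<ominus>\<^bsub>R\<^esub> \<one>\<^bsub>R\<^esub>" x] smult_l_minus[of "\<one>\<^bsub>R\<^esub>" x] x assms(2) by auto
  then show ?thesis using assms by (intro submoduleI) auto
qed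

section \<open>Functionals on the graded module and their restrictions to the filtration\<close>

context filtered_pair
begin

abbreviation "D \<equiv> dual k A C"
abbreviation "GD \<equiv> dual k GA GC"
abbreviation "g\<epsilon> \<equiv> gr_augmentation k A FA"
abbreviation "GK \<equiv> residue_module k g\<epsilon>"
text \<open>The product of F^1 A with the dual, kept as a generated additive subgroup; scalars from
  \<open>k\<close> are absorbed into the factor from \<open>FA 1\<close> whenever an element is
  built.\<close>

abbreviation "ID \<equiv> generate (add_monoid D) {a \<odot>\<^bsub>D\<^esub> f | a f. a \<in> FA 1 \<and> f \<in> carrier D}"

lemma V_module: "module k V"
  by (rule restrict_scalars_is_module[OF alg modC])

lemma D_module: "module A D"
  by (rule dual_is_module[OF alg modC])

lemma gr_augmentation_closed:
  assumes "a \<in> carrier GA"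
  shows "g\<epsilon> a \<in> carrier k" and "a 0 = FA (0 + 1) +>\<^bsub>A\<^esub> (g\<epsilon> a \<odot>\<^bsub>A\<^esub> \<one>\<^bsub>A\<^esub>)"
proof -
  have "a 0 \<in> (\<lambda>x. FA 1 +>\<^bsub>A\<^esub> x) ` carrier A"
    using GA_comp[OF assms, of 0] filt_nonpos[of 0] by (simp add: QA_carrier)
  then have "a 0 \<in> a_rcosets\<^bsub>A\<^esub> FA 1" by (elim imageE) (simp add: coset_in_rcosets)
  from residue_inv[OF this] show "g\<epsilon> a \<in> carrier k" "a 0 = FA (0 + 1) +>\<^bsub>A\<^esub> (g\<epsilon> a \<odot>\<^bsub>A\<^esub> \<one>\<^bsub>A\<^esub>)"
    by (simp_all add: gr_augmentation_def residue_map_def)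
qed

text \<open>For negative \<open>i\<close> both \<open>FA i\<close> and \<open>FA (i + 1)\<close> are
  all of \<open>A\<close>. Consequently a nonzero component outside degree 0 has positive degree and
  is represented in \<open>FA 1\<close>.\<close>

lemma negative_QA:
  assumes "i < 0" "U \<in> carrier (QA i)"
  shows "U = \<zero>\<^bsub>QA i\<^esub>"
proof -
  obtain a where a: "a \<in> FA i" "U = FA (i + 1) +>\<^bsub>A\<^esub> a" using assms(2) by (auto simp: QA_carrier)
  have "a \<in> FA (i + 1)" using filt_nonpos[of "i + 1"] assms(1) FA_carrier[OF a(1)] by simp
  then show ?thesis using QA_eq_zero_iff[OF a(1)] a(2) by simp
qed

lemma GD_abelian_group: "abelian_group GD"
  by (rule dual_abelian_group[OF GV_module])

lemma GD_smult_closed: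
  assumes a: "a \<in> carrier GA" and \<phi>: "\<phi> \<in> carrier GD"
  shows "a \<odot>\<^bsub>GD\<^esub> \<phi> \<in> carrier GD"
proof -
  have l: "\<phi> \<in> functionals k GV" using \<phi> by (simp add: carrier_dual)
  note \<phi> = functional_closed[OF l, simplified] functional_add[OF l, simplified] functional_smult[OF l, simplified]
  interpret GV: module k GV by (rule GV_module)
  have "x \<oplus>\<^bsub>GC\<^esub> y \<in> carrier GC" if "x \<in> carrier GC" "y \<in> carrier GC" for x y
    using GV.M.a_closed[of x y] that by simp
  moreover have "c \<odot>\<^bsub>GV\<^esub> x \<in> carrier GC" if "c \<in> carrier k" "x \<in> carrier GC" for c x
    using GV.smult_closed[of c x] that by simp
  ultimately show ?thesis
    unfolding carrier_dual functionals_iff dual_smult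
    by (auto simp: GC_smult_closed[OF a] GC_smult_add[OF a] GC_smult_scalar[OF a] \<phi>)
qed

lemma GD_tensor: "tensor GA GD GK"
proof -
  interpret GD: abelian_group GD by (rule GD_abelian_group)
  show ?thesis
    by unfold_locales (auto simp: residue_module_def gr_augmentation_closed GD_smult_closed)
qed

lemma homogeneous_closed: "X \<in> carrier (Q n) \<Longrightarrow> \<iota>\<^sub>Q n X \<in> carrier GC"
  using homogeneous_in_direct_sum[where M = kQ and x = X and n = n, OF kQ_module] by (simp add: direct_sum_kQ)

lemma cls_closed: "x \<in> FC n \<Longrightarrow> cls n x \<in> carrier (Q n)"
  by (auto simp: Q_carrier)

lemma homogeneous_add:
  assumes "X \<in> carrier (Q n)" "Y \<in> carrier (Q n)"
  shows "\<iota>\<^sub>Q n (X \<oplus>\<^bsub>Q n\<^esub> Y) = \<iota>\<^sub>Q n X \<oplus>\<^bsub>GC\<^esub> \<iota>\<^sub>Q n Y"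
proof
  fix m
  interpret Qm: module A "Q m" by (rule Q_module)
  show "\<iota>\<^sub>Q n (X \<oplus>\<^bsub>Q n\<^esub> Y) m = (\<iota>\<^sub>Q n X \<oplus>\<^bsub>GC\<^esub> \<iota>\<^sub>Q n Y) m"
    using assms by (simp add: homogeneous_def GC_add)
qed

lemma homogeneous_smult:
  assumes "X \<in> carrier (Q n)" "c \<in> carrier k"
  shows "\<iota>\<^sub>Q n ((c \<odot>\<^bsub>A\<^esub> \<one>\<^bsub>A\<^esub>) \<odot>\<^bsub>Q n\<^esub> X) = c \<odot>\<^bsub>GV\<^esub> \<iota>\<^sub>Q n X"
proof
  fix m
  interpret Qm: module A "Q m" by (rule Q_module)
  show "\<iota>\<^sub>Q n ((c \<odot>\<^bsub>A\<^esub> \<one>\<^bsub>A\<^esub>) \<odot>\<^bsub>Q n\<^esub> X) m = (c \<odot>\<^bsub>GV\<^esub> \<iota>\<^sub>Q n X) m"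
    unfolding GV_smult[OF assms(2) homogeneous_closed[OF assms(1)]]
    using assms by (simp add: homogeneous_def)
qed

lemma gr_filt_submodule: "submodule (gr_filt C FC s) k GV"
proof (rule submoduleI_smult[OF GV_module])
  interpret GV: module k GV by (rule GV_module)
  interpret Qn: module A "Q n" for n by (rule Q_module)
  note gr = gr_filt_def GC_carrier[symmetric]
  show "gr_filt C FC s \<subseteq> carrier GV" by (auto simp: gr)
  show "\<zero>\<^bsub>GV\<^esub> \<in> gr_filt C FC s"
    using GV.M.zero_closed by (simp add: gr) (simp add: gr_module_def direct_sum_def)
  fix x y assume x: "x \<in> gr_filt C FC s"
  {
    assume "y \<in> gr_filt C FC s"
    then show "x \<oplus>\<^bsub>GV\<^esub> y \<in> gr_filt C FC s"
      using x GV.M.a_closed[of x y] by (simp add: gr) (simp add: GC_add)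
  }
  fix c assume "c \<in> carrier k"
  then show "c \<odot>\<^bsub>GV\<^esub> x \<in> gr_filt C FC s"
    using x GV.smult_closed[of c x] by (simp add: gr) (simp add: GV_smult gr)
qed

text \<open>The pullback of \<open>\<phi>\<close> along F^m C \<rightarrow> G_m C \<rightarrow> G C.
  This is the functional on a step of the filtration that will be extended to all of
  \<open>C\<close>.\<close>

lemma functional_gr_lift:
  assumes \<phi>: "\<phi> \<in> carrier GD"
  shows "(\<lambda>y\<in>FC m. \<phi> (\<iota>\<^sub>Q m (cls m y))) \<in> functionals k (submodule_of V (FC m))"
proof -
  have l: "\<phi> \<in> functionals k GV" using \<phi> by (simp add: carrier_dual)
  note \<phi>_simps = functional_closed[OF l, simplified] functional_add[OF l, simplified] functional_smult[OF l, simplified]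
  have s: "c \<odot>\<^bsub>A\<^esub> \<one>\<^bsub>A\<^esub> \<in> carrier A" if "c \<in> carrier k" for c using that by simp
  have cl: "x \<oplus>\<^bsub>C\<^esub> y \<in> FC m" if "x \<in> FC m" "y \<in> FC m" for x y
    using C.submoduleE(5)[OF FC_sub that] .
  have sm: "(c \<odot>\<^bsub>A\<^esub> \<one>\<^bsub>A\<^esub>) \<odot>\<^bsub>C\<^esub> x \<in> FC m" if "c \<in> carrier k" "x \<in> FC m" for c x
    using C.submoduleE(4)[OF FC_sub s that(2)] that(1) .
  show ?thesis
    unfolding functionals_iff
    by (auto simp: submodule_of_def smult_restrict_scalars[of k A C] cl sm \<phi>_simps homogeneous_closed cls_closed
        Q_add[symmetric] Q_smult[OF s, symmetric] homogeneous_add homogeneous_smult)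
qed

lemma ID_subgroup: "subgroup ID (add_monoid D)"
proof -
  interpret D: module A D by (rule D_module)
  show ?thesis
    using FA_carrier by (intro D.M.add.generate_is_subgroup) auto
qed

text \<open>The witnesses add up in the dual while the values add up in \<open>k\<close>; the
  induction matches the two sums.\<close>

lemma finsum_restriction:
  assumes "finite S" and "\<And>m. m \<in> S \<Longrightarrow> \<exists>w\<in>ID. \<forall>x\<in>FC n. t m x = w x"
  shows "\<exists>w\<in>ID. \<forall>x\<in>FC n. (\<Oplus>m\<in>S. t m x) = w x"
  using assms
proof (induction S rule: finite_induct)
  case empty
  have "\<zero>\<^bsub>D\<^esub> \<in> ID" using subgroup.one_closed[OF ID_subgroup] by simp
  moreover have "\<forall>x\<in>FC n. (\<Oplus>m\<in>{}. t m x) = \<zero>\<^bsub>D\<^esub> x"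
    using FC_carrier by (simp add: dual_zero)
  ultimately show ?case by blast
next
  case (insert j S)
  have IDc: "w \<in> functionals k V" if "w \<in> ID" for w
    using subgroup.subset[OF ID_subgroup] that by (auto simp: carrier_dual)
  obtain w where w: "w \<in> ID" "\<forall>x\<in>FC n. (\<Oplus>m\<in>S. t m x) = w x" using insert by blast
  obtain v where v: "v \<in> ID" "\<forall>x\<in>FC n. t j x = v x" using insert by blast
  have vw: "v \<oplus>\<^bsub>D\<^esub> w \<in> ID" using subgroup.m_closed[OF ID_subgroup v(1) w(1)] by simp
  have tc: "t m x \<in> carrier k" if m: "m \<in> insert j S" and x: "x \<in> FC n" for m x
  proof -
    obtain w where "w \<in> ID" "\<forall>x\<in>FC n. t m x = w x" using insert.prems[OF m] by blast
    then show ?thesis using functional_closed[OF IDc, of w x] x FC_carrier by simp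
  qed
  have "(\<Oplus>m\<in>insert j S. t m x) = (v \<oplus>\<^bsub>D\<^esub> w) x" if x: "x \<in> FC n" for x
  proof -
    have "(\<Oplus>m\<in>insert j S. t m x) = t j x \<oplus> (\<Oplus>m\<in>S. t m x)"
      using insert.hyps tc[OF _ x] by (intro R.finsum_insert) auto
    then show ?thesis using w v x FC_carrier by (simp add: dual_add)
  qed
  then show ?case using vw by blast
qed

text \<open>Both \<open>\<phi>\<close> and zero lie in the subgroup divided out in the target, so
  the canonical map sends their pure tensors with 1 to the same coset, and injectivity identifies
  the two tensors. Comparing with the tensor of zero keeps both sides within the formula for pure
  tensors.\<close>

lemma level_frag_in_kernel:
  assumes lev: "level k GA g\<epsilon> GC (gr_filt C FC) s"
    and \<phi>: "\<phi> \<in> carrier GD" "\<And>x. x \<in> gr_filt C FC s \<Longrightarrow> \<phi> x = \<zero>"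
  shows "frag_of (\<phi>, \<one>) - frag_of (\<zero>\<^bsub>GD\<^esub>, \<one>) \<in> tensor_kernel GA GD GK"
proof -
  interpret GD: abelian_group GD by (rule GD_abelian_group)
  interpret GV: module k GV by (rule GV_module)
  interpret T: tensor GA GD GK by (rule GD_tensor)
  let ?H = "dual_filt k GA GC (gr_filt C FC) (1 - s)"
  have H: "?H = {\<phi> \<in> carrier GD. \<forall>x\<in>gr_filt C FC s. \<phi> x = \<zero>}"
    using dual_filt_eq[where F = "gr_filt C FC" and p = "1 - s", OF GV_module gr_filt_submodule] by simp
  have grc: "gr_filt C FC s \<subseteq> carrier GC" by (auto simp: gr_filt_def GC_carrier)
  have sub: "abelian_subgroup ?H GD"
  proof (intro abelian_subgroupI3 additive_subgroup.intro GD_abelian_group GD.add.subgroupI)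
    show "?H \<noteq> {}" using grc by (auto simp: H dual_zero intro!: exI[of _ "\<zero>\<^bsub>GD\<^esub>"] GD.zero_closed[unfolded dual_zero])
    fix a assume "a \<in> ?H"
    then show "\<ominus>\<^bsub>GD\<^esub> a \<in> ?H"
      using grc GD.a_inv_closed[of a] dual_minus[OF GV_module, of a] by (auto simp: H subset_iff)
  next
    fix a b assume "a \<in> ?H" "b \<in> ?H"
    then show "a \<oplus>\<^bsub>GD\<^esub> b \<in> ?H"
      using grc GD.a_closed[of a b] by (auto simp: H dual_add subset_iff)
  qed (auto simp: H)
  have mem: "\<phi> \<in> ?H" "\<zero>\<^bsub>GD\<^esub> \<in> ?H"
    using \<phi> grc GD.zero_closed by (auto simp: H dual_zero subset_iff)
  \<comment> \<open>The identity law for 1 comes from the \<open>k\<close>-module \<open>GV\<close>,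
    as the unit of \<open>GA\<close> acts on \<open>GC\<close> through it.\<close>
  have one: "\<one> \<odot>\<^bsub>restrict_scalars k GA GD\<^esub> \<psi> = \<psi>" if \<psi>: "\<psi> \<in> carrier GD" for \<psi>
  proof
    fix x
    have l: "\<psi> \<in> functionals k GV" using \<psi> by (simp add: carrier_dual)
    have "(\<one> \<odot>\<^bsub>GA\<^esub> \<one>\<^bsub>GA\<^esub>) \<odot>\<^bsub>GC\<^esub> x = x" if "x \<in> carrier GC"
      using GV.smult_one[of x] that by (simp add: smult_restrict_scalars)
    then show "(\<one> \<odot>\<^bsub>restrict_scalars k GA GD\<^esub> \<psi>) x = \<psi> x"
      using functional_extensional[OF l] by (simp add: smult_restrict_scalars dual_smult extensional_def)
  qed
  from lev obtain \<theta> where inj: "inj_on \<theta> (carrier T.T)"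
    and \<theta>': "\<forall>f\<in>carrier GD. \<forall>c\<in>carrier k.
      \<theta> (pure_tensor GA GD GK f c) = ?H +>\<^bsub>GD\<^esub> (c \<odot>\<^bsub>restrict_scalars k GA GD\<^esub> f)"
    unfolding level_def Let_def bij_betw_def by (elim bexE conjE)
  note \<theta> = \<theta>'[rule_format]
  have z: "\<zero>\<^bsub>GD\<^esub> \<in> carrier GD" by simp
  have "\<theta> (T.cl (frag_of (\<phi>, \<one>))) = \<theta> (T.cl (frag_of (\<zero>\<^bsub>GD\<^esub>, \<one>)))"
    using \<theta>[OF \<phi>(1) R.one_closed] \<theta>[OF z R.one_closed]
      abelian_subgroup.a_rcos_const[OF sub mem(1)] abelian_subgroup.a_rcos_const[OF sub mem(2)]
    unfolding one[OF \<phi>(1)] one[OF z] pure_tensor_def by simp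
  moreover have "T.cl (frag_of (\<phi>, \<one>)) \<in> carrier T.T" "T.cl (frag_of (\<zero>\<^bsub>GD\<^esub>, \<one>)) \<in> carrier T.T"
    using \<phi>(1) z by (auto simp: T.carrier_tensor carrier_residue_module)
  ultimately have "T.cl (frag_of (\<phi>, \<one>)) = T.cl (frag_of (\<zero>\<^bsub>GD\<^esub>, \<one>))"
    using inj by (meson inj_onD)
  then show ?thesis by (simp add: T.tensor_class_eq_iff)
qed

text \<open>Send (\<psi>, c) to the function x \<mapsto> c \<psi>(class of x in degree n) on
  \<open>FC n\<close>. Modulo restrictions of elements of \<open>ID\<close> this respects every
  tensor relation, so an element of the relation subgroup goes to such a restriction. Applied to the
  given difference, this is the claim about \<open>\<phi>\<close>.\<close>

lemma tensor_kernel_restriction: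
  assumes lift: "\<forall>m. \<forall>\<psi>\<in>functionals k (submodule_of V (FC m)).
      \<exists>\<Psi>\<in>carrier D. \<forall>y\<in>FC m. \<Psi> y = \<psi> y"
    and \<phi>: "\<phi> \<in> carrier GD"
    and ker: "frag_of (\<phi>, \<one>) - frag_of (\<zero>\<^bsub>GD\<^esub>, \<one>) \<in> tensor_kernel GA GD GK"
  shows "\<exists>w\<in>ID. \<forall>x\<in>FC n. \<phi> (\<iota>\<^sub>Q n (cls n x)) = w x"
proof -
  interpret D: module A D by (rule D_module)
  interpret GD: abelian_group GD by (rule GD_abelian_group)
  interpret T: tensor GA GD GK by (rule GD_tensor)
  have K: "carrier GK = carrier k" "add GK = add k"
    "smult GK = (\<lambda>a c. g\<epsilon> a \<otimes> c)"
    by (simp_all add: residue_module_def)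
  define \<iota> where "\<iota> = (\<lambda>x. \<iota>\<^sub>Q n (cls n x))"
  have \<iota>c: "\<iota> x \<in> carrier GC" if "x \<in> FC n" for x
    unfolding \<iota>_def using that by (intro homogeneous_closed cls_closed)
  have lin: "\<psi> \<in> functionals k GV" if "\<psi> \<in> carrier GD" for \<psi> using that by (simp add: carrier_dual)
  have \<psi>c: "\<psi> (\<iota> x) \<in> carrier k" if "\<psi> \<in> carrier GD" "x \<in> FC n" for \<psi> x
    using functional_closed[OF lin[OF that(1)]] \<iota>c[OF that(2)] by simp
  \<comment> \<open>All functions from \<open>FC n\<close> to \<open>k\<close>, as a product of
    copies of the additive group; linearity is not recorded in the target, so the product group
    supplies all group laws.\<close>
  define B where "B = product_group (FC n) (\<lambda>_. add_monoid k)"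
  have gk: "group (add_monoid k)" by (rule R.a_group)
  have Bc: "carrier B = FC n \<rightarrow>\<^sub>E carrier k" by (simp add: B_def)
  have Bm: "u \<otimes>\<^bsub>B\<^esub> v = (\<lambda>x\<in>FC n. u x \<oplus> v x)" for u v by (simp add: B_def)
  have Bi: "inv\<^bsub>B\<^esub> u = (\<lambda>x\<in>FC n. \<ominus> u x)" if "u \<in> carrier B" for u
    using that gk by (simp add: B_def a_inv_def)
  have Bgroup: "group B" using gk by (simp add: B_def)
  have Bcomm: "comm_group B"
    by (rule group.group_comm_groupI[OF Bgroup]) (auto simp: Bm Bc R.a_comm PiE_iff intro!: restrict_ext)
  interpret B: comm_group B by (rule Bcomm)
  define W where "W = {u \<in> carrier B. \<exists>w\<in>ID. \<forall>x\<in>FC n. u x = w x}"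
  have IDc: "w \<in> carrier D" if "w \<in> ID" for w
    using subgroup.subset[OF ID_subgroup] that by auto
  have zID: "\<zero>\<^bsub>D\<^esub> \<in> ID" using subgroup.one_closed[OF ID_subgroup] by simp
  have W: "subgroup W B"
  proof (rule B.subgroupI)
    have B_one: "\<forall>x\<in>FC n. \<one>\<^bsub>B\<^esub> x = \<zero>\<^bsub>D\<^esub> x" using FC_carrier by (simp add: B_def dual_zero)
    have "\<one>\<^bsub>B\<^esub> \<in> W"
      using B_one B.one_closed zID unfolding W_def by blast
    then show "W \<noteq> {}" by blast
    fix u assume u: "u \<in> W"
    then obtain w where w: "w \<in> ID" "\<And>x. x \<in> FC n \<Longrightarrow> u x = w x" and uB: "u \<in> carrier B" by (auto simp: W_def)
    have "\<ominus>\<^bsub>D\<^esub> w \<in> ID" using subgroup.m_inv_closed[OF ID_subgroup w(1)] by (simp add: a_inv_def)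
    moreover have "(inv\<^bsub>B\<^esub> u) x = (\<ominus>\<^bsub>D\<^esub> w) x" if "x \<in> FC n" for x
      using that w FC_carrier uB by (simp add: Bi dual_minus[OF V_module IDc[OF w(1)]])
    ultimately show "inv\<^bsub>B\<^esub> u \<in> W" using B.inv_closed[OF uB] by (auto simp: W_def)
    fix v assume v: "v \<in> W"
    then obtain w' where w': "w' \<in> ID" "\<And>x. x \<in> FC n \<Longrightarrow> v x = w' x" and vB: "v \<in> carrier B" by (auto simp: W_def)
    have "w \<oplus>\<^bsub>D\<^esub> w' \<in> ID" using subgroup.m_closed[OF ID_subgroup w(1) w'(1)] by simp
    moreover have "(u \<otimes>\<^bsub>B\<^esub> v) x = (w \<oplus>\<^bsub>D\<^esub> w') x" if "x \<in> FC n" for x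
      using that w w' FC_carrier by (simp add: Bm dual_add)
    ultimately show "u \<otimes>\<^bsub>B\<^esub> v \<in> W" using B.m_closed[OF uB vB] by (auto simp: W_def)
  qed (auto simp: W_def)
  define h0 where "h0 = (\<lambda>(\<psi>, c). \<lambda>x\<in>FC n. c \<otimes> \<psi> (\<iota> x))"
  have h0c: "h0 (\<psi>, c) \<in> carrier B" if "\<psi> \<in> carrier GD" "c \<in> carrier k" for \<psi> c
    using that \<psi>c by (auto simp: h0_def Bc)
  then have "h0 ` T.S \<subseteq> carrier B" by (auto simp: K)
  then obtain h where h: "h \<in> hom T.Fr B" and h_of': "\<And>p. p \<in> T.S \<Longrightarrow> h (frag_of p) = h0 p"
    using B.free_Abelian_group_universal by blast
  have h_of: "h (frag_of (\<psi>, c)) = h0 (\<psi>, c)" if "\<psi> \<in> carrier GD" "c \<in> carrier k" for \<psi> c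
    using h_of' that by (simp add: K)
  interpret h: group_hom T.Fr B h
    using h Bgroup by (simp add: group_hom_def group_hom_axioms_def)
  have h_diff: "h (z - w) = h z \<otimes>\<^bsub>B\<^esub> inv\<^bsub>B\<^esub> h w"
    if "supp z \<subseteq> T.S" "supp w \<subseteq> T.S" for z w
    using h.hom_mult[of z "- w"] h.hom_inv[of w] that by simp
  have fr: "supp (frag_of (\<psi>, c) :: _ \<Rightarrow>\<^sub>0 int) \<subseteq> T.S" if "\<psi> \<in> carrier GD" "c \<in> carrier k" for \<psi> c
    using that by (simp add: K)
  have dk: "supp (z - w) \<subseteq> T.S" if "supp z \<subseteq> T.S" "supp w \<subseteq> T.S"
    for z w :: "_ \<Rightarrow>\<^sub>0 int"
    using that keys_diff[of z w] by blast
  have canc: "(u \<otimes>\<^bsub>B\<^esub> v) \<otimes>\<^bsub>B\<^esub> inv\<^bsub>B\<^esub> u \<otimes>\<^bsub>B\<^esub> inv\<^bsub>B\<^esub> v = \<one>\<^bsub>B\<^esub>" if "u \<in> carrier B" "v \<in> carrier B" for u v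
    using that B.r_inv[of "u \<otimes>\<^bsub>B\<^esub> v"] by (simp add: B.m_assoc B.inv_mult)
  \<comment> \<open>The degree 0 part of \<open>a\<close> is the scalar
    \<open>g\<epsilon> a\<close>, and its contribution cancels against the second term. What remains
    comes from positive degrees, where representatives lie in \<open>FA 1\<close>.\<close>
  have rel3: "h0 (a \<odot>\<^bsub>GD\<^esub> \<psi>, c) \<otimes>\<^bsub>B\<^esub> inv\<^bsub>B\<^esub> h0 (\<psi>, g\<epsilon> a \<otimes> c) \<in> W"
    if a: "a \<in> carrier GA" and \<psi>: "\<psi> \<in> carrier GD" and c: "c \<in> carrier k" for a \<psi> c
  proof -
    note e = gr_augmentation_closed[OF a]
    let ?e = "g\<epsilon> a"
    note \<psi>l = lin[OF \<psi>]
    have "\<forall>i. \<exists>b. b \<in> FA i \<and> a i = FA (i + 1) +>\<^bsub>A\<^esub> b"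
      using GA_comp[OF a] unfolding QA_carrier by blast
    from choice[OF this] obtain b where b': "\<forall>i. b i \<in> FA i \<and> a i = FA (i + 1) +>\<^bsub>A\<^esub> b i"
      by (elim exE)
    have b: "b i \<in> FA i" "a i = FA (i + 1) +>\<^bsub>A\<^esub> b i" for i
      by (rule conjunct1[OF spec[OF b']], rule conjunct2[OF spec[OF b']])
    \<comment> \<open>The degrees n + i reached from degree n by nonzero components of
      \<open>a\<close> with i different from 0. The set depends on \<open>a\<close> alone, not on
      \<open>x\<close>.\<close>
    let ?S = "(\<lambda>i. n + i) ` ({i. a i \<noteq> \<zero>\<^bsub>QA i\<^esub>} - {0})"
    have S: "finite ?S" "n \<notin> ?S"
      by (intro finite_imageI finite_Diff GA_finite[OF a]) (simp add: image_iff)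
    let ?t = "\<lambda>m x. \<psi> (\<iota>\<^sub>Q m (cls m (b (m - n) \<odot>\<^bsub>C\<^esub> x)))"
    have bx: "b (m - n) \<odot>\<^bsub>C\<^esub> x \<in> FC m" if "x \<in> FC n" for m x
      using FC_smult[OF b(1) that] by simp
    have tc: "?t m x \<in> carrier k" if "x \<in> FC n" for m x
      using functional_closed[OF \<psi>l] homogeneous_closed[OF cls_closed[OF bx[OF that]]] by simp
    have expand: "\<psi> (a \<odot>\<^bsub>GC\<^esub> \<iota> x) = ?e \<otimes> \<psi> (\<iota> x) \<oplus> (\<Oplus>m\<in>?S. ?t m x)" if x: "x \<in> FC n" for x
    proof -
      let ?y = "a \<odot>\<^bsub>GC\<^esub> \<iota> x"
      have y: "?y m = gact (m - n) n (a (m - n)) (cls n x)" for m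
        unfolding \<iota>_def by (rule GC_smult_homogeneous[OF a cls_closed[OF x]])
      have y_cls: "?y m = cls m (b (m - n) \<odot>\<^bsub>C\<^esub> x)" for m
        using gact_coset[OF b(1) x, of "m - n"] by (simp add: y b(2)[symmetric])
      have yc: "?y \<in> carrier GC" by (rule GC_smult_closed[OF a \<iota>c[OF x]])
      have y0: "?y m = \<zero>\<^bsub>kQ m\<^esub>" if "m \<notin> insert n ?S" for m
      proof -
        have "a (m - n) = \<zero>\<^bsub>QA (m - n)\<^esub>"
        proof (rule ccontr)
          assume "a (m - n) \<noteq> \<zero>\<^bsub>QA (m - n)\<^esub>"
          moreover have "m - n \<noteq> 0" using that by auto
          ultimately have "n + (m - n) \<in> ?S" by blast
          then show False using that by simp
        qed
        then show ?thesis using gact_zero_left[OF cls_closed[OF x], of "m - n"] by (simp add: y)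
      qed
      \<comment> \<open>\<open>?y\<close> has components only in degree n and in \<open>?S\<close>.
        Degree n is inserted separately because the degree 0 component of \<open>a\<close> may or
        may not be zero.\<close>
      have "\<psi> ?y = (\<Oplus>m\<in>insert n ?S. \<psi> (\<iota>\<^sub>Q m (?y m)))"
      proof (rule functional_direct_sum[where M = kQ, OF R_cring kQ_module])
        show "\<psi> \<in> carrier (direct_sum kQ) \<rightarrow> carrier k"
          using functional_closed[OF \<psi>l] by (auto simp: direct_sum_kQ)
        show "\<psi> (u \<oplus>\<^bsub>direct_sum kQ\<^esub> v) = \<psi> u \<oplus> \<psi> v"
          if "u \<in> carrier (direct_sum kQ)" "v \<in> carrier (direct_sum kQ)" for u v
          using functional_add[OF \<psi>l, of u v] that by (simp add: direct_sum_kQ)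
      qed (use S yc y0 in \<open>simp_all add: direct_sum_kQ\<close>)
      also have "\<dots> = (\<Oplus>m\<in>insert n ?S. ?t m x)" by (simp only: y_cls)
      also have "\<dots> = ?t n x \<oplus> (\<Oplus>m\<in>?S. ?t m x)"
        using S tc[OF x] tc[OF x, of n] by (intro R.finsum_insert) auto
      also have "?t n x = \<psi> (\<iota>\<^sub>Q n (?y n))" by (simp only: y_cls)
      also have "?y n = (?e \<odot>\<^bsub>A\<^esub> \<one>\<^bsub>A\<^esub>) \<odot>\<^bsub>Q n\<^esub> cls n x"
      proof -
        have "?e \<odot>\<^bsub>A\<^esub> \<one>\<^bsub>A\<^esub> \<in> FA 0" using filt_nonpos[of 0] e(1) by simp
        from gact_coset[OF this x] show ?thesis using e x by (simp add: y Q_smult)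
      qed
      also have "\<psi> (\<iota>\<^sub>Q n \<dots>) = ?e \<otimes> \<psi> (\<iota> x)"
        using homogeneous_smult[OF cls_closed[OF x] e(1)] functional_smult[OF \<psi>l e(1), of "\<iota> x"] \<iota>c[OF x]
        by (simp add: \<iota>_def)
      finally show ?thesis .
    qed
    have "\<exists>w\<in>ID. \<forall>x\<in>FC n. (\<Oplus>m\<in>?S. c \<otimes> ?t m x) = w x"
    proof (rule finsum_restriction[OF S(1)])
      fix m assume m: "m \<in> ?S"
      then have "m - n \<noteq> 0" "a (m - n) \<noteq> \<zero>\<^bsub>QA (m - n)\<^esub>" by auto
      \<comment> \<open>Degree 0 was removed from the index set and negative components of
        \<open>a\<close> are zero.\<close>
      then have "1 \<le> m - n" using negative_QA[OF _ GA_comp[OF a]] by (meson int_one_le_iff_zero_less linorder_neqE_linordered_idom)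
      then have b1: "b (m - n) \<in> FA 1" using b(1) filt_decreasing by blast
      \<comment> \<open>Here local freeness enters: the part of \<open>\<psi>\<close> in degree m,
        seen on \<open>FC m\<close>, becomes the restriction of a functional on all of
        \<open>C\<close>.\<close>
      obtain \<Psi> where \<Psi>: "\<Psi> \<in> carrier D"
        and \<Psi>_eq: "\<forall>y\<in>FC m. \<Psi> y = (\<lambda>y\<in>FC m. \<psi> (\<iota>\<^sub>Q m (cls m y))) y"
        using lift[rule_format, OF functional_gr_lift[OF \<psi>, of m]] by (elim bexE)
      let ?s = "c \<odot>\<^bsub>A\<^esub> \<one>\<^bsub>A\<^esub>"
      have sA: "?s \<in> carrier A" using c by simp
      have sb: "?s \<otimes>\<^bsub>A\<^esub> b (m - n) \<in> FA 1" using ideal.I_l_closed[OF filt_ideal b1 sA] .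
      \<comment> \<open>The scalar \<open>c\<close> is put into the algebra factor, which stays in
        the ideal \<open>FA 1\<close>, so that \<open>?w\<close> is itself one of the generators of
        \<open>ID\<close>.\<close>
      let ?w = "(?s \<otimes>\<^bsub>A\<^esub> b (m - n)) \<odot>\<^bsub>D\<^esub> \<Psi>"
      have "?w \<in> ID" using sb \<Psi> by (intro generate.incl) blast
      moreover have "c \<otimes> ?t m x = ?w x" if x: "x \<in> FC n" for x
      proof -
        have \<Psi>l: "\<Psi> \<in> functionals k V" using \<Psi> by (simp add: carrier_dual)
        have "?w x = \<Psi> (c \<odot>\<^bsub>V\<^esub> (b (m - n) \<odot>\<^bsub>C\<^esub> x))"
          using FC_carrier[OF x] sA FA_carrier[OF b1]
          by (simp add: dual_smult smult_restrict_scalars C.smult_assoc1)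
        also have "\<dots> = c \<otimes> \<Psi> (b (m - n) \<odot>\<^bsub>C\<^esub> x)"
          using functional_smult[OF \<Psi>l c] FC_carrier[OF bx[OF x]] by simp
        also have "\<dots> = c \<otimes> ?t m x" using \<Psi>_eq bx[OF x] by simp
        finally show ?thesis by simp
      qed
      ultimately show "\<exists>w\<in>ID. \<forall>x\<in>FC n. c \<otimes> ?t m x = w x" by blast
    qed
    then obtain w where w: "w \<in> ID" "\<And>x. x \<in> FC n \<Longrightarrow> (\<Oplus>m\<in>?S. c \<otimes> ?t m x) = w x" by blast
    let ?u = "h0 (a \<odot>\<^bsub>GD\<^esub> \<psi>, c) \<otimes>\<^bsub>B\<^esub> inv\<^bsub>B\<^esub> h0 (\<psi>, ?e \<otimes> c)"
    have ec: "?e \<otimes> c \<in> carrier k" using e(1) c by simp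
    have "?u x = w x" if x: "x \<in> FC n" for x
    proof -
      let ?p = "\<psi> (\<iota> x)" and ?\<Sigma> = "\<Oplus>m\<in>?S. ?t m x"
      have p: "?p \<in> carrier k" using \<psi>c[OF \<psi> x] .
      have \<Sigma>: "?\<Sigma> \<in> carrier k" using tc[OF x] by (intro R.finsum_closed) auto
      have "?u x = c \<otimes> \<psi> (a \<odot>\<^bsub>GC\<^esub> \<iota> x) \<oplus> \<ominus> (?e \<otimes> c \<otimes> ?p)"
        using x h0c[OF \<psi> ec] \<iota>c[OF x] by (simp add: Bm Bi) (simp add: h0_def dual_smult)
      also have "\<dots> = c \<otimes> ?\<Sigma>"
      proof -
        have "c \<otimes> \<psi> (a \<odot>\<^bsub>GC\<^esub> \<iota> x) = c \<otimes> ?\<Sigma> \<oplus> ?e \<otimes> c \<otimes> ?p"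
          unfolding expand[OF x] using p \<Sigma> c e(1) by (simp add: R.r_distr R.m_ac R.a_comm)
        then show ?thesis using p \<Sigma> c e(1) ec by (simp add: R.a_assoc R.r_neg)
      qed
      also have "\<dots> = (\<Oplus>m\<in>?S. c \<otimes> ?t m x)"
        using S(1) c tc[OF x] by (intro R.finsum_rdistr) auto
      finally show ?thesis using w(2)[OF x] by simp
    qed
    moreover have "?u \<in> carrier B" using h0c[OF \<psi> ec] h0c[OF GD_smult_closed[OF a \<psi>] c] by simp
    ultimately show ?thesis using w(1) by (auto simp: W_def)
  qed
  \<comment> \<open>Both additivity relations go to the unit of \<open>B\<close>; the balancing
    relation is covered by \<open>rel3\<close>.\<close>
  have "h (frag_of (\<phi>, \<one>) - frag_of (\<zero>\<^bsub>GD\<^esub>, \<one>)) \<in> W"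
  proof (rule T.hom_tensor_kernel[OF Bgroup h W _ ker])
    have oneW: "\<one>\<^bsub>B\<^esub> \<in> W" by (rule subgroup.one_closed[OF W])
    fix z assume "z \<in> tensor_rels GA GD GK"
    then show "h z \<in> W"
    proof (cases rule: T.tensor_relsE)
      case (left x x' y)
      have "h0 (x \<oplus>\<^bsub>GD\<^esub> x', y) = h0 (x, y) \<otimes>\<^bsub>B\<^esub> h0 (x', y)"
        using left[unfolded K] \<iota>c \<psi>c by (auto simp: h0_def Bm dual_add R.r_distr intro!: restrict_ext)
      then show ?thesis
        using left[unfolded K] fr dk h0c oneW by (simp add: h_diff h_of canc)
    next
      case (right x y y')
      have "h0 (x, y \<oplus> y') = h0 (x, y) \<otimes>\<^bsub>B\<^esub> h0 (x, y')"
        using right[unfolded K] \<psi>c by (auto simp: h0_def Bm R.l_distr intro!: restrict_ext)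
      then show ?thesis
        using right[unfolded K] fr dk h0c oneW by (simp add: h_diff h_of canc)
    next
      case (smult a x y)
      show ?thesis
        using smult[unfolded K] fr rel3 GD_smult_closed gr_augmentation_closed(1)
        by (simp add: h_diff h_of)
    qed
  qed
  then obtain w where w: "w \<in> ID"
    and w_eq: "\<And>x. x \<in> FC n \<Longrightarrow> h (frag_of (\<phi>, \<one>) - frag_of (\<zero>\<^bsub>GD\<^esub>, \<one>)) x = w x"
    by (auto simp: W_def)
  have "\<phi> (\<iota> x) = w x" if x: "x \<in> FC n" for x
  proof -
    \<comment> \<open>The subtracted generator contributes the zero function, which leaves the
      values of \<open>\<phi>\<close>.\<close>
    have "w x = (h0 (\<phi>, \<one>) \<otimes>\<^bsub>B\<^esub> inv\<^bsub>B\<^esub> h0 (\<zero>\<^bsub>GD\<^esub>, \<one>)) x"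
      using w_eq[OF x] \<phi> fr by (simp add: h_diff h_of)
    also have "\<dots> = \<one> \<otimes> \<phi> (\<iota> x) \<oplus> \<ominus> (\<one> \<otimes> \<zero>)"
      using x h0c[OF GD.zero_closed R.one_closed] \<iota>c[OF x] by (simp add: Bm Bi) (simp add: h0_def dual_zero)
    also have "\<dots> = \<phi> (\<iota> x)" using \<psi>c[OF \<phi> x] by simp
    finally show ?thesis by simp
  qed
  then show ?thesis using w by (auto simp: \<iota>_def)
qed

lemma gr_functional:
  assumes f: "f \<in> carrier D" and f0: "\<forall>x\<in>FC (n + 1). f x = \<zero>"
  shows "\<exists>\<phi>\<in>carrier GD. \<forall>X\<in>carrier GC. \<forall>x\<in>FC n. X n = cls n x \<longrightarrow> \<phi> X = f x"
proof -
  have fl: "f \<in> functionals k V" using f by (simp add: carrier_dual)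
  have f_eq: "f x = f y" if xy: "x \<in> FC n" "y \<in> FC n" "cls n x = cls n y" for x y
  proof -
    note c = FC_carrier[OF xy(1)] FC_carrier[OF xy(2)]
    have "f (x \<ominus>\<^bsub>C\<^esub> y) = \<zero>" using coset_eq_iff[OF modC FC_sub c] xy(3) f0 by blast
    moreover have "f (x \<oplus>\<^bsub>V\<^esub> (\<ominus>\<^bsub>V\<^esub> y)) = f x \<oplus> \<ominus> f y"
      using functional_add[OF fl, of x "\<ominus>\<^bsub>V\<^esub> y"] functional_minus[OF fl V_module, of y] c by simp
    ultimately have "f x \<oplus> \<ominus> f y = \<zero>" by (simp add: a_minus_def)
    then show ?thesis
      using functional_closed[OF fl] c
      by (metis R.minus_equality R.minus_minus R.a_inv_closed carrier_restrict_scalars)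
  qed
  \<comment> \<open>Extension by zero amounts to looking at the component in degree n alone. Since
    \<open>f\<close> kills \<open>FC (n + 1)\<close>, the chosen representative of that component
    does not matter.\<close>
  define \<phi> where "\<phi> = (\<lambda>X\<in>carrier GC. f (SOME x. x \<in> FC n \<and> X n = cls n x))"
  have \<phi>: "\<phi> X = f x" if "X \<in> carrier GC" "x \<in> FC n" "X n = cls n x" for X x
  proof -
    let ?y = "SOME y. y \<in> FC n \<and> X n = cls n y"
    have "?y \<in> FC n \<and> X n = cls n ?y" by (rule someI[of _ x]) (use that in simp)
    then show ?thesis using f_eq[of ?y x] that by (simp add: \<phi>_def)
  qed
  interpret GV: module k GV by (rule GV_module)
  have ex: "\<exists>x\<in>FC n. X n = cls n x" if "X \<in> carrier GC" for X
    using that by (auto simp: GC_carrier carrier_direct_sum Q_carrier)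
  have "\<phi> \<in> functionals k GV"
    unfolding functionals_iff
  proof (intro conjI ballI)
    show "\<phi> \<in> extensional (carrier GV)" by (simp add: \<phi>_def)
    fix X assume "X \<in> carrier GV"
    then have X: "X \<in> carrier GC" by simp
    then obtain x where x: "x \<in> FC n" "X n = cls n x" using ex by blast
    show "\<phi> X \<in> carrier k" using \<phi>[OF X x] functional_closed[OF fl] FC_carrier[OF x(1)] by simp
    {
      fix Y assume "Y \<in> carrier GV"
      then have Y: "Y \<in> carrier GC" by simp
      then obtain y where y: "y \<in> FC n" "Y n = cls n y" using ex by blast
      have "\<phi> (X \<oplus>\<^bsub>GC\<^esub> Y) = f (x \<oplus>\<^bsub>C\<^esub> y)"
        using GV.M.a_closed[of X Y] X Y x y C.submoduleE(5)[OF FC_sub x(1) y(1)]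
        by (intro \<phi>) (simp_all add: GC_add Q_add)
      then show "\<phi> (X \<oplus>\<^bsub>GV\<^esub> Y) = \<phi> X \<oplus> \<phi> Y"
        using \<phi>[OF X x] \<phi>[OF Y y] functional_add[OF fl, of x y] x y FC_carrier by simp
    }
  next
    fix c X assume c: "c \<in> carrier k" and "X \<in> carrier GV"
    then have X: "X \<in> carrier GC" by simp
    then obtain x where x: "x \<in> FC n" "X n = cls n x" using ex by blast
    have s: "c \<odot>\<^bsub>A\<^esub> \<one>\<^bsub>A\<^esub> \<in> carrier A" using c by simp
    have "\<phi> (c \<odot>\<^bsub>GV\<^esub> X) = f ((c \<odot>\<^bsub>A\<^esub> \<one>\<^bsub>A\<^esub>) \<odot>\<^bsub>C\<^esub> x)"
      using GV.smult_closed[OF c, of X] X x C.submoduleE(4)[OF FC_sub s x(1)]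
      by (intro \<phi>) (simp_all add: GV_smult[OF c X] Q_smult[OF s])
    then show "\<phi> (c \<odot>\<^bsub>GV\<^esub> X) = c \<otimes> \<phi> X"
      using \<phi>[OF X x] functional_smult[OF fl c, of x] x FC_carrier by (simp add: smult_restrict_scalars)
  qed
  then show ?thesis using \<phi> by (intro bexI[of _ \<phi>]) (simp_all add: carrier_dual)
qed

lemma graded_level_step:
  assumes lift: "\<forall>m. \<forall>\<psi>\<in>functionals k (submodule_of V (FC m)).
      \<exists>\<Psi>\<in>carrier D. \<forall>y\<in>FC m. \<Psi> y = \<psi> y"
    and lev: "level k GA g\<epsilon> GC (gr_filt C FC) s"
    and n: "n < s" and f: "f \<in> carrier D" and f0: "\<forall>x\<in>FC (n + 1). f x = \<zero>"
  shows "\<exists>w\<in>ID. \<forall>x\<in>FC n. f x = w x"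
proof -
  obtain \<phi> where \<phi>: "\<phi> \<in> carrier GD"
    and \<phi>_all: "\<forall>X\<in>carrier GC. \<forall>x\<in>FC n. X n = cls n x \<longrightarrow> \<phi> X = f x"
    using gr_functional[OF f f0] by (elim bexE)
  note \<phi>_eq = \<phi>_all[rule_format]
  have z: "\<zero>\<^bsub>C\<^esub> \<in> FC m" for m
    using subgroup.one_closed[OF submodule.axioms(1)[OF FC_sub]] by simp
  have "\<phi> X = \<zero>" if X: "X \<in> gr_filt C FC s" for X
  proof -
    \<comment> \<open>Because n < s, an element of the s-th filtration step has zero component in
      degree n, and zero of \<open>C\<close> represents it.\<close>
    have "X \<in> carrier GC" "X n = cls n \<zero>\<^bsub>C\<^esub>"
      using X n Q_eq_zero_iff[OF z] z by (simp_all add: gr_filt_def GC_carrier)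
    then show ?thesis using \<phi>_eq[OF _ z] f0 z by simp
  qed
  then have "frag_of (\<phi>, \<one>) - frag_of (\<zero>\<^bsub>GD\<^esub>, \<one>) \<in> tensor_kernel GA GD GK"
    by (rule level_frag_in_kernel[OF lev \<phi>])
  from tensor_kernel_restriction[OF lift \<phi> this, of n]
  obtain w where w: "w \<in> ID" "\<forall>x\<in>FC n. \<phi> (\<iota>\<^sub>Q n (cls n x)) = w x" by (elim bexE)
  have "\<phi> (\<iota>\<^sub>Q n (cls n x)) = f x" if "x \<in> FC n" for x
    using that by (intro \<phi>_eq homogeneous_closed cls_closed) (simp_all add: homogeneous_def)
  with w(2) have "\<forall>x\<in>FC n. f x = w x" by simp
  then show ?thesis by (rule bexI[OF _ w(1)])
qed

end

section \<open>Levelness descends from the associated graded module\<close>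

context filtered_pair
begin

text \<open>The functional is extended one filtration step at a time: each successive quotient is a
  locally free graded piece, and after finitely many steps down the filtration has become all of
  \<open>C\<close>.\<close>

lemma functional_lift:
  assumes noeth: "noetherian_ring k"
    and bot: "\<forall>n\<le>m0. FC n = carrier C"
    and lf: "\<forall>n. locally_free_of_rank k (kQ n) (h n)"
    and \<psi>: "\<psi> \<in> functionals k (submodule_of V (FC m))"
  shows "\<exists>\<Psi>\<in>carrier D. \<forall>y\<in>FC m. \<Psi> y = \<psi> y"
proof -
  have subV: "submodule (FC n) k V" for n
    by (rule submodule_restrict_scalars[OF alg modC FC_sub])
  have step: "\<exists>\<Psi>\<in>lin_maps k (submodule_of V (FC (m - int j))) (self_module k). \<forall>y\<in>FC m. \<Psi> y = \<psi> y" for j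
  proof (induction j)
    case 0
    show ?case using \<psi> by auto
  next
    case (Suc j)
    let ?n = "m - int (Suc j)"
    let ?M = "submodule_of V (FC ?n)"
    have n1: "?n + 1 = m - int j" by simp
    have dec: "FC (m - int j) \<subseteq> FC ?n" using FC_dec[of ?n] by (simp only: n1)
    from Suc.IH obtain \<Psi> where \<Psi>: "\<Psi> \<in> lin_maps k (submodule_of V (FC (m - int j))) (self_module k)"
      and \<Psi>_eq: "\<forall>y\<in>FC m. \<Psi> y = \<psi> y" by (elim bexE)
    have M: "module k ?M" by (rule submodule_of_is_module[OF V_module subV])
    have N: "submodule (FC (m - int j)) k ?M"
      by (rule submodule_of_submodule[OF V_module subV subV dec])
    \<comment> \<open>Enlarging the domain from \<open>FC (m - int j)\<close> to the next lower step
      has quotient the piece in degree \<open>?n\<close>, one below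
      \<open>m - int j\<close>.\<close>
    have "kQ ?n = quot_module ?M (FC (m - int j))"
      unfolding kQ_def gr_piece_def restrict_scalars_quot_module restrict_scalars_submodule_of n1 ..
    then have "locally_free_of_rank k (quot_module ?M (FC (m - int j))) (h ?n)" using lf by metis
    moreover have "\<Psi> \<in> lin_maps k (submodule_of ?M (FC (m - int j))) (self_module k)"
      using \<Psi> by (simp add: submodule_of_def)
    ultimately obtain G where G: "G \<in> functionals k ?M"
      and G_eq: "\<forall>y\<in>FC (m - int j). G y = \<Psi> y"
      using functional_extension[OF R_cring noeth M N] by blast
    have "FC m \<subseteq> FC (m - int j)" by (rule C.filt_decreasing) simp
    then have "\<forall>y\<in>FC m. G y = \<psi> y" using G_eq \<Psi>_eq by auto
    then show ?case by (rule bexI[OF _ G])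
  qed
  \<comment> \<open>For m at most m0 the number of steps is 0 and \<open>FC m\<close> is already
    everything; otherwise the descent ends exactly at m0.\<close>
  have "FC (m - int (nat (m - m0))) = carrier C" using bot by simp
  moreover have "submodule_of V (carrier C) = V" by (simp add: submodule_of_def restrict_scalars_def)
  ultimately show ?thesis using step[of "nat (m - m0)"] by (simp add: carrier_dual)
qed

text \<open>Pieces of rank 0 vanish, so the filtration is constant from s + 1 on, and far out it is
  zero.\<close>

lemma filtration_vanishes_above:
  assumes noeth: "noetherian_ring k"
    and top: "\<forall>n\<ge>m1. FC n = {\<zero>\<^bsub>C\<^esub>}"
    and lf: "\<forall>n. locally_free_of_rank k (kQ n) (h n)"
    and h0: "\<forall>n>s. h n = 0"
  shows "FC (s + 1) = {\<zero>\<^bsub>C\<^esub>}"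
proof -
  have eq: "FC n = FC (n + 1)" if n: "n > s" for n
  proof
    show "FC n \<subseteq> FC (n + 1)"
    proof
      fix x assume x: "x \<in> FC n"
      have "locally_free_of_rank k (kQ n) 0" using lf h0 n by metis
      then have "cls n x = \<zero>\<^bsub>kQ n\<^esub>"
        using cls_closed[OF x] by (intro locally_free_of_rank_0[OF R_cring noeth kQ_module]) simp_all
      then show "x \<in> FC (n + 1)" using Q_eq_zero_iff[OF x] by simp
    qed
  qed (rule FC_dec)
  have "FC (s + 1) = FC (s + 1 + int j)" for j
  proof (induction j)
    case (Suc j)
    then show ?case using eq[of "s + 1 + int j"] by (simp add: algebra_simps)
  qed simp
  from this[of "nat (m1 - (s + 1))"] show ?thesis using top by simp
qed

lemma level_descends:
  assumes noeth: "noetherian_ring k"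
    and bot: "\<forall>n\<le>m0. FC n = carrier C" and top: "\<forall>n\<ge>m1. FC n = {\<zero>\<^bsub>C\<^esub>}"
    and lf: "\<forall>n. locally_free_of_rank k (kQ n) (h n)"
    and h0: "\<forall>n>s. h n = 0"
    and lev: "level k GA g\<epsilon> GC (gr_filt C FC) s"
  shows "level k A (augmentation k A FA) C FC s"
proof (rule level_if[OF modC FC_sub])
  interpret D: module A D by (rule D_module)
  show top': "FC (s + 1) = {\<zero>\<^bsub>C\<^esub>}" by (rule filtration_vanishes_above[OF noeth top lf h0])
  show "a \<odot>\<^bsub>C\<^esub> x = \<zero>\<^bsub>C\<^esub>" if "a \<in> FA 1" "x \<in> FC s" for a x
    using FC_smult[OF that, of "s + 1"] top' by simp
  have lift: "\<forall>m. \<forall>\<psi>\<in>functionals k (submodule_of V (FC m)).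
      \<exists>\<Psi>\<in>carrier D. \<forall>y\<in>FC m. \<Psi> y = \<psi> y"
    by (intro allI ballI functional_lift[OF noeth bot lf])
  \<comment> \<open>At n = s this is the \<open>gen\<close> assumption of \<open>level_if\<close>;
    the induction climbs from a step where the filtration is still all of \<open>C\<close>.\<close>
  define P where "P = (\<lambda>n. \<forall>f\<in>carrier D. (\<forall>x\<in>FC n. f x = \<zero>) \<longrightarrow> f \<in> ID)"
  have base: "P n" if n: "n \<le> m0" for n
    unfolding P_def
  proof (intro ballI impI)
    fix f assume f: "f \<in> carrier D" and f0: "\<forall>x\<in>FC n. f x = \<zero>"
    have "f = \<zero>\<^bsub>D\<^esub>"
    proof
      fix x
      have "f \<in> extensional (carrier C)"
        using f functional_extensional[of f k V] by (simp add: carrier_dual)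
      then show "f x = \<zero>\<^bsub>D\<^esub> x"
        using f0 bot n by (simp add: dual_zero extensional_def)
    qed
    then show "f \<in> ID" using subgroup.one_closed[OF ID_subgroup] by simp
  qed
  have step: "P (n + 1)" if n: "n < s" and Pn: "P n" for n
    unfolding P_def
  proof (intro ballI impI)
    fix f assume f: "f \<in> carrier D" and f0: "\<forall>x\<in>FC (n + 1). f x = \<zero>"
    obtain w where w: "w \<in> ID" and w_eq: "\<forall>x\<in>FC n. f x = w x"
      using graded_level_step[OF lift lev n f f0] by (elim bexE)
    have wD: "w \<in> carrier D" using subgroup.subset[OF ID_subgroup] w by auto
    have "(f \<ominus>\<^bsub>D\<^esub> w) x = \<zero>" if x: "x \<in> FC n" for x
    proof -
      have xC: "x \<in> carrier C" by (rule FC_carrier[OF x])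
      have "w x \<in> carrier k" using wD xC functional_closed[of w k V x] by (simp add: carrier_dual)
      moreover have "(f \<ominus>\<^bsub>D\<^esub> w) x = f x \<oplus> \<ominus> w x"
        using xC dual_minus[OF V_module wD xC] by (simp add: a_minus_def dual_add)
      ultimately show ?thesis using w_eq x by (simp add: R.r_neg)
    qed
    then have "f \<ominus>\<^bsub>D\<^esub> w \<in> ID" using Pn f wD unfolding P_def by simp
    from subgroup.m_closed[OF ID_subgroup this w]
    show "f \<in> ID" using f wD by (simp add: a_minus_def D.M.a_assoc D.M.l_neg)
  qed
  \<comment> \<open>The start has to satisfy the base case and must not lie beyond s, where
    \<open>step\<close> is no longer available; the minimum ensures both.\<close>
  have "P (min m0 s + int j)" if "min m0 s + int j \<le> s" for j
    using that
  proof (induction j)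
    case 0
    then show ?case using base[of "min m0 s"] by simp
  next
    case (Suc j)
    then have "P (min m0 s + int j + 1)" by (intro step) simp_all
    then show ?case by (simp add: algebra_simps)
  qed
  from this[of "nat (s - min m0 s)"] have "P s" by simp
  then show "{f \<in> carrier D. \<forall>x\<in>FC s. f x = \<zero>} \<subseteq> ID" unfolding P_def by blast
qed

end

lemma above_top_degree:
  assumes "finite {n. h n \<noteq> 0}" "n > top_degree h"
  shows "h n = 0"
proof (rule ccontr)
  assume "h n \<noteq> 0"
  then have "n \<le> top_degree h"
    unfolding top_degree_def using assms(1) by (intro le_cSup_finite) simp_all
  then show False using assms(2) by simp
qed

theorem mainTheorem19:
  fixes k :: "'k ring" and A :: "('k, 'a) module" and FA :: "int \<Rightarrow> 'a set"
    and C :: "('a, 'c) module" and FC :: "int \<Rightarrow> 'c set" and h :: "int \<Rightarrow> int"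
  assumes "cring k" and "noetherian_ring k"
    and "filtered_algebra k A FA"
    and "residue_map A FA \<in> ring_iso k (A Quot FA 1)"
    and "finite {n. h n \<noteq> 0}" and "\<exists>n. h n \<noteq> 0"
    and "AF k A FA h C FC"
    and "level k (gr_algebra A FA) (gr_augmentation k A FA)
           (gr_module A FA C FC) (gr_filt C FC) (top_degree h)"
  shows "level k A (augmentation k A FA) C FC (top_degree h)"
proof -
  have "residue_algebra k A FA"
    using assms(3,4) by (intro residue_algebra.intro residue_algebra_axioms.intro)
  moreover have "filtered_module A FA C FC" using assms(7) by (simp add: AF_def)
  ultimately interpret filtered_pair k A FA C FC by (rule filtered_pair.intro)
  from assms(7) obtain m0 m1 where "\<forall>n\<le>m0. FC n = carrier C" "\<forall>n\<ge>m1. FC n = {\<zero>\<^bsub>C\<^esub>}"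
    and "\<forall>n. locally_free_of_rank k (restrict_scalars k A (gr_piece C FC n)) (h n)"
    by (auto simp: AF_def)
  then show ?thesis
    unfolding kQ_def[symmetric] using level_descends[OF assms(2) _ _ _ _ assms(8)] above_top_degree[OF assms(5)] by blast
qed

end
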